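(* Let $\gamma:K^*\to K$ be a non-degenerate simplicial dynamical system on an everywhere $d$-dimensional polyhedron $X$ ($d\ge1$), with associated p.l. map $g$. With $v_0$ a positive distribution on ${}^dK$, let $\lambda_0=\sum_{s\in{}^dK}v_0(s)\lambda_s$ (a locally Lebesgue background measure on $X$). For each terminal $G$ basic set $B\subset{}^dK$, the measure $\lambda_B=\sum_{s\in B}v_B(s)\lambda_s$ is an ergodic $g$-invariant measure whose support is $\bigcup_{s\in B}s=\bigcup_{s^*\in B^*}s^*$, where $B^*$ is the associated $G^*$ basic set. Moreover, with background measure $\lambda_0$ and ergodic measures $\{\lambda_B\}$ indexed by the terminal $G$ basic sets, the system $(X,g)$ is tractable.
   Context: $\gamma:K^*\to K$ is a simplicial map with $K^*$ a proper subdivision of $K$ (every simplex of $K$ is a union of simplices of $K^*$ and no simplex of $K^*$ meets two disjoint simplices of $K$), non-degenerate ($\dim\gamma(s^* )=\dim s^*$); $g(x)=\sum_vb_v(x)\gamma(v)$ its p.l. map; $X=X(K)$ is a union of $d$-simplices. ${}^dK,{}^dK^*$ are the sets of $d$-simplices, $J:{}^dK^*\to{}^dK$ maps $s^*$ to the $d$-simplex of $K$ containing it, and $\gamma$ maps ${}^dK^*\to{}^dK$. Relations: $(s,t)\in G$ iff $t=\gamma(s^* )$ for some $s^*\subset s$; $(s_1^*,s_2^* )\in G^*$ iff $s_2^*\subset\gamma(s_1^* )$. $G$ basic sets are classes of $\{s:(s,s)\in\mathcal{O}G\}$ under mutual reachability, $\mathcal{O}G=\bigcup_{n\ge1}G^n$;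 terminal means $\mathcal{O}G(B)\subset B$; the associated $G^*$ basic set is $B^*=\gamma^{-1}(B)\cap J^{-1}(B)$. $\lambda_s$ is normalized Lebesgue measure on the $d$-simplex $s$; $\nu(s^* )=\lambda_{J(s^* )}(s^* )$; $\Gamma$ is the stochastic matrix on ${}^dK$ with $\Gamma_{s_2s_1}=\sum\{\nu(s^* ):J(s^* )=s_1,\gamma(s^* )=s_2\}$; for terminal $B$, $v_B$ is the unique distribution with $\Gamma v_B=v_B$ and support exactly $B$. Tractability of $(X,g)$ with respect to a full background measure $\lambda_0$: TRAC 1: $g$ has finitely many basic sets (chain components); TRAC 2: there are finitely many ergodic invariant probability measures $\mu_1,\dots,\mu_k$ such that every point outside a $\lambda_0$-null set is generic for some $\mu_i$ (generic: $\frac1n\sum_{i<n}u(g^ix)\to\int u\,d\mu_i$ for all continuous $u$); TRAC 3: each support $|\mu_i|$ is contained in a visible basic set (one with nonempty basin $\operatorname{int}\{x:\omega g(x)\subset B\}$); TRAC 4: for $i\ne j$, $\lambda_0(|\mu_i|\cap|\mu_j|)=0$. *)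

theory Defs
  imports "HOL-Analysis.Analysis"
begin

definition simplex_set :: "'a::euclidean_space set \<Rightarrow> bool" where
  "simplex_set s \<longleftrightarrow> finite s \<and> s \<noteq> {} \<and> \<not> affine_dependent s"

definition complex :: "'a::euclidean_space set set \<Rightarrow> bool" where
  "complex K \<longleftrightarrow> finite K \<and> (\<forall>s\<in>K. simplex_set s)
     \<and> (\<forall>s\<in>K. \<forall>t. t \<subseteq> s \<and> t \<noteq> {} \<longrightarrow> t \<in> K)
     \<and> (\<forall>s\<in>K. \<forall>t\<in>K. convex hull s \<inter> convex hull t = convex hull (s \<inter> t))"

definition polyhedron :: "'a::euclidean_space set set \<Rightarrow> 'a set" where
  "polyhedron K = (\<Union>s\<in>K. convex hull s)"

definition proper_subdivision :: "'a::euclidean_space set set \<Rightarrow> 'a set set \<Rightarrow> bool" where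
  "proper_subdivision Ks K \<longleftrightarrow> complex Ks \<and> complex K \<and> polyhedron Ks = polyhedron K
     \<and> (\<forall>s\<in>Ks. \<exists>t\<in>K. convex hull s \<subseteq> convex hull t)
     \<and> (\<forall>t\<in>K. \<exists>S\<subseteq>Ks. convex hull t = (\<Union>s\<in>S. convex hull s))
     \<and> (\<forall>s\<in>Ks. \<not> (\<exists>t1\<in>K. \<exists>t2\<in>K. convex hull t1 \<inter> convex hull t2 = {}
            \<and> convex hull s \<inter> convex hull t1 \<noteq> {} \<and> convex hull s \<inter> convex hull t2 \<noteq> {}))"

definition simplicial_map :: "'a::euclidean_space set set \<Rightarrow> 'a set set \<Rightarrow> ('a \<Rightarrow> 'a) \<Rightarrow> bool" where
  "simplicial_map Ks K \<gamma> \<longleftrightarrow> (\<forall>s\<in>Ks. \<gamma> ` s \<in> K)"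

definition nondegenerate :: "'a set set \<Rightarrow> ('a \<Rightarrow> 'a) \<Rightarrow> bool" where
  "nondegenerate Ks \<gamma> \<longleftrightarrow> (\<forall>s\<in>Ks. card (\<gamma> ` s) = card s)"

definition everywhere_dim :: "'a set set \<Rightarrow> nat \<Rightarrow> bool" where
  "everywhere_dim K d \<longleftrightarrow> (\<forall>s\<in>K. card s \<le> Suc d) \<and> (\<forall>s\<in>K. \<exists>t\<in>K. card t = Suc d \<and> s \<subseteq> t)"

definition dsimp :: "'a set set \<Rightarrow> nat \<Rightarrow> 'a set set" where
  "dsimp K d = {s\<in>K. card s = Suc d}"

definition plmap :: "'a::euclidean_space set set \<Rightarrow> ('a \<Rightarrow> 'a) \<Rightarrow> 'a \<Rightarrow> 'a" where
  "plmap Ks \<gamma> x = (if x \<in> polyhedron Ks then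
      (SOME y. \<exists>s\<in>Ks. \<exists>b. (\<forall>v\<in>s. 0 \<le> b v) \<and> sum b s = 1 \<and> (\<Sum>v\<in>s. b v *\<^sub>R v) = x
                      \<and> y = (\<Sum>v\<in>s. b v *\<^sub>R \<gamma> v))
    else x)"

definition std_simplex :: "nat \<Rightarrow> (nat \<Rightarrow> real) set" where
  "std_simplex n = {y \<in> {..<n} \<rightarrow>\<^sub>E UNIV. (\<forall>i<n. 0 \<le> y i) \<and> (\<Sum>i<n. y i) \<le> 1}"

definition aff_param :: "(nat \<Rightarrow> 'a::euclidean_space) \<Rightarrow> nat \<Rightarrow> (nat \<Rightarrow> real) \<Rightarrow> 'a" where
  "aff_param f n y = f n + (\<Sum>i<n. y i *\<^sub>R (f i - f n))"

text \<open>lam s: normalized Lebesgue measure on the simplex convex hull s (of dimension card s - 1),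
  i.e. the push-forward of the uniform distribution on the standard simplex under an affine
  parametrisation (independent of the choice of vertex ordering).\<close>
definition lam :: "'a::euclidean_space set \<Rightarrow> 'a measure" where
  "lam s = (let n = card s - 1; f = (SOME f. bij_betw f {..n} s) in
     distr (uniform_measure (PiM {..<n} (\<lambda>_. lborel)) (std_simplex n)) borel (aff_param f n))"

definition mixture :: "('a::euclidean_space set \<Rightarrow> real) \<Rightarrow> 'a set set \<Rightarrow> 'a measure" where
  "mixture w S = measure_of UNIV (sets borel) (\<lambda>A. \<Sum>s\<in>S. ennreal (w s) * emeasure (lam s) A)"

definition Jmap :: "'a::euclidean_space set set \<Rightarrow> nat \<Rightarrow> 'a set \<Rightarrow> 'a set" where
  "Jmap K d ss = (THE s. s \<in> dsimp K d \<and> convex hull ss \<subseteq> convex hull s)"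

definition Grel :: "'a::euclidean_space set set \<Rightarrow> 'a set set \<Rightarrow> ('a \<Rightarrow> 'a) \<Rightarrow> nat \<Rightarrow> ('a set \<times> 'a set) set" where
  "Grel Ks K \<gamma> d = {(s, t). \<exists>ss\<in>dsimp Ks d. Jmap K d ss = s \<and> \<gamma> ` ss = t}"

definition G_basic_sets :: "'a::euclidean_space set set \<Rightarrow> 'a set set \<Rightarrow> ('a \<Rightarrow> 'a) \<Rightarrow> nat \<Rightarrow> 'a set set set" where
  "G_basic_sets Ks K \<gamma> d = (let OG = (Grel Ks K \<gamma> d)\<^sup>+ in
     {{t. (t, t) \<in> OG \<and> (s, t) \<in> OG \<and> (t, s) \<in> OG} | s. (s, s) \<in> OG})"

definition terminal_basic_sets :: "'a::euclidean_space set set \<Rightarrow> 'a set set \<Rightarrow> ('a \<Rightarrow> 'a) \<Rightarrow> nat \<Rightarrow> 'a set set set" where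
  "terminal_basic_sets Ks K \<gamma> d =
     {B \<in> G_basic_sets Ks K \<gamma> d. (Grel Ks K \<gamma> d)\<^sup>+ `` B \<subseteq> B}"

definition Bstar :: "'a::euclidean_space set set \<Rightarrow> 'a set set \<Rightarrow> ('a \<Rightarrow> 'a) \<Rightarrow> nat \<Rightarrow> 'a set set \<Rightarrow> 'a set set" where
  "Bstar Ks K \<gamma> d B = {ss \<in> dsimp Ks d. \<gamma> ` ss \<in> B \<and> Jmap K d ss \<in> B}"

definition nu :: "'a::euclidean_space set set \<Rightarrow> nat \<Rightarrow> 'a set \<Rightarrow> real" where
  "nu K d ss = measure (lam (Jmap K d ss)) (convex hull ss)"

definition Gamma :: "'a::euclidean_space set set \<Rightarrow> 'a set set \<Rightarrow> ('a \<Rightarrow> 'a) \<Rightarrow> nat \<Rightarrow> 'a set \<Rightarrow> 'a set \<Rightarrow> real" where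
  "Gamma Ks K \<gamma> d s2 s1 = (\<Sum>ss\<in>{ss \<in> dsimp Ks d. Jmap K d ss = s1 \<and> \<gamma> ` ss = s2}. nu K d ss)"

definition vB :: "'a::euclidean_space set set \<Rightarrow> 'a set set \<Rightarrow> ('a \<Rightarrow> 'a) \<Rightarrow> nat \<Rightarrow> 'a set set \<Rightarrow> 'a set \<Rightarrow> real" where
  "vB Ks K \<gamma> d B = (THE v. (\<forall>s. s \<notin> dsimp K d \<longrightarrow> v s = 0) \<and> (\<forall>s\<in>dsimp K d. 0 \<le> v s)
       \<and> sum v (dsimp K d) = 1 \<and> {s \<in> dsimp K d. v s \<noteq> 0} = B
       \<and> (\<forall>s2\<in>dsimp K d. (\<Sum>s1\<in>dsimp K d. Gamma Ks K \<gamma> d s2 s1 * v s1) = v s2))"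

definition lamB :: "'a::euclidean_space set set \<Rightarrow> 'a set set \<Rightarrow> ('a \<Rightarrow> 'a) \<Rightarrow> nat \<Rightarrow> 'a set set \<Rightarrow> 'a measure" where
  "lamB Ks K \<gamma> d B = mixture (vB Ks K \<gamma> d B) B"

definition invariant_prob :: "('a::euclidean_space \<Rightarrow> 'a) \<Rightarrow> 'a set \<Rightarrow> 'a measure \<Rightarrow> bool" where
  "invariant_prob g X \<mu> \<longleftrightarrow> emeasure \<mu> (space \<mu>) = 1 \<and> sets \<mu> = sets borel \<and> emeasure \<mu> X = 1
     \<and> g \<in> borel_measurable borel \<and> (\<forall>A\<in>sets borel. emeasure \<mu> (g -` A) = emeasure \<mu> A)"

definition ergodic :: "('a::euclidean_space \<Rightarrow> 'a) \<Rightarrow> 'a set \<Rightarrow> 'a measure \<Rightarrow> bool" where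
  "ergodic g X \<mu> \<longleftrightarrow> invariant_prob g X \<mu>
     \<and> (\<forall>A\<in>sets borel. g -` A = A \<longrightarrow> emeasure \<mu> A = 0 \<or> emeasure \<mu> A = 1)"

definition support :: "'a::topological_space measure \<Rightarrow> 'a set" where
  "support \<mu> = {x. \<forall>U. open U \<and> x \<in> U \<longrightarrow> emeasure \<mu> U > 0}"

definition generic :: "('a::euclidean_space \<Rightarrow> 'a) \<Rightarrow> 'a set \<Rightarrow> 'a measure \<Rightarrow> 'a \<Rightarrow> bool" where
  "generic g X \<mu> x \<longleftrightarrow> (\<forall>u::'a \<Rightarrow> real. continuous_on X u \<longrightarrow>
     (\<lambda>n. (\<Sum>i<n. u ((g ^^ i) x)) / real n) \<longlonglongrightarrow> (LINT y:X|\<mu>. u y))"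

definition eps_chain :: "('a::metric_space \<Rightarrow> 'a) \<Rightarrow> 'a set \<Rightarrow> real \<Rightarrow> 'a \<Rightarrow> 'a \<Rightarrow> bool" where
  "eps_chain g X e x y \<longleftrightarrow> (\<exists>n\<ge>1. \<exists>xs::nat \<Rightarrow> 'a. xs 0 = x \<and> xs n = y \<and> (\<forall>i\<le>n. xs i \<in> X)
       \<and> (\<forall>i<n. dist (g (xs i)) (xs (Suc i)) < e))"

definition chain_rel :: "('a::metric_space \<Rightarrow> 'a) \<Rightarrow> 'a set \<Rightarrow> ('a \<times> 'a) set" where
  "chain_rel g X = {(x, y). x \<in> X \<and> y \<in> X \<and> (\<forall>e>0. eps_chain g X e x y)}"

definition basic_sets :: "('a::metric_space \<Rightarrow> 'a) \<Rightarrow> 'a set \<Rightarrow> 'a set set" where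
  "basic_sets g X = (let C = chain_rel g X in
     {{y. (y, y) \<in> C \<and> (x, y) \<in> C \<and> (y, x) \<in> C} | x. (x, x) \<in> C})"

definition omega_limit :: "('a::metric_space \<Rightarrow> 'a) \<Rightarrow> 'a \<Rightarrow> 'a set" where
  "omega_limit g x = {y. \<forall>e>0. \<forall>N. \<exists>n\<ge>N. dist ((g ^^ n) x) y < e}"

definition basin :: "('a::metric_space \<Rightarrow> 'a) \<Rightarrow> 'a set \<Rightarrow> 'a set \<Rightarrow> 'a set" where
  "basin g X B = (top_of_set X) interior_of {x \<in> X. omega_limit g x \<subseteq> B}"

definition visible :: "('a::metric_space \<Rightarrow> 'a) \<Rightarrow> 'a set \<Rightarrow> 'a set \<Rightarrow> bool" where
  "visible g X B \<longleftrightarrow> B \<in> basic_sets g X \<and> basin g X B \<noteq> {}"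

definition tractable :: "('a::euclidean_space \<Rightarrow> 'a) \<Rightarrow> 'a set \<Rightarrow> 'a measure \<Rightarrow> 'i set \<Rightarrow> ('i \<Rightarrow> 'a measure) \<Rightarrow> bool" where
  "tractable g X lam0 I mu \<longleftrightarrow>
     finite (basic_sets g X)
   \<and> (finite I \<and> (\<forall>i\<in>I. ergodic g X (mu i)) \<and> (AE x in lam0. \<exists>i\<in>I. generic g X (mu i) x))
   \<and> (\<forall>i\<in>I. \<exists>B. visible g X B \<and> support (mu i) \<subseteq> B)
   \<and> (\<forall>i\<in>I. \<forall>j\<in>I. i \<noteq> j \<longrightarrow> emeasure lam0 (support (mu i) \<inter> support (mu j)) = 0)"

end

theory Submission
  imports Defs
begin

text \<open>On a \<open>d\<close>-simplex the map is affine and carries normalized Lebesgue measure to normalized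
  Lebesgue measure, so the itinerary of a random point through the \<open>d\<close>-simplices of \<open>K\<close> is a Markov
  chain with matrix \<open>\<Gamma>\<close>. Properness of the subdivision makes the barycentric coordinate matrices
  pairwise overlapping, so by Dobrushin's criterion the inverse branches contract uniformly in
  barycentric coordinates: long cylinders are small and every itinerary is shadowed. Smallness of
  cylinders gives a density argument for the zero-one law on each terminal class, hence ergodicity.
  Almost every point of a terminal class is generic by the ergodic theorem, and almost every point
  enters a terminal class by a maximum principle for the states. Shadowing bounds the number of chain
  components by the number of \<open>d\<close>-simplices and makes each terminal class chain transitive.\<close>

section \<open>Normalized Lebesgue measure on simplices\<close>

text \<open>The polyhedron may have positive codimension, so ambient Lebesgue measure cannot be used
  and each \<open>d\<close>-plane needs its own; \<open>lam\<close> moreover fixes a vertex ordering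
  by choice. Both difficulties vanish once invariant measure on a plane is known to be unique up to
  scale: ratios of volumes then depend on nothing chosen, and no Jacobian is ever computed.
  Contraction is sought in the l1 distance of barycentric coordinates because
  \<open>\<gamma>\<close> merely relabels vertices and so preserves it; the whole gain comes from
  including a simplex of \<open>Ks\<close> into its simplex of \<open>K\<close>. Simplices overlap
  along faces, so a point may have several itineraries. Measure statements discard the faces as null
  sets, while chain statements must keep them and therefore use a relation instead of a coding
  map.\<close>

abbreviation Leb :: "nat \<Rightarrow> (nat \<Rightarrow> real) measure" where
  "Leb n \<equiv> PiM {..<n} (\<lambda>_. lborel)"

definition lincomb :: "(nat \<Rightarrow> 'a::euclidean_space) \<Rightarrow> nat \<Rightarrow> (nat \<Rightarrow> real) \<Rightarrow> 'a" where
  "lincomb e n y = (\<Sum>i<n. y i *\<^sub>R e i)"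

text \<open>Lebesgue measure of the plane through \<open>p\<close> directed by \<open>e\<close>, in
  the scale set by \<open>e\<close>; for a frame it is a Haar measure on that plane.\<close>

definition flat :: "(nat \<Rightarrow> 'a::euclidean_space) \<Rightarrow> nat \<Rightarrow> 'a \<Rightarrow> 'a measure" where
  "flat e n p = distr (Leb n) borel (\<lambda>y. p + lincomb e n y)"

text \<open>Linear independence through a dual family, which makes the coordinates linear functionals.\<close>
definition frame :: "(nat \<Rightarrow> 'a::euclidean_space) \<Rightarrow> nat \<Rightarrow> bool" where
  "frame e n \<longleftrightarrow> (\<exists>c. (\<forall>i<n. linear (c i)) \<and> (\<forall>i<n. \<forall>j<n. c i (e j) = (if i = j then 1 else 0::real)))"

section \<open>Translation invariant measure on an affine plane\<close>

lemma lincomb_measurable [measurable]: "lincomb e n \<in> borel_measurable (Leb n)"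
  unfolding lincomb_def by measurable

lemma sets_flat [simp, measurable_cong]: "sets (flat e n p) = sets borel"
  and space_flat [simp]: "space (flat e n p) = UNIV"
  by (simp_all add: flat_def)

lemma emeasure_flat:
  "A \<in> sets borel \<Longrightarrow> emeasure (flat e n p) A =
     emeasure (Leb n) {y \<in> {..<n} \<rightarrow>\<^sub>E UNIV. p + lincomb e n y \<in> A}"
  unfolding flat_def
  by (subst emeasure_distr) (auto simp: space_PiM intro!: arg_cong2[where f=emeasure])

lemma PiM_lborel_shift:
  "distr (Leb n) (Leb n) (\<lambda>y. \<lambda>i\<in>{..<n}. z i + y i)
     = Leb n"
proof -
  interpret product_sigma_finite "\<lambda>_::nat. lborel::real measure" by standard
  have m[measurable]: "(\<lambda>y. \<lambda>i\<in>{..<n}. z i + y i) \<in>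
      Leb n \<rightarrow>\<^sub>M Leb n"
    by measurable
  show ?thesis
  proof (rule PiM_eqI)
    fix A assume A: "\<And>i. i \<in> {..<n} \<Longrightarrow> A i \<in> sets (lborel :: real measure)"
    have shift: "emeasure lborel ((\<lambda>x. z i + x) -` A i) = emeasure lborel (A i)" if "i < n" for i
    proof -
      have "emeasure lborel (A i) = emeasure (distr lborel borel ((+) (z i))) (A i)"
        by (simp add: lborel_distr_plus)
      then show ?thesis using A[of i] that by (simp add: emeasure_distr)
    qed
    have "(\<lambda>y. \<lambda>i\<in>{..<n}. z i + y i) -` Pi\<^sub>E {..<n} A \<inter> space (Leb n)
      = Pi\<^sub>E {..<n} (\<lambda>i. (\<lambda>x. z i + x) -` A i)"
      by (auto simp: space_PiM PiE_iff)
    moreover have "Pi\<^sub>E {..<n} A \<in> sets (Leb n)"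
      using A by (intro sets_PiM_I_finite) auto
    moreover have "(\<lambda>x. z i + x) -` A i \<in> sets lborel" if "i < n" for i
      using A[of i] that by (simp add: measurable_sets_borel[of "\<lambda>x. z i + x" borel])
    moreover have "emeasure (Leb n) (Pi\<^sub>E {..<n} (\<lambda>i. (\<lambda>x. z i + x) -` A i))
        = (\<Prod>i\<in>{..<n}. emeasure lborel (A i))"
      using calculation(3) by (subst emeasure_PiM) (auto simp: shift)
    ultimately show "emeasure (distr (Leb n) (Leb n)
        (\<lambda>y. \<lambda>i\<in>{..<n}. z i + y i)) (Pi\<^sub>E {..<n} A) = (\<Prod>i\<in>{..<n}. emeasure lborel (A i))"
      using m by (simp add: emeasure_distr)
  qed auto
qed

lemma span_lincomb:
  assumes "w \<in> span (e ` {..<n})" obtains z where "w = lincomb e n z"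
proof -
  have "subspace (range (lincomb e n))"
    unfolding subspace_def
  proof (intro conjI allI ballI)
    show "0 \<in> range (lincomb e n)"
      by (rule image_eqI[where x="\<lambda>_. 0"]) (auto simp: lincomb_def)
  next
    fix x y assume "x \<in> range (lincomb e n)" "y \<in> range (lincomb e n)"
    then obtain a b where "x = lincomb e n a" "y = lincomb e n b" by auto
    then have "x + y = lincomb e n (\<lambda>i. a i + b i)"
      by (simp add: lincomb_def scaleR_left_distrib sum.distrib)
    then show "x + y \<in> range (lincomb e n)" by auto
  next
    fix x c assume "x \<in> range (lincomb e n)"
    then obtain a where "x = lincomb e n a" by auto
    then have "c *\<^sub>R x = lincomb e n (\<lambda>i. c * a i)"
      by (simp add: lincomb_def scaleR_sum_right)
    then show "c *\<^sub>R x \<in> range (lincomb e n)" by auto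
  qed
  moreover have "e j = lincomb e n (\<lambda>i. if i = j then 1 else 0)" if "j < n" for j
  proof -
    have "lincomb e n (\<lambda>i. if i = j then 1 else 0) = (\<Sum>i<n. if i = j then e i else 0)"
      unfolding lincomb_def by (rule sum.cong) auto
    then show ?thesis using that by simp
  qed
  then have "e ` {..<n} \<subseteq> range (lincomb e n)" by blast
  ultimately have "span (e ` {..<n}) \<subseteq> range (lincomb e n)"
    by (intro span_minimal)
  with assms that show ?thesis by auto
qed

lemma lincomb_in_span: "lincomb e n y \<in> span (e ` {..<n})"
  unfolding lincomb_def by (intro span_sum span_scale span_base) auto

text \<open>A translation along the span is a translation of the coordinates, under which product
  Lebesgue measure is invariant; hence only the plane through \<open>p\<close> matters, not
  \<open>p\<close> itself.\<close>

lemma flat_shift: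
  assumes "w \<in> span (e ` {..<n})"
  shows "flat e n (p + w) = flat e n p"
proof -
  obtain z where w: "w = lincomb e n z" using span_lincomb[OF assms] .
  have "flat e n p = distr (distr (Leb n) (Leb n) (\<lambda>y. \<lambda>i\<in>{..<n}. z i + y i))
      borel (\<lambda>y. p + lincomb e n y)"
    unfolding flat_def PiM_lborel_shift ..
  also have "\<dots> = distr (Leb n) borel (\<lambda>y. p + lincomb e n (\<lambda>i\<in>{..<n}. z i + y i))"
    by (subst distr_distr) (auto simp: comp_def)
  also have "(\<lambda>y. p + lincomb e n (\<lambda>i\<in>{..<n}. z i + y i)) = (\<lambda>y. (p + w) + lincomb e n y)"
    by (simp add: w lincomb_def scaleR_left_distrib sum.distrib algebra_simps)
  finally show ?thesis unfolding flat_def by simp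
qed

lemma nn_integral_flat_shift:
  assumes "w \<in> span (e ` {..<n})" and [measurable]: "f \<in> borel_measurable borel"
  shows "(\<integral>\<^sup>+x. f (w + x) \<partial>flat e n p) = (\<integral>\<^sup>+x. f x \<partial>flat e n p)"
proof -
  have "(\<integral>\<^sup>+x. f (w + x) \<partial>flat e n p) = (\<integral>\<^sup>+x. f x \<partial>distr (flat e n p) borel ((+) w))"
    by (subst nn_integral_distr) auto
  also have "distr (flat e n p) borel ((+) w) = flat e n (p + w)"
    unfolding flat_def by (subst distr_distr) (auto simp: comp_def algebra_simps)
  finally show ?thesis by (simp add: flat_shift assms)
qed

lemma flat_translate:
  assumes "A \<in> sets borel"
  shows "emeasure (flat e n (p + w)) A = emeasure (flat e n p) ((+) w -` A)"
proof -
  have "flat e n (p + w) = distr (flat e n p) borel ((+) w)"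
    unfolding flat_def by (subst distr_distr) (auto simp: comp_def algebra_simps)
  then show ?thesis using assms by (simp add: emeasure_distr)
qed

lemma AE_flat_span: "AE x in flat e n 0. x \<in> span (e ` {..<n})"
proof -
  have [measurable]: "span (e ` {..<n}) \<in> sets borel"
    by (intro borel_closed closed_subspace subspace_span)
  show ?thesis unfolding flat_def
    by (subst AE_distr_iff) (auto simp: lincomb_in_span)
qed

lemma frame_coord:
  assumes "i < n" "linear (c i)" "\<And>j. j < n \<Longrightarrow> c i (e j) = (if i = j then 1 else 0::real)"
  shows "c i (lincomb e n y) = y i"
proof -
  have "c i (lincomb e n y) = (\<Sum>j<n. y j * c i (e j))"
    unfolding lincomb_def by (simp add: linear_sum[OF assms(2)] linear_scale[OF assms(2)])
  also have "\<dots> = (\<Sum>j<n. if j = i then y j else 0)"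
    by (rule sum.cong) (use assms(3) in auto)
  also have "\<dots> = y i" using assms(1) by simp
  finally show ?thesis .
qed

text \<open>The dual functionals bound every coordinate by a multiple of the norm, so the
  coordinates of a bounded set stay in a box.\<close>

lemma flat_bounded_finite:
  assumes "frame e n" "bounded S" "S \<in> sets borel"
  shows "emeasure (flat e n p) S < \<infinity>"
proof -
  interpret product_sigma_finite "\<lambda>_::nat. lborel::real measure" by standard
  obtain c where c: "\<And>i. i < n \<Longrightarrow> linear (c i)"
      "\<And>i j. i < n \<Longrightarrow> j < n \<Longrightarrow> c i (e j) = (if i = j then 1 else 0::real)"
    using assms(1) unfolding frame_def by auto
  obtain r where r: "\<And>x. x \<in> S \<Longrightarrow> norm x \<le> r" using assms(2) unfolding bounded_iff by auto
  have "\<exists>B. \<forall>x. norm (c i x) \<le> B * norm x" if "i < n" for i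
    using linear_bounded[OF c(1)[OF that]] .
  then obtain B where B: "\<And>i x. i < n \<Longrightarrow> norm (c i x) \<le> B i * norm x" by metis
  define C where "C i = \<bar>B i\<bar> * (\<bar>r\<bar> + norm p)" for i
  have "{y \<in> {..<n} \<rightarrow>\<^sub>E UNIV. p + lincomb e n y \<in> S} \<subseteq> Pi\<^sub>E {..<n} (\<lambda>i. {- C i .. C i})"
  proof
    fix y assume y: "y \<in> {y \<in> {..<n} \<rightarrow>\<^sub>E UNIV. p + lincomb e n y \<in> S}"
    have "\<bar>y i\<bar> \<le> C i" if "i < n" for i
    proof -
      have "\<bar>y i\<bar> = norm (c i (lincomb e n y))" using frame_coord[of i n c e y] c that by simp
      also have "\<dots> \<le> B i * norm (lincomb e n y)" by (rule B[OF that])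
      also have "\<dots> \<le> \<bar>B i\<bar> * (\<bar>r\<bar> + norm p)"
      proof (rule mult_mono)
        have "norm (lincomb e n y) \<le> norm (p + lincomb e n y) + norm p"
          by (metis add_diff_cancel_left' norm_triangle_ineq4)
        then show "norm (lincomb e n y) \<le> \<bar>r\<bar> + norm p" using r[of "p + lincomb e n y"] y by auto
      qed auto
      finally show ?thesis by (simp add: C_def)
    qed
    then show "y \<in> Pi\<^sub>E {..<n} (\<lambda>i. {- C i .. C i})"
      using y unfolding PiE_iff by (auto simp: abs_le_iff minus_le_iff)
  qed
  then have "emeasure (flat e n p) S \<le> emeasure (Leb n) (Pi\<^sub>E {..<n} (\<lambda>i. {- C i .. C i}))"
    unfolding emeasure_flat[OF assms(3)] by (intro emeasure_mono sets_PiM_I_finite) auto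
  also have "\<dots> = (\<Prod>i<n. emeasure lborel {- C i .. C i})"
    by (rule emeasure_PiM) auto
  also have "\<dots> < \<infinity>"
    by (auto simp: ennreal_prod_eq_top less_top[symmetric] C_def)
  finally show ?thesis .
qed

lemma emeasure_box_pos:
  assumes "0 < r"
  shows "0 < emeasure (Leb n) (Pi\<^sub>E {..<n} (\<lambda>i. {0..r}))"
proof -
  interpret product_sigma_finite "\<lambda>_::nat. lborel::real measure" by standard
  have "emeasure (Leb n) (Pi\<^sub>E {..<n} (\<lambda>i. {0..r})) = (\<Prod>i<n. ennreal r)"
    using assms by (subst emeasure_PiM) auto
  then show ?thesis using assms by (simp add: ennreal_power)
qed

lemma flat_ball_pos: "0 < emeasure (flat e n 0) (ball 0 1)"
proof -
  \<comment> \<open>The summand 1 makes \<open>N\<close> positive and the final estimate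
    strict.\<close>
  define N where "N = 1 + (\<Sum>i<n. norm (e i))"
  have N: "N > 0" unfolding N_def by (simp add: add_pos_nonneg sum_nonneg)
  have "0 < emeasure (Leb n) (Pi\<^sub>E {..<n} (\<lambda>i. {0..1/N}))"
    by (rule emeasure_box_pos) (use N in auto)
  also have "\<dots> \<le> emeasure (flat e n 0) (ball 0 1)"
  proof (subst emeasure_flat, simp, rule emeasure_mono)
    show "Pi\<^sub>E {..<n} (\<lambda>i. {0..1/N}) \<subseteq> {y \<in> {..<n} \<rightarrow>\<^sub>E UNIV. 0 + lincomb e n y \<in> ball 0 1}"
    proof
      fix y assume y: "y \<in> Pi\<^sub>E {..<n} (\<lambda>i. {0..1/N})"
      have "norm (lincomb e n y) \<le> (\<Sum>i<n. norm (y i *\<^sub>R e i))"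
        unfolding lincomb_def by (rule norm_sum)
      also have "\<dots> \<le> (\<Sum>i<n. 1/N * norm (e i))"
        unfolding norm_scaleR using y by (intro sum_mono mult_right_mono) (auto simp: PiE_iff)
      also have "\<dots> = (N - 1) / N" unfolding N_def by (simp add: sum_divide_distrib)
      also have "\<dots> < 1" using N by simp
      finally show "y \<in> {y \<in> {..<n} \<rightarrow>\<^sub>E UNIV. 0 + lincomb e n y \<in> ball 0 1}"
        using y by (auto simp: PiE_iff)
    qed
    have "lincomb e n -` ball 0 1 \<inter> space (Leb n)
        \<in> sets (Leb n)"
      by (rule measurable_sets[OF lincomb_measurable]) auto
    moreover have "lincomb e n -` ball 0 1 \<inter> space (Leb n)
        = {y \<in> {..<n} \<rightarrow>\<^sub>E UNIV. 0 + lincomb e n y \<in> ball 0 1}"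
      by (simp add: space_PiM vimage_def Int_def conj_commute)
    ultimately show "{y \<in> {..<n} \<rightarrow>\<^sub>E UNIV. 0 + lincomb e n y \<in> ball 0 1} \<in> sets (Leb n)"
      by simp
  qed
  finally show ?thesis .
qed

section \<open>Uniqueness of the invariant measure up to scale\<close>

lemma sigma_finite_flat:
  assumes "frame e n" shows "sigma_finite_measure (flat e n p)"
proof
  show "\<exists>A. countable A \<and> A \<subseteq> sets (flat e n p) \<and> \<Union> A = space (flat e n p) \<and> (\<forall>a\<in>A. emeasure (flat e n p) a \<noteq> \<infinity>)"
  proof (intro exI[of _ "range (\<lambda>k. ball 0 (real k))"] conjI)
    show "\<Union> (range (\<lambda>k. ball 0 (real k))) = space (flat e n p)"
      using reals_Archimedean2 by (force simp: dist_norm)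
    show "\<forall>a\<in>range (\<lambda>k. ball 0 (real k)). emeasure (flat e n p) a \<noteq> \<infinity>"
      using flat_bounded_finite[OF assms] by (auto simp: less_top[symmetric])
  qed auto
qed

text \<open>Weil's uniqueness argument for Haar measure, carried out on a common span.\<close>
lemma flat_proportional:
  assumes fr: "frame e n" "frame e' n'" and sp: "span (e ` {..<n}) = span (e' ` {..<n'})"
    and p: "p' - p \<in> span (e ` {..<n})"
  obtains c where "0 < c" "c < \<infinity>"
    "\<And>A. A \<in> sets borel \<Longrightarrow> emeasure (flat e n p) A = c * emeasure (flat e' n' p') A"
proof -
  let ?\<mu> = "flat e n 0" and ?\<nu> = "flat e' n' 0"
  \<comment> \<open>A symmetric test set with positive finite mass for both measures.\<close>
  define B :: "'a set" where "B = ball 0 1"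
  have [measurable]: "B \<in> sets borel" and B_sym: "- x \<in> B \<longleftrightarrow> x \<in> B" for x
    by (auto simp: B_def)

  interpret M: sigma_finite_measure ?\<mu> by (rule sigma_finite_flat[OF fr(1)])
  interpret N: sigma_finite_measure ?\<nu> by (rule sigma_finite_flat[OF fr(2)])
  interpret P: pair_sigma_finite ?\<mu> ?\<nu> by standard
  \<comment> \<open>Both sides equal the double integral of
    \<open>indicator A (y + x) * indicator B y\<close>. Shifting \<open>x\<close> by
    \<open>y\<close> gives the left; shifting \<open>y\<close> by \<open>x\<close> and then using
    the symmetry of \<open>B\<close> gives the right. Each shift is legal only along the common
    span, hence the appeals to \<open>AE_flat_span\<close>.\<close>
  have key: "emeasure ?\<mu> A * emeasure ?\<nu> B = emeasure ?\<nu> A * emeasure ?\<mu> B"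
    if A[measurable]: "A \<in> sets borel" for A
  proof -
    have "emeasure ?\<mu> A * emeasure ?\<nu> B
        = (\<integral>\<^sup>+y. (\<integral>\<^sup>+x. indicator A x * indicator B y \<partial>?\<mu>) \<partial>?\<nu>)"
    proof -
      have "(\<integral>\<^sup>+x. indicator A x * indicator B y \<partial>?\<mu>) = emeasure ?\<mu> A * indicator B y" for y
        by (subst nn_integral_multc) auto
      then show ?thesis by (simp add: nn_integral_cmult_indicator)
    qed
    also have "\<dots> = (\<integral>\<^sup>+y. (\<integral>\<^sup>+x. indicator A (y + x) * indicator B y \<partial>?\<mu>) \<partial>?\<nu>)"
    proof (rule nn_integral_cong_AE, rule AE_mp[OF AE_flat_span], intro AE_I2 impI)
      fix y assume "y \<in> span (e' ` {..<n'})"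
      then have y: "y \<in> span (e ` {..<n})" by (simp add: sp)
      show "(\<integral>\<^sup>+x. indicator A x * indicator B y \<partial>?\<mu>) = (\<integral>\<^sup>+x. indicator A (y + x) * indicator B y \<partial>?\<mu>)"
        by (rule nn_integral_flat_shift[OF y, of "\<lambda>x. indicator A x * indicator B y", symmetric]) measurable
    qed
    also have "\<dots> = (\<integral>\<^sup>+x. (\<integral>\<^sup>+y. indicator A (y + x) * indicator B y \<partial>?\<nu>) \<partial>?\<mu>)"
      by (rule P.Fubini') measurable
    also have "\<dots> = (\<integral>\<^sup>+x. (\<integral>\<^sup>+y. indicator A y * indicator B (y - x) \<partial>?\<nu>) \<partial>?\<mu>)"
    proof (rule nn_integral_cong_AE, rule AE_mp[OF AE_flat_span], intro AE_I2 impI)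
      fix x assume "x \<in> span (e ` {..<n})"
      then have x: "x \<in> span (e' ` {..<n'})" by (simp add: sp)
      show "(\<integral>\<^sup>+y. indicator A (y + x) * indicator B y \<partial>?\<nu>) = (\<integral>\<^sup>+y. indicator A y * indicator B (y - x) \<partial>?\<nu>)"
        by (subst nn_integral_flat_shift[OF x, of "\<lambda>y. indicator A y * indicator B (y - x)", symmetric])
          (auto simp: add.commute)
    qed
    also have "\<dots> = (\<integral>\<^sup>+y. (\<integral>\<^sup>+x. indicator A y * indicator B (y - x) \<partial>?\<mu>) \<partial>?\<nu>)"
      by (rule P.Fubini'[symmetric]) measurable
    also have "\<dots> = (\<integral>\<^sup>+y. indicator A y * emeasure ?\<mu> B \<partial>?\<nu>)"
    proof (rule nn_integral_cong_AE, rule AE_mp[OF AE_flat_span], intro AE_I2 impI)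
      fix y assume "y \<in> span (e' ` {..<n'})"
      then have y: "y \<in> span (e ` {..<n})" by (simp add: sp)
      have "(\<integral>\<^sup>+x. indicator A y * indicator B (y - x) \<partial>?\<mu>) = indicator A y * (\<integral>\<^sup>+x. indicator B (y - x) \<partial>?\<mu>)"
        by (rule nn_integral_cmult) measurable
      also have "(\<integral>\<^sup>+x. indicator B (y - x) \<partial>?\<mu>) = (\<integral>\<^sup>+x. indicator B (- x) \<partial>?\<mu>)"
        by (subst nn_integral_flat_shift[OF y, of "\<lambda>x. indicator B (y - x)", symmetric]) auto
      also have "\<dots> = (\<integral>\<^sup>+x. indicator B x \<partial>?\<mu>)"
        by (simp add: indicator_def B_sym)
      finally show "(\<integral>\<^sup>+x. indicator A y * indicator B (y - x) \<partial>?\<mu>) = indicator A y * emeasure ?\<mu> B" by simp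
    qed
    also have "\<dots> = emeasure ?\<nu> A * emeasure ?\<mu> B"
      by (subst nn_integral_multc) auto
    finally show ?thesis .
  qed
  have mB: "0 < emeasure ?\<mu> B" "emeasure ?\<mu> B < \<infinity>" "0 < emeasure ?\<nu> B" "emeasure ?\<nu> B < \<infinity>"
    using flat_ball_pos flat_bounded_finite[OF fr(1)] flat_bounded_finite[OF fr(2)] by (simp_all add: B_def)
  define c where "c = emeasure ?\<mu> B / emeasure ?\<nu> B"
  have c0: "emeasure ?\<mu> A = c * emeasure ?\<nu> A" if "A \<in> sets borel" for A
  proof -
    have "emeasure ?\<mu> A = emeasure ?\<mu> A * emeasure ?\<nu> B / emeasure ?\<nu> B"
      using mB by (subst ennreal_mult_divide_eq) auto
    also have "\<dots> = c * emeasure ?\<nu> A"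
      unfolding key[OF that] c_def by (simp add: ennreal_times_divide mult.commute)
    finally show ?thesis .
  qed
  have "emeasure (flat e n p) A = c * emeasure (flat e' n' p') A" if A: "A \<in> sets borel" for A
  proof -
    have A': "(+) p -` A \<in> sets borel"
      using A by (simp add: measurable_sets_borel[of "(+) p" borel])
    have "emeasure (flat e n p) A = emeasure ?\<mu> ((+) p -` A)"
      using flat_translate[OF A, of e n 0 p] by simp
    also have "\<dots> = c * emeasure ?\<nu> ((+) p -` A)" by (rule c0[OF A'])
    also have "emeasure ?\<nu> ((+) p -` A) = emeasure (flat e' n' p) A"
      using flat_translate[OF A, of e' n' 0 p] by simp
    also have "flat e' n' p = flat e' n' p'"
      using flat_shift[of "p' - p" e' n' p] p sp by simp
    finally show ?thesis .
  qed
  moreover have "0 < c"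
    using mB by (auto simp: c_def ennreal_zero_less_divide)
  moreover have "c \<noteq> \<infinity>"
    using mB unfolding c_def infinity_ennreal_def ennreal_divide_eq_top_iff by auto
  ultimately show thesis using that by (simp add: less_top)
qed

lemma flat_proportional_measure:
  assumes fr: "frame e n" "frame e' n'" and sp: "span (e ` {..<n}) = span (e' ` {..<n'})"
    and p: "p' - p \<in> span (e ` {..<n})"
  obtains c where "0 < c" "\<And>A. A \<in> sets borel \<Longrightarrow> measure (flat e n p) A = c * measure (flat e' n' p') A"
proof -
  obtain c where c: "0 < c" "c < \<infinity>"
    and eq: "\<And>A. A \<in> sets borel \<Longrightarrow> emeasure (flat e n p) A = c * emeasure (flat e' n' p') A"
    using flat_proportional[OF assms] by blast
  show thesis
  proof
    show "0 < enn2real c" using c by (simp add: enn2real_positive_iff)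
    show "measure (flat e n p) A = enn2real c * measure (flat e' n' p') A" if "A \<in> sets borel" for A
      using eq[OF that] by (simp add: measure_def enn2real_mult)
  qed
qed

section \<open>Simplices and their affine charts\<close>

definition nsimplex :: "'a::euclidean_space set \<Rightarrow> nat \<Rightarrow> bool" where
  "nsimplex s n \<longleftrightarrow> finite s \<and> \<not> affine_dependent s \<and> card s = Suc n"

lemma nsimplex_param:
  assumes "nsimplex s n" obtains f where "bij_betw f {..n} s"
  using assms unfolding nsimplex_def
  by (metis card_atMost finite_atMost finite_same_card_bij)

lemma frame_indep:
  assumes s: "nsimplex s n" and f: "bij_betw f {..n} s"
  defines "e \<equiv> \<lambda>i. f i - f n"
  shows "independent (e ` {..<n})" "inj_on e {..<n}"
proof -
  have inj: "inj_on f {..n}" and im: "f ` {..n} = s" using f by (auto simp: bij_betw_def)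
  have s_eq: "s = insert (f n) (f ` {..<n})" using im by (auto simp: less_le image_iff)
  have "f n \<notin> f ` {..<n}" using inj by (force simp: inj_on_def)
  then have "independent ((\<lambda>x. - f n + x) ` (f ` {..<n}))"
    using s affine_dependent_iff_dependent[of "f n" "f ` {..<n}"] unfolding nsimplex_def s_eq by blast
  then show "independent (e ` {..<n})" by (simp add: image_image e_def)
  show "inj_on e {..<n}" using inj by (auto simp: inj_on_def e_def)
qed

lemma frame_simplex:
  assumes s: "nsimplex s n" and f: "bij_betw f {..n} s"
  shows "frame (\<lambda>i. f i - f n) n"
proof -
  let ?e = "\<lambda>i. f i - f n"
  have "\<exists>g. linear g \<and> (\<forall>x\<in>?e ` {..<n}. g x = (if x = ?e i then 1 else 0::real))" for i
    by (rule linear_independent_extend[OF frame_indep(1)[OF s f]])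
  then obtain g where g: "\<And>i. linear (g i)"
      "\<And>i x. x \<in> ?e ` {..<n} \<Longrightarrow> g i x = (if x = ?e i then 1 else 0::real)" by metis
  have "g i (?e j) = (if i = j then 1 else 0)" if "i < n" "j < n" for i j
    using g(2)[of "?e j" i] frame_indep(2)[OF s f] that by (auto simp: inj_on_def)
  then show ?thesis unfolding frame_def using g(1) by blast
qed

lemma aff_param_lincomb: "aff_param f n y = f n + lincomb (\<lambda>i. f i - f n) n y"
  by (simp add: aff_param_def lincomb_def)

lemma aff_param_bary:
  "aff_param f n y = (\<Sum>i\<le>n. (if i < n then y i else 1 - (\<Sum>i<n. y i)) *\<^sub>R f i)"
proof -
  have "(\<Sum>i\<le>n. (if i < n then y i else 1 - (\<Sum>i<n. y i)) *\<^sub>R f i)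
      = (\<Sum>i<n. y i *\<^sub>R f i) + (1 - (\<Sum>i<n. y i)) *\<^sub>R f n"
    by (simp add: lessThan_Suc_atMost[symmetric])
  then show ?thesis
    by (simp add: aff_param_def scaleR_diff_right scaleR_diff_left sum_subtractf scaleR_sum_left)
qed

lemma convex_hull_param:
  fixes s :: "'a::euclidean_space set"
  assumes f: "bij_betw f {..n} s"
  shows "convex hull s = aff_param f n ` std_simplex n"
proof (intro set_eqI iffI)
  have fin: "finite s" using f bij_betw_finite by blast
  have re: "sum g s = (\<Sum>i\<le>n. g (f i))" for g :: "'a \<Rightarrow> 'b::comm_monoid_add"
    by (rule sum.reindex_bij_betw[OF f, symmetric])
  fix x assume "x \<in> convex hull s"
  then obtain u where u: "\<forall>v\<in>s. 0 \<le> u v" "sum u s = 1" "(\<Sum>v\<in>s. u v *\<^sub>R v) = x"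
    unfolding convex_hull_finite[OF fin] by auto
  define y where "y = (\<lambda>i\<in>{..<n}. u (f i))"
  have s1: "(\<Sum>i\<le>n. u (f i)) = 1" using u(2) unfolding re .
  have un: "u (f n) = 1 - (\<Sum>i<n. u (f i))" using s1 by (simp add: lessThan_Suc_atMost[symmetric])
  have nn: "0 \<le> u (f i)" if "i \<le> n" for i using u(1) f that by (auto simp: bij_betw_def)
  have "y \<in> std_simplex n"
    unfolding std_simplex_def using nn un nn[of n] by (auto simp: y_def)
  moreover have "x = aff_param f n y"
    unfolding aff_param_bary u(3)[symmetric] re
    by (rule sum.cong) (auto simp: y_def un)
  ultimately show "x \<in> aff_param f n ` std_simplex n" by auto
next
  have fin: "finite s" using f bij_betw_finite by blast
  fix x assume "x \<in> aff_param f n ` std_simplex n"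
  then obtain y where y: "y \<in> std_simplex n" "x = aff_param f n y" by auto
  show "x \<in> convex hull s"
    unfolding y(2) aff_param_bary
  proof (rule convex_sum)
    show "(\<Sum>i\<le>n. if i < n then y i else 1 - (\<Sum>i<n. y i)) = 1"
      by (simp add: lessThan_Suc_atMost[symmetric])
    show "f i \<in> convex hull s" if "i \<in> {..n}" for i
      using f that by (auto simp: bij_betw_def intro: hull_inc)
  qed (use y(1) in \<open>auto simp: std_simplex_def convex_convex_hull\<close>)
qed

lemma convex_hull_diff_span:
  fixes f :: "nat \<Rightarrow> 'a::euclidean_space"
  assumes f: "bij_betw f {..n} s" and "x \<in> convex hull s"
  shows "x - f n \<in> span ((\<lambda>i. f i - f n) ` {..<n})"
  using assms(2) unfolding convex_hull_param[OF f] by (auto simp: aff_param_lincomb lincomb_in_span)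

lemma std_simplex_measurable [measurable]: "std_simplex n \<in> sets (Leb n)"
proof -
  have "{y \<in> space (Leb n). (\<forall>i<n. 0 \<le> y i) \<and> (\<Sum>i<n. y i) \<le> (1::real)}
    \<in> sets (Leb n)"
    by measurable
  then show ?thesis by (simp add: std_simplex_def space_PiM)
qed

lemma std_simplex_measure:
  "0 < emeasure (Leb n) (std_simplex n)"
  "emeasure (Leb n) (std_simplex n) < \<infinity>"
proof -
  interpret product_sigma_finite "\<lambda>_::nat. lborel::real measure" by standard
  have "Pi\<^sub>E {..<n} (\<lambda>i. {0..1/(real n + 1)}) \<subseteq> std_simplex n"
  proof
    fix y assume y: "y \<in> Pi\<^sub>E {..<n} (\<lambda>i. {0..1/(real n + 1)})"
    have "(\<Sum>i<n. y i) \<le> (\<Sum>i<n. 1/(real n + 1))" using y by (intro sum_mono) (auto simp: PiE_iff)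
    also have "\<dots> \<le> 1" by (simp add: field_simps)
    finally show "y \<in> std_simplex n" using y unfolding std_simplex_def by (auto simp: PiE_iff)
  qed
  then have "emeasure (Leb n) (Pi\<^sub>E {..<n} (\<lambda>i. {0..1/(real n + 1)}))
      \<le> emeasure (Leb n) (std_simplex n)"
    by (intro emeasure_mono) auto
  then show "0 < emeasure (Leb n) (std_simplex n)"
    using emeasure_box_pos[of "1/(real n + 1)" n] by (simp add: less_le_trans)
  have "std_simplex n \<subseteq> Pi\<^sub>E {..<n} (\<lambda>i. {0..1})"
  proof
    fix y assume y: "y \<in> std_simplex n"
    have "y i \<le> 1" if "i < n" for i
      using y that member_le_sum[of i "{..<n}" y] by (auto simp: std_simplex_def)
    then show "y \<in> Pi\<^sub>E {..<n} (\<lambda>i. {0..1})" using y by (auto simp: std_simplex_def PiE_iff)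
  qed
  then have "emeasure (Leb n) (std_simplex n)
      \<le> emeasure (Leb n) (Pi\<^sub>E {..<n} (\<lambda>i. {0..1::real}))"
    by (intro emeasure_mono sets_PiM_I_finite) auto
  also have "\<dots> = (\<Prod>i<n. emeasure lborel {0..1::real})"
    by (rule emeasure_PiM) auto
  also have "\<dots> = 1" by simp
  finally show "emeasure (Leb n) (std_simplex n) < \<infinity>"
    using le_less_trans by fastforce
qed

lemma aff_param_measurable [measurable]: "aff_param f n \<in> borel_measurable (Leb n)"
  unfolding aff_param_lincomb[abs_def] by measurable

section \<open>Normalized measure of a simplex in any frame of its plane\<close>

lemma sets_lam [simp, measurable_cong]: "sets (lam s) = sets borel"
  and space_lam [simp]: "space (lam s) = UNIV"
  by (simp_all add: lam_def Let_def)

lemma finite_convex_hull_borel [measurable]: "finite s \<Longrightarrow> convex hull s \<in> sets (borel :: 'a::euclidean_space measure)"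
  by (intro borel_compact finite_imp_compact_convex_hull)

text \<open>The chart is injective, since the dual functionals recover its coordinates; so a
  coordinate vector mapped into the hull already lies in the standard simplex.\<close>

lemma flat_simplex:
  assumes s: "nsimplex s n" and f: "bij_betw f {..n} s" and E: "E \<in> sets borel"
  shows "emeasure (flat (\<lambda>i. f i - f n) n (f n)) (E \<inter> convex hull s)
    = emeasure (Leb n) (std_simplex n \<inter> aff_param f n -` E)"
proof -
  let ?e = "\<lambda>i. f i - f n"
  obtain c where c: "\<And>i. i < n \<Longrightarrow> linear (c i)"
      "\<And>i j. i < n \<Longrightarrow> j < n \<Longrightarrow> c i (?e j) = (if i = j then 1 else 0::real)"
    using frame_simplex[OF s f] unfolding frame_def by auto
  have "y \<in> std_simplex n" if y: "y \<in> {..<n} \<rightarrow>\<^sub>E UNIV" "aff_param f n y \<in> convex hull s" for y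
  proof -
    obtain z where z: "z \<in> std_simplex n" "aff_param f n y = aff_param f n z"
      using y(2) unfolding convex_hull_param[OF f] by auto
    have "y i = z i" if "i < n" for i
    proof -
      have "lincomb ?e n y = lincomb ?e n z" using z(2) by (simp add: aff_param_lincomb)
      then show ?thesis using frame_coord[of i n c ?e y] frame_coord[of i n c ?e z] c that by simp
    qed
    moreover have "z \<in> {..<n} \<rightarrow>\<^sub>E UNIV" using z(1) by (simp add: std_simplex_def)
    ultimately have "y = z" using y(1) by (intro PiE_ext) auto
    then show ?thesis using z by simp
  qed
  moreover have "y \<in> {..<n} \<rightarrow>\<^sub>E UNIV" "aff_param f n y \<in> convex hull s" if "y \<in> std_simplex n" for y
    using that convex_hull_param[OF f] by (auto simp: std_simplex_def)
  ultimately have "{y \<in> {..<n} \<rightarrow>\<^sub>E UNIV. aff_param f n y \<in> E \<inter> convex hull s} = std_simplex n \<inter> aff_param f n -` E"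
    by blast
  moreover have "finite s" using s by (simp add: nsimplex_def)
  ultimately show ?thesis
    using E by (subst emeasure_flat) (auto simp: aff_param_lincomb[symmetric])
qed

text \<open>By uniqueness of Haar measure, the vertex ordering chosen inside \<open>lam\<close> and
  the frame given here yield proportional measures, and the factor cancels in the quotient. Any
  frame of the plane may thus serve, so different simplices of one plane can be compared.\<close>

lemma measure_lam_flat:
  assumes s: "nsimplex s n" and e: "frame e n" and sp: "\<And>x. x \<in> s \<Longrightarrow> x - p \<in> span (e ` {..<n})"
    and E: "E \<in> sets borel"
  shows "measure (lam s) E = measure (flat e n p) (E \<inter> convex hull s) / measure (flat e n p) (convex hull s)"
    "0 < measure (flat e n p) (convex hull s)"
proof -
  define f where "f = (SOME f. bij_betw f {..n} s)"
  have f: "bij_betw f {..n} s" unfolding f_def using nsimplex_param[OF s] by (metis someI)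
  have n: "card s - 1 = n" using s by (simp add: nsimplex_def)
  let ?L = "Leb n" and ?e = "\<lambda>i. f i - f n"
  let ?R = "flat ?e n (f n)"
  have lam: "lam s = distr (uniform_measure ?L (std_simplex n)) borel (aff_param f n)"
    unfolding lam_def Let_def n f_def ..
  have fs: "f i \<in> s" if "i \<le> n" for i using f that by (auto simp: bij_betw_def)
  have "measure (lam s) E = measure (uniform_measure ?L (std_simplex n)) (aff_param f n -` E \<inter> space ?L)"
    unfolding lam using E by (subst measure_distr) auto
  also have "\<dots> = measure ?L (std_simplex n \<inter> (aff_param f n -` E \<inter> space ?L)) / measure ?L (std_simplex n)"
    using std_simplex_measure[of n] E by (subst measure_uniform_measure) (auto intro: measurable_sets)
  also have "std_simplex n \<inter> (aff_param f n -` E \<inter> space ?L) = std_simplex n \<inter> aff_param f n -` E"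
    by (auto simp: space_PiM std_simplex_def)
  also have "measure ?L (std_simplex n \<inter> aff_param f n -` E) = measure ?R (E \<inter> convex hull s)"
    unfolding measure_def flat_simplex[OF s f E] ..
  also have "measure ?L (std_simplex n) = measure ?R (convex hull s)"
    using flat_simplex[OF s f, of UNIV] by (simp add: measure_def)
  finally have 1: "measure (lam s) E = measure ?R (E \<inter> convex hull s) / measure ?R (convex hull s)" .
  have 2: "0 < measure ?R (convex hull s)"
    using flat_simplex[OF s f, of UNIV] std_simplex_measure[of n]
    by (simp add: measure_def enn2real_positive_iff)
  have sub: "?e ` {..<n} \<subseteq> span (e ` {..<n})"
  proof safe
    fix i assume "i < n"
    then have "(f i - p) - (f n - p) \<in> span (e ` {..<n})"
      by (intro span_diff sp fs) auto
    then show "f i - f n \<in> span (e ` {..<n})" by simp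
  qed
  \<comment> \<open>There are \<open>n\<close> independent edges inside a span of dimension at most
    \<open>n\<close>, so the two spans agree.\<close>
  have "dim (?e ` {..<n}) = n"
    using frame_indep[OF s f] by (simp add: dim_eq_card_independent card_image)
  moreover have "dim (e ` {..<n}) \<le> n"
    using dim_le_card[of "e ` {..<n}" "e ` {..<n}"] card_image_le[of "{..<n}" e] by (auto simp: span_superset)
  ultimately have span_eq: "span (?e ` {..<n}) = span (e ` {..<n})"
    using sub by (metis dim_eq_span dim_span span_span)
  have "p - f n \<in> span (?e ` {..<n})"
    using span_neg[OF sp[OF fs[of n]]] unfolding span_eq by simp
  then obtain c where c: "0 < c" "\<And>A. A \<in> sets borel \<Longrightarrow> measure ?R A = c * measure (flat e n p) A"
    using flat_proportional_measure[OF frame_simplex[OF s f] e span_eq] by blast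
  have fin: "finite s" using s by (simp add: nsimplex_def)
  show "0 < measure (flat e n p) (convex hull s)"
    using 2 c fin by (simp add: zero_less_mult_iff)
  show "measure (lam s) E = measure (flat e n p) (E \<inter> convex hull s) / measure (flat e n p) (convex hull s)"
    unfolding 1 using c fin E by simp
qed

lemma nsimplex_frame:
  assumes "nsimplex s n"
  obtains e p where "frame e n" "\<And>x. x \<in> convex hull s \<Longrightarrow> x - p \<in> span (e ` {..<n})"
proof -
  obtain f where f: "bij_betw f {..n} s" using nsimplex_param[OF assms] .
  show thesis using that[OF frame_simplex[OF assms f] convex_hull_diff_span[OF f]] .
qed

lemma flat_hull_finite:
  assumes "frame e n" "finite s" "E \<in> sets borel"
  shows "emeasure (flat e n p) (E \<inter> convex hull s) < \<infinity>"
  using assms by (intro flat_bounded_finite) (auto intro: bounded_subset finite_imp_bounded_convex_hull)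

lemma finite_measure_lam: "finite_measure (lam s)"
proof
  have S: "std_simplex m \<inter> space (PiM {..<m} (\<lambda>_. lborel)) = std_simplex m" for m
    by (auto simp: space_PiM std_simplex_def)
  show "emeasure (lam s) (space (lam s)) \<noteq> \<infinity>"
    unfolding lam_def Let_def using std_simplex_measure
    by (simp add: emeasure_distr vimage_def S ennreal_divide_eq_top_iff less_imp_neq less_imp_neq[symmetric])
qed

lemma measure_lam_hull:
  assumes "nsimplex s n" shows "measure (lam s) (convex hull s) = 1" "measure (lam s) UNIV = 1"
proof -
  have fin: "finite s" using assms by (simp add: nsimplex_def)
  obtain e p where e: "frame e n" "\<And>x. x \<in> convex hull s \<Longrightarrow> x - p \<in> span (e ` {..<n})"
    using nsimplex_frame[OF assms] by blast
  note lf = measure_lam_flat[OF assms e(1), of p]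
  show "measure (lam s) (convex hull s) = 1" "measure (lam s) UNIV = 1"
    using lf[of UNIV] lf[of "convex hull s"] e(2) fin by (auto simp: hull_inc)
qed

text \<open>A sub-simplex of full dimension lies in the same plane, so the frame of \<open>s\<close>
  computes both measures: \<open>lam a\<close> is \<open>lam s\<close> conditioned on the hull of
  \<open>a\<close>.\<close>

lemma measure_lam_restrict:
  assumes s: "nsimplex s n" and a: "nsimplex a n" and sub: "convex hull a \<subseteq> convex hull s"
    and E: "E \<in> sets borel"
  shows "measure (lam s) (convex hull a \<inter> E) = measure (lam s) (convex hull a) * measure (lam a) E"
    "0 < measure (lam s) (convex hull a)"
proof -
  have fin: "finite s" "finite a" using s a by (auto simp: nsimplex_def)
  obtain e p where e: "frame e n" "\<And>x. x \<in> convex hull s \<Longrightarrow> x - p \<in> span (e ` {..<n})"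
    using nsimplex_frame[OF s] by blast
  have ps: "\<And>x. x \<in> s \<Longrightarrow> x - p \<in> span (e ` {..<n})" "\<And>x. x \<in> a \<Longrightarrow> x - p \<in> span (e ` {..<n})"
    using e(2) sub by (auto simp: hull_inc subset_eq)
  have ls: "measure (lam s) E = measure (flat e n p) (E \<inter> convex hull s) / measure (flat e n p) (convex hull s)"
      "0 < measure (flat e n p) (convex hull s)" if "E \<in> sets borel" for E
    using measure_lam_flat[OF s e(1) _ that] ps(1) by blast+
  have la: "measure (lam a) E = measure (flat e n p) (E \<inter> convex hull a) / measure (flat e n p) (convex hull a)"
      "0 < measure (flat e n p) (convex hull a)"
    using measure_lam_flat[OF a e(1) _ E] ps(2) by blast+
  have i: "convex hull a \<inter> E \<inter> convex hull s = E \<inter> convex hull a" "convex hull a \<inter> convex hull s = convex hull a"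
    using sub by auto
  show "measure (lam s) (convex hull a \<inter> E) = measure (lam s) (convex hull a) * measure (lam a) E"
    "0 < measure (lam s) (convex hull a)"
    using ls[of "convex hull a \<inter> E"] ls[of "convex hull a"] la fin E by (simp_all add: i)
qed

text \<open>Every vertex ordering \<open>f\<close> may be used, whichever one \<open>lam\<close> has
  chosen.\<close>

lemma measure_lam_param:
  assumes s: "nsimplex s n" and f: "bij_betw f {..n} s" and E: "E \<in> sets borel"
  shows "measure (lam s) E = measure (Leb n) (std_simplex n \<inter> aff_param f n -` E)
    / measure (Leb n) (std_simplex n)"
  using measure_lam_flat(1)[OF s frame_simplex[OF s f] _ E, of "f n"] convex_hull_diff_span[OF f]
    flat_simplex[OF s f E] flat_simplex[OF s f, of UNIV]
  by (simp add: measure_def hull_inc)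

text \<open>One family of weights serves all vertex functions \<open>h\<close>; taking the identity
  and \<open>\<gamma>\<close> for \<open>h\<close> relates a point to its image.\<close>

lemma std_simplex_weights:
  fixes f :: "nat \<Rightarrow> 'a::euclidean_space"
  assumes f: "bij_betw f {..n} s" and y: "y \<in> std_simplex n"
  obtains b where "\<And>v. v \<in> s \<Longrightarrow> 0 \<le> b v" "sum b s = 1"
    "\<And>h :: 'a \<Rightarrow> 'b::euclidean_space. (\<Sum>v\<in>s. b v *\<^sub>R h v) = aff_param (h \<circ> f) n y"
proof -
  have re: "sum g s = (\<Sum>i\<le>n. g (f i))" for g :: "'a \<Rightarrow> 'c::comm_monoid_add"
    by (rule sum.reindex_bij_betw[OF f, symmetric])
  define \<beta> where "\<beta> i = (if i < n then y i else 1 - (\<Sum>i<n. y i))" for i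
  define b where "b v = \<beta> (the_inv_into {..n} f v)" for v
  have bf: "b (f i) = \<beta> i" if "i \<le> n" for i
    unfolding b_def using f that by (simp add: the_inv_into_f_f bij_betw_def)
  show thesis
  proof
    have "0 \<le> \<beta> i" if "i \<le> n" for i using y by (auto simp: \<beta>_def std_simplex_def)
    then show "0 \<le> b v" if "v \<in> s" for v using that f bf by (auto simp: bij_betw_def)
    have "sum b s = (\<Sum>i\<le>n. \<beta> i)" unfolding re by (rule sum.cong) (auto simp: bf)
    also have "\<dots> = 1" by (simp add: \<beta>_def lessThan_Suc_atMost[symmetric])
    finally show "sum b s = 1" .
    show "(\<Sum>v\<in>s. b v *\<^sub>R h v) = aff_param (h \<circ> f) n y" for h :: "'a \<Rightarrow> 'b"
      unfolding re aff_param_bary \<beta>_def[symmetric] by (rule sum.cong) (auto simp: bf)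
  qed
qed

text \<open>Composing a chart of \<open>a\<close> with \<open>h\<close> gives a chart of the image
  simplex, so both sides measure the same subset of the standard simplex.\<close>

lemma measure_lam_push:
  fixes \<gamma> :: "'a::euclidean_space \<Rightarrow> 'a"
  assumes a: "nsimplex a n" and b: "nsimplex (\<gamma> ` a) n" and h: "h \<in> borel_measurable borel"
    and aff: "\<And>b. (\<And>v. v \<in> a \<Longrightarrow> 0 \<le> b v) \<Longrightarrow> sum b a = 1 \<Longrightarrow>
       h (\<Sum>v\<in>a. b v *\<^sub>R v) = (\<Sum>v\<in>a. b v *\<^sub>R \<gamma> v)"
    and F: "F \<in> sets borel"
  shows "measure (lam a) (h -` F) = measure (lam (\<gamma> ` a)) F"
proof -
  obtain f where f: "bij_betw f {..n} a" using nsimplex_param[OF a] .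
  have "inj_on \<gamma> a" using a b by (intro eq_card_imp_inj_on) (auto simp: nsimplex_def)
  then have gf: "bij_betw (\<gamma> \<circ> f) {..n} (\<gamma> ` a)"
    using f by (intro bij_betw_trans[OF f]) (simp add: bij_betw_def)
  have "h (aff_param f n y) = aff_param (\<gamma> \<circ> f) n y" if y: "y \<in> std_simplex n" for y
  proof -
    obtain b where b: "\<And>v. v \<in> a \<Longrightarrow> 0 \<le> b v" "sum b a = 1"
      "\<And>h :: 'a \<Rightarrow> 'a. (\<Sum>v\<in>a. b v *\<^sub>R h v) = aff_param (h \<circ> f) n y"
      using std_simplex_weights[OF f y] by metis
    show ?thesis using aff[OF b(1,2)] b(3)[of \<gamma>] b(3)[of "\<lambda>x. x"] by (simp add: comp_def)
  qed
  then have "std_simplex n \<inter> aff_param f n -` (h -` F) = std_simplex n \<inter> aff_param (\<gamma> \<circ> f) n -` F"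
    by auto
  moreover have "h -` F \<in> sets borel" using h F by (simp add: measurable_sets_borel)
  ultimately show ?thesis
    using measure_lam_param[OF a f, of "h -` F"] measure_lam_param[OF b gf F] by simp
qed

text \<open>Infinitely many disjoint translates of the small simplex fit into a bounded set.\<close>
lemma flat_null_hull:
  assumes e: "frame e n" and dim: "dim (span (e ` {..<n})) = n" and t: "finite t" "card t \<le> n"
  shows "measure (flat e n p) (convex hull t) = 0"
proof (cases "t = {}")
  case False
  then obtain t0 where t0: "t0 \<in> t" by auto
  \<comment> \<open>Directions of \<open>t\<close> from \<open>t0\<close>: they span less than
    \<open>n\<close> dimensions, so some direction \<open>w\<close> of the plane escapes
    them.\<close>
  define D where "D = (\<lambda>x. - t0 + x) ` (t - {t0})"
  have "dim D \<le> card D" using t by (intro dim_le_card[of D D]) (auto simp: D_def span_superset)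
  also have "\<dots> \<le> card (t - {t0})" unfolding D_def using t by (intro card_image_le) auto
  also have "\<dots> < n" using t t0 by (metis card_Diff1_less le_neq_implies_less less_le_trans)
  finally have "\<not> span (e ` {..<n}) \<subseteq> span D" using dim dim_subset by (metis dim_span not_le)
  then obtain w where w: "w \<in> span (e ` {..<n})" "w \<notin> span D" by auto
  have hull: "x - t0 \<in> span D" if "x \<in> convex hull t" for x
    using that convex_hull_subset_affine_hull[of t] affine_hull_span2[OF t0] by (auto simp: D_def)
  \<comment> \<open>Two translates that meet would put a nonzero multiple of \<open>w\<close> into
    \<open>span D\<close>, so they are disjoint; the shrinking factors keep them in one bounded set.
    Equal measures with a finite sum must vanish.\<close>
  define A where "A k = (+) (inverse (real (Suc k)) *\<^sub>R w) -` (convex hull t)" for k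
  have Ab[measurable]: "A k \<in> sets borel" for k
    unfolding A_def using t by (simp add: measurable_sets_borel[of _ borel])
  have mA: "measure (flat e n p) (A k) = measure (flat e n p) (convex hull t)" for k
  proof -
    have "inverse (real (Suc k)) *\<^sub>R w \<in> span (e ` {..<n})" using w by (intro span_scale)
    then show ?thesis
      unfolding A_def measure_def using t
      by (simp add: flat_translate[symmetric] flat_shift del: of_nat_Suc)
  qed
  have disj: "disjoint_family A"
    unfolding disjoint_family_on_def
  proof (safe)
    fix i j x assume ij: "i \<noteq> j" and x: "x \<in> A i" "x \<in> A j"
    let ?r = "inverse (real (Suc i)) - inverse (real (Suc j))"
    have "(inverse (real (Suc i)) *\<^sub>R w + x - t0) - (inverse (real (Suc j)) *\<^sub>R w + x - t0) \<in> span D"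
      using x unfolding A_def by (intro span_diff hull) auto
    then have "?r *\<^sub>R w \<in> span D" by (simp add: scaleR_diff_left)
    then have "inverse ?r *\<^sub>R (?r *\<^sub>R w) \<in> span D" by (rule span_scale)
    then show "x \<in> {}" using ij w(2) by simp
  qed
  obtain r where r: "\<And>x. x \<in> convex hull t \<Longrightarrow> norm x \<le> r"
    using finite_imp_bounded_convex_hull[OF t(1)] unfolding bounded_iff by auto
  have "norm x \<le> r + norm w" if "x \<in> A k" for x k
  proof -
    have "norm x \<le> norm (inverse (real (Suc k)) *\<^sub>R w + x) + norm (inverse (real (Suc k)) *\<^sub>R w)"
      by (metis add_diff_cancel_left' norm_triangle_ineq4)
    moreover have "norm (inverse (real (Suc k)) *\<^sub>R w) \<le> 1 * norm w"
      unfolding norm_scaleR by (intro mult_right_mono) (auto simp: field_simps)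
    ultimately show ?thesis using r that unfolding A_def by fastforce
  qed
  then have "bounded (\<Union>k. A k)" unfolding bounded_iff by blast
  then have "emeasure (flat e n p) (\<Union>k. A k) \<noteq> \<infinity>"
    using flat_bounded_finite[OF e, of "\<Union>k. A k" p] by (simp add: less_top)
  then have "(\<lambda>k. measure (flat e n p) (A k)) sums measure (flat e n p) (\<Union>k. A k)"
    using disj by (intro measure_UNION) auto
  then have "summable (\<lambda>k::nat. measure (flat e n p) (convex hull t))"
    unfolding mA by (rule sums_summable)
  then show ?thesis by (simp add: summable_const_iff)
qed simp

text \<open>Distinct \<open>d\<close>-simplices of a complex overlap in the hull of at most
  \<open>d\<close> vertices; this makes such overlaps null.\<close>

lemma measure_lam_null:
  assumes s: "nsimplex s n" and t: "finite t" "card t \<le> n"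
  shows "measure (lam s) (convex hull t) = 0"
proof -
  obtain f where f: "bij_betw f {..n} s" using nsimplex_param[OF s] .
  let ?e = "\<lambda>i. f i - f n"
  note fr = frame_simplex[OF s f]
  have dim: "dim (span (?e ` {..<n})) = n"
    using frame_indep[OF s f] by (simp add: dim_eq_card_independent card_image)
  have fin: "finite s" using s by (simp add: nsimplex_def)
  have "measure (flat ?e n (f n)) (convex hull t \<inter> convex hull s) \<le> measure (flat ?e n (f n)) (convex hull t)"
    unfolding measure_def
    by (intro enn2real_mono emeasure_mono)
      (use flat_hull_finite[OF fr t(1), of UNIV] t fin in auto)
  then have "measure (flat ?e n (f n)) (convex hull t \<inter> convex hull s) = 0"
    using flat_null_hull[OF fr dim t] by (simp add: measure_le_0_iff)
  then show ?thesis
    using measure_lam_flat(1)[OF s fr, of "f n" "convex hull t"] convex_hull_diff_span[OF f] t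
    by (simp add: hull_inc)
qed

text \<open>Shrinking \<open>s\<close> towards \<open>x\<close> produces a simplex of the same
  dimension inside both \<open>U\<close> and the hull of \<open>s\<close>; by the restriction
  formula it has positive mass.\<close>

lemma measure_lam_open_pos:
  assumes s: "nsimplex s n" and U: "open U" "x \<in> U" "x \<in> convex hull s"
  shows "0 < measure (lam s) U"
proof -
  obtain r where r: "r > 0" "ball x r \<subseteq> U" using U openE by blast
  obtain M where M: "\<And>z. z \<in> convex hull s \<Longrightarrow> norm z \<le> M" "M > 0"
    using finite_imp_bounded_convex_hull[of s] s unfolding bounded_pos nsimplex_def by auto
  \<comment> \<open>Two points of the hull are at most \<open>2 * M\<close> apart, so the shrunken
    copy stays within r/2 of \<open>x\<close>; the bound 1 keeps \<open>h z\<close> a convex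
    combination.\<close>
  define \<epsilon> where "\<epsilon> = min 1 (r / (4 * M))"
  have \<epsilon>: "0 < \<epsilon>" "\<epsilon> \<le> 1" "\<epsilon> * (2 * M) < r" using r M by (auto simp: \<epsilon>_def min_def field_simps)
  define h where "h z = (1 - \<epsilon>) *\<^sub>R x + \<epsilon> *\<^sub>R z" for z
  have hull: "h z \<in> convex hull s" if "z \<in> convex hull s" for z
    unfolding h_def using \<epsilon> U that by (intro convexD[OF convex_convex_hull]) auto
  have near: "h z \<in> ball x r" if "z \<in> convex hull s" for z
  proof -
    have "x - h z = \<epsilon> *\<^sub>R (x - z)" by (simp add: h_def algebra_simps)
    then have "dist x (h z) = \<epsilon> * norm (x - z)" using \<epsilon> by (simp add: dist_norm)
    also have "\<dots> \<le> \<epsilon> * (2 * M)"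
      using \<epsilon> M(1)[OF that] M(1)[OF U(3)] norm_triangle_ineq4[of x z] by (intro mult_left_mono) auto
    finally show ?thesis using \<epsilon> by simp
  qed
  have sub: "convex hull (h ` s) \<subseteq> convex hull s" "convex hull (h ` s) \<subseteq> U"
  proof -
    have "convex hull (h ` s) \<subseteq> ball x r"
      by (rule hull_minimal) (use near in \<open>auto simp: hull_inc\<close>)
    then show "convex hull (h ` s) \<subseteq> U" using r(2) by blast
    show "convex hull (h ` s) \<subseteq> convex hull s"
      by (rule hull_minimal) (use hull in \<open>auto simp: hull_inc convex_convex_hull\<close>)
  qed
  have h_eq: "h ` s = (+) ((1 - \<epsilon>) *\<^sub>R x) ` ((*\<^sub>R) \<epsilon> ` s)" by (auto simp: h_def image_image)
  have inj: "inj h" using \<epsilon> by (auto simp: inj_on_def h_def)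
  have "aff_dim (h ` s) = aff_dim s"
    unfolding h_eq aff_dim_translation_eq using \<epsilon> by (intro aff_dim_injective_linear_image) (auto simp: inj_on_def)
  then have hs: "nsimplex (h ` s) n"
    using s inj unfolding nsimplex_def affine_independent_iff_card
    by (auto simp: card_image inj_on_subset)
  have "0 < measure (lam s) (convex hull (h ` s))"
    by (rule measure_lam_restrict(2)[OF s hs sub(1), of UNIV]) auto
  also have "\<dots> \<le> measure (lam s) U"
    using sub(2) U by (intro finite_measure.finite_measure_mono[OF finite_measure_lam]) auto
  finally show ?thesis .
qed

section \<open>Stationary distributions\<close>

lemma finite_convergent_subsequence:
  fixes v :: "nat \<Rightarrow> 's \<Rightarrow> real"
  assumes "finite S" "\<And>n s. s \<in> S \<Longrightarrow> \<bar>v n s\<bar> \<le> M"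
  shows "\<exists>r l. strict_mono r \<and> (\<forall>s\<in>S. (\<lambda>n. v (r n) s) \<longlonglongrightarrow> l s)"
  using assms
proof (induction S rule: finite_induct)
  case empty
  show ?case by (intro exI[of _ id]) (auto simp: strict_mono_def)
next
  case (insert a S)
  then obtain r l where r: "strict_mono r" "\<forall>s\<in>S. (\<lambda>n. v (r n) s) \<longlonglongrightarrow> l s" by auto
  have "bounded (range (\<lambda>n. v (r n) a))"
    using insert.prems by (auto simp: bounded_iff intro!: exI[of _ M])
  then obtain l' r' where r': "strict_mono r'" "((\<lambda>n. v (r n) a) \<circ> r') \<longlonglongrightarrow> l'"
    using bounded_imp_convergent_subsequence by blast
  have "(\<lambda>n. v ((r \<circ> r') n) s) \<longlonglongrightarrow> (l(a := l')) s" if "s \<in> insert a S" for s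
  proof (cases "s = a")
    case True
    then show ?thesis using r'(2) by (simp add: comp_def)
  next
    case False
    then have "(\<lambda>n. v (r n) s) \<longlonglongrightarrow> l s" using r(2) that by auto
    then show ?thesis using False LIMSEQ_subseq_LIMSEQ[OF _ r'(1)] by (fastforce simp: comp_def)
  qed
  then show ?case using strict_mono_o[OF r(1) r'(1)] by blast
qed

text \<open>Cesaro averages of the iterates of the uniform vector have a limit point, and it is
  stationary. \<open>M t s\<close> is the probability of passing from \<open>s\<close> to
  \<open>t\<close>, so it is the columns that sum to 1.\<close>

lemma stationary_exists:
  fixes M :: "'s \<Rightarrow> 's \<Rightarrow> real"
  assumes fin: "finite B" "B \<noteq> {}" and M0: "\<And>s t. s \<in> B \<Longrightarrow> t \<in> B \<Longrightarrow> 0 \<le> M t s"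
    and M1: "\<And>s. s \<in> B \<Longrightarrow> (\<Sum>t\<in>B. M t s) = 1"
  obtains v where "\<And>s. s \<in> B \<Longrightarrow> 0 \<le> v s" "sum v B = 1" "\<And>t. t \<in> B \<Longrightarrow> (\<Sum>s\<in>B. M t s * v s) = v t"
proof -
  define w where "w = rec_nat (\<lambda>_. 1 / real (card B)) (\<lambda>_ w t. \<Sum>s\<in>B. M t s * w s)"
  have w_Suc: "w (Suc n) t = (\<Sum>s\<in>B. M t s * w n s)" for n t by (simp add: w_def)
  have w0: "0 \<le> w n t" if "t \<in> B" for n t
    using that by (induction n arbitrary: t) (auto simp: w_Suc w_def M0 intro!: sum_nonneg)
  have w1: "sum (w n) B = 1" for n
  proof (induction n)
    case 0
    show ?case using fin by (simp add: w_def)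
  next
    case (Suc n)
    have "sum (w (Suc n)) B = (\<Sum>s\<in>B. w n s * (\<Sum>t\<in>B. M t s))"
      unfolding w_Suc by (subst sum.swap) (simp add: sum_distrib_left mult.commute)
    then show ?case using M1 Suc by simp
  qed
  have wle: "w n t \<le> 1" if "t \<in> B" for n t
    using member_le_sum[of t B "w n"] w0 w1[of n] fin that by auto
  define u where "u n t = (\<Sum>i<Suc n. w i t) / real (Suc n)" for n t
  have u0: "0 \<le> u n t" if "t \<in> B" for n t
    using w0[OF that] by (simp add: u_def sum_nonneg del: sum.lessThan_Suc)
  have u1: "sum (u n) B = 1" for n
  proof -
    have "sum (u n) B = (\<Sum>i<Suc n. sum (w i) B) / real (Suc n)"
      unfolding u_def by (simp only: sum_divide_distrib[symmetric] sum.swap[of _ B])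
    then show ?thesis by (simp only: w1) simp
  qed
  have ule: "\<bar>u n t\<bar> \<le> 1" if "t \<in> B" for n t
    using member_le_sum[of t B "u n"] u0 u1[of n] fin that by auto
  obtain r v where r: "strict_mono r" "\<forall>s\<in>B. (\<lambda>n. u (r n) s) \<longlonglongrightarrow> v s"
    using finite_convergent_subsequence[of B u 1] fin ule by blast
  show thesis
  proof
    show "0 \<le> v s" if "s \<in> B" for s
      using r(2) that u0[OF that] by (intro LIMSEQ_le_const[of "\<lambda>n. u (r n) s"]) auto
    have "(\<lambda>n. sum (u (r n)) B) \<longlonglongrightarrow> sum v B" using r(2) by (intro tendsto_sum) auto
    then show "sum v B = 1" by (simp add: u1 LIMSEQ_const_iff)
    fix t assume t: "t \<in> B"
    \<comment> \<open>Applying \<open>M\<close> to the average advances every iterate by one, so the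
      difference telescopes to the first and last iterates, divided by \<open>Suc n\<close>.\<close>
    have "(\<Sum>s\<in>B. M t s * u n s) - u n t = (w (Suc n) t - w 0 t) / real (Suc n)" for n
    proof -
      have "(\<Sum>s\<in>B. M t s * u n s) = (\<Sum>i<Suc n. \<Sum>s\<in>B. M t s * w i s) / real (Suc n)"
        unfolding u_def by (subst sum.swap) (simp add: sum_divide_distrib sum_distrib_left del: sum.lessThan_Suc)
      also have "\<dots> = (\<Sum>i<Suc n. w (Suc i) t) / real (Suc n)" by (simp only: w_Suc)
      finally have "(\<Sum>s\<in>B. M t s * u n s) - u n t = (\<Sum>i<Suc n. w (Suc i) t - w i t) / real (Suc n)"
        unfolding u_def by (simp only: sum_subtractf diff_divide_distrib)
      then show ?thesis by (simp only: sum_lessThan_telescope[of "\<lambda>i. w i t"])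
    qed
    moreover have "(\<lambda>n. (w (Suc n) t - w 0 t) / real (Suc n)) \<longlonglongrightarrow> 0"
    proof (rule Lim_null_comparison)
      show "\<forall>\<^sub>F n in sequentially. norm ((w (Suc n) t - w 0 t) / real (Suc n)) \<le> inverse (real (Suc n))"
      proof (intro always_eventually allI)
        fix n
        have "\<bar>w (Suc n) t - w 0 t\<bar> \<le> 1" using w0[OF t, of "Suc n"] wle[OF t, of "Suc n"] w0[OF t, of 0] wle[OF t, of 0] by linarith
        then show "norm ((w (Suc n) t - w 0 t) / real (Suc n)) \<le> inverse (real (Suc n))"
          by (simp add: field_simps del: of_nat_Suc)
      qed
      show "(\<lambda>n. inverse (real (Suc n))) \<longlonglongrightarrow> 0" by (rule LIMSEQ_inverse_real_of_nat)
    qed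
    ultimately have "(\<lambda>n. (\<Sum>s\<in>B. M t s * u n s) - u n t) \<longlonglongrightarrow> 0" by simp
    then have "(\<lambda>n. (\<Sum>s\<in>B. M t s * u (r n) s) - u (r n) t) \<longlonglongrightarrow> 0"
      using LIMSEQ_subseq_LIMSEQ[OF _ r(1)] by (fastforce simp: comp_def)
    moreover have "(\<lambda>n. (\<Sum>s\<in>B. M t s * u (r n) s) - u (r n) t) \<longlonglongrightarrow> (\<Sum>s\<in>B. M t s * v s) - v t"
      using r(2) t by (intro tendsto_intros) auto
    ultimately have "(\<Sum>s\<in>B. M t s * v s) - v t = 0" by (rule LIMSEQ_unique[rotated])
    then show "(\<Sum>s\<in>B. M t s * v s) = v t" by simp
  qed
qed

text \<open>Stationarity makes \<open>v b\<close> at least \<open>M b a * v a\<close>, so positivity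
  spreads along the edges.\<close>

lemma stationary_pos:
  fixes M :: "'s \<Rightarrow> 's \<Rightarrow> real"
  assumes fin: "finite B" and M0: "\<And>s t. s \<in> B \<Longrightarrow> t \<in> B \<Longrightarrow> 0 \<le> M t s"
    and v: "\<And>s. s \<in> B \<Longrightarrow> 0 \<le> v s" "\<And>t. t \<in> B \<Longrightarrow> (\<Sum>s\<in>B. M t s * v s) = v t"
    and s: "0 < v s" and st: "(s, t) \<in> {(s, t). s \<in> B \<and> t \<in> B \<and> 0 < M t s}\<^sup>+"
  shows "0 < v t"
  using st
proof (induction rule: trancl_induct)
  have step: "0 < v b" if "a \<in> B" "b \<in> B" "0 < M b a" "0 < v a" for a b
  proof -
    have "0 < M b a * v a" using that by simp
    also have "\<dots> \<le> (\<Sum>s\<in>B. M b s * v s)"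
      using that fin M0 v(1) by (intro member_le_sum) auto
    finally show ?thesis using v(2) that by simp
  qed
  {
    case (base t)
    then show ?case using step s by auto
  next
    case (step t u)
    then show ?case using \<open>\<And>a b. a \<in> B \<Longrightarrow> b \<in> B \<Longrightarrow> 0 < M b a \<Longrightarrow> 0 < v a \<Longrightarrow> 0 < v b\<close> by auto
  }
qed

text \<open>Subtract from \<open>v\<close> the largest multiple of \<open>w\<close> that keeps it nonnegative.\<close>
lemma stationary_unique:
  fixes M :: "'s \<Rightarrow> 's \<Rightarrow> real"
  assumes fin: "finite B" "B \<noteq> {}" and M0: "\<And>s t. s \<in> B \<Longrightarrow> t \<in> B \<Longrightarrow> 0 \<le> M t s"
    and irr: "\<And>s t. s \<in> B \<Longrightarrow> t \<in> B \<Longrightarrow> (s, t) \<in> {(s, t). s \<in> B \<and> t \<in> B \<and> 0 < M t s}\<^sup>+"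
    and v: "\<And>s. s \<in> B \<Longrightarrow> 0 < v s" "sum v B = 1" "\<And>t. t \<in> B \<Longrightarrow> (\<Sum>s\<in>B. M t s * v s) = v t"
    and w: "\<And>s. s \<in> B \<Longrightarrow> 0 < w s" "sum w B = 1" "\<And>t. t \<in> B \<Longrightarrow> (\<Sum>s\<in>B. M t s * w s) = w t"
    and s: "s \<in> B"
  shows "v s = w s"
proof -
  define c where "c = Min ((\<lambda>s. v s / w s) ` B)"
  define z where "z s = v s - c * w s" for s
  have c_le: "c \<le> v s / w s" if "s \<in> B" for s unfolding c_def using fin that by (intro Min_le) auto
  have z0: "0 \<le> z s" if "s \<in> B" for s
    using c_le[OF that] w(1)[OF that] by (simp add: z_def field_simps)
  have zM: "(\<Sum>s\<in>B. M t s * z s) = z t" if "t \<in> B" for t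
  proof -
    have "(\<Sum>s\<in>B. M t s * z s) = (\<Sum>s\<in>B. M t s * v s) - c * (\<Sum>s\<in>B. M t s * w s)"
      by (simp add: z_def right_diff_distrib sum_subtractf sum_distrib_left mult.left_commute)
    then show ?thesis using v(3)[OF that] w(3)[OF that] by (simp add: z_def)
  qed
  have "c \<in> (\<lambda>s. v s / w s) ` B" unfolding c_def using fin by (intro Min_in) auto
  then obtain b where b: "b \<in> B" "c = v b / w b" by auto
  then have zb: "z b = 0" using w(1)[of b] by (simp add: z_def)
  \<comment> \<open>\<open>z\<close> is nonnegative and stationary; were it positive anywhere,
    irreducibility would make it positive at \<open>b\<close>, where the minimal ratio is
    attained.\<close>
  have z_zero: "z a = 0" if a: "a \<in> B" for a
  proof (rule ccontr)
    assume "z a \<noteq> 0"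
    then have "0 < z a" using z0[OF a] by simp
    then have "0 < z b" using stationary_pos[OF fin(1) M0 z0 zM _ irr[OF a b(1)]] by blast
    then show False using zb by simp
  qed
  have "sum v B = c * sum w B"
    using z_zero by (simp add: z_def sum_distrib_left)
  then have "c = 1" using v(2) w(2) by simp
  then show ?thesis using z_zero[OF s] by (simp add: z_def)
qed

text \<open>The two sums differ in their end terms only. This gives both the invariance of the
  limsup of averages and the passage of genericity from \<open>T x\<close> back to
  \<open>x\<close>.\<close>

lemma average_shift_null:
  fixes u :: "'a \<Rightarrow> real"
  assumes b: "\<And>n. \<bar>u ((T ^^ n) x)\<bar> \<le> b"
  shows "(\<lambda>n. (\<Sum>i<n. u ((T ^^ i) (T x))) / real n - (\<Sum>i<n. u ((T ^^ i) x)) / real n) \<longlonglongrightarrow> 0"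
proof (rule Lim_null_comparison)
  show "\<forall>\<^sub>F n in sequentially. norm ((\<Sum>i<n. u ((T ^^ i) (T x))) / real n - (\<Sum>i<n. u ((T ^^ i) x)) / real n)
      \<le> 2 * b * inverse (real n)"
  proof (intro always_eventually allI)
    fix n
    have "(\<Sum>i<n. u ((T ^^ i) (T x))) = (\<Sum>i<n. u ((T ^^ Suc i) x))" by (simp add: funpow_swap1)
    then have "(\<Sum>i<n. u ((T ^^ i) (T x))) - (\<Sum>i<n. u ((T ^^ i) x)) = u ((T ^^ n) x) - u x"
      using sum_lessThan_telescope[of "\<lambda>i. u ((T ^^ i) x)" n] by (simp add: sum_subtractf)
    moreover have "\<bar>u ((T ^^ n) x) - u x\<bar> \<le> 2 * b" using b[of n] b[of 0] by simp
    ultimately have "norm (((\<Sum>i<n. u ((T ^^ i) (T x))) - (\<Sum>i<n. u ((T ^^ i) x))) / real n) \<le> 2 * b * inverse (real n)"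
      by (simp add: divide_inverse abs_mult mult_right_mono)
    then show "norm ((\<Sum>i<n. u ((T ^^ i) (T x))) / real n - (\<Sum>i<n. u ((T ^^ i) x)) / real n)
        \<le> 2 * b * inverse (real n)"
      by (simp only: diff_divide_distrib)
  qed
  show "(\<lambda>n. 2 * b * inverse (real n)) \<longlonglongrightarrow> 0"
    using tendsto_mult_left[OF lim_inverse_n, of "2 * b"] by simp
qed

section \<open>The ergodic theorem\<close>

text \<open>The transformation acts on the whole type because \<open>plmap\<close> is the identity
  off the polyhedron.\<close>

locale mpt =
  fixes \<mu> :: "'a::topological_space measure" and T :: "'a \<Rightarrow> 'a"
  assumes sets_mu: "sets \<mu> = sets borel" and prob: "emeasure \<mu> UNIV = 1"
    and T_meas [measurable]: "T \<in> borel_measurable borel"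
    and inv: "\<And>A. A \<in> sets borel \<Longrightarrow> emeasure \<mu> (T -` A) = emeasure \<mu> A"
begin

lemma space_mu: "space \<mu> = UNIV"
  using sets_eq_imp_space_eq[OF sets_mu] by simp

sublocale finite_measure \<mu>
  by standard (simp add: space_mu prob)

lemma AE_full:
  assumes "A \<in> sets borel" "emeasure \<mu> A = 1" shows "AE x in \<mu>. x \<in> A"
proof -
  have "emeasure \<mu> (space \<mu> - A) = 0"
    using emeasure_compl[of A \<mu>] prob assms by (simp add: sets_mu space_mu)
  then have "- A \<in> null_sets \<mu>"
    using assms(1) by (simp add: null_sets_def sets_mu space_mu Compl_eq_Diff_UNIV)
  then show ?thesis by (rule AE_I') auto
qed

lemma meas_mu: "measurable \<mu> N = measurable borel N"
  by (rule measurable_cong_sets[OF sets_mu refl])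

lemma T_funpow_meas [measurable]: "T ^^ i \<in> borel_measurable borel"
  by (induction i) (auto intro: measurable_comp[OF _ T_meas] simp: comp_def id_def)

lemma distr_T: "distr \<mu> borel T = \<mu>"
proof (rule measure_eqI)
  fix A assume "A \<in> sets (distr \<mu> borel T)"
  then show "emeasure (distr \<mu> borel T) A = emeasure \<mu> A"
    using inv by (simp add: emeasure_distr meas_mu space_mu)
qed (simp add: sets_mu)

lemma integral_T:
  fixes u :: "'a \<Rightarrow> real"
  assumes [measurable]: "u \<in> borel_measurable borel"
  shows "(\<integral>x. u ((T ^^ i) x) \<partial>\<mu>) = (\<integral>x. u x \<partial>\<mu>)"
proof (induction i)
  case (Suc i)
  have "(\<integral>x. u ((T ^^ Suc i) x) \<partial>\<mu>) = (\<integral>x. u ((T ^^ i) (T x)) \<partial>\<mu>)"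
    by (simp add: funpow_swap1)
  also have "\<dots> = (\<integral>x. u ((T ^^ i) x) \<partial>distr \<mu> borel T)"
    by (subst integral_distr) (auto simp: meas_mu)
  finally show ?case using Suc by (simp add: distr_T)
qed simp

lemma integrable_bounded:
  fixes u :: "'a \<Rightarrow> real"
  assumes "u \<in> borel_measurable borel" "\<And>x. \<bar>u x\<bar> \<le> b"
  shows "integrable \<mu> u"
  by (rule integrable_const_bound[of _ b]) (use assms in \<open>auto simp: meas_mu\<close>)

text \<open>Katznelson and Weiss: on the small set where the average reaches level \<open>c\<close> only after time \<open>N\<close>,
  replace \<open>u\<close> by a large constant, so that every orbit splits into short blocks of average at least \<open>c\<close>.\<close>
lemma integral_ge_of_averages:
  fixes u :: "'a \<Rightarrow> real"
  assumes u [measurable]: "u \<in> borel_measurable borel" and u01: "\<And>x. 0 \<le> u x" "\<And>x. u x \<le> 1" and c: "0 \<le> c"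
    and ae: "AE x in \<mu>. \<exists>n\<ge>1. real n * c \<le> (\<Sum>i<n. u ((T ^^ i) x))"
  shows "c \<le> (\<integral>x. u x \<partial>\<mu>)"
proof (rule field_le_epsilon)
  fix e :: real assume e: "0 < e"
  \<comment> \<open>Large enough that a single point outside \<open>A N\<close> is already a block
    of average at least \<open>c\<close>, and positive even for c = 0.\<close>
  define b where "b = 1 + c"
  define A where "A N = {x. \<exists>n\<in>{1..N}. real n * c \<le> (\<Sum>i<n. u ((T ^^ i) x))}" for N
  have A_meas[measurable]: "A N \<in> sets borel" for N unfolding A_def by measurable
  have "(\<lambda>N. measure \<mu> (A N)) \<longlonglongrightarrow> measure \<mu> (\<Union>N. A N)"
  proof (rule finite_Lim_measure_incseq)
    show "range A \<subseteq> sets \<mu>" by (auto simp: sets_mu)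
    show "incseq A" unfolding incseq_def A_def by fastforce
  qed
  also have "measure \<mu> (\<Union>N. A N) = measure \<mu> UNIV"
  proof (rule measure_eq_AE)
    show "AE x in \<mu>. x \<in> (\<Union>N. A N) \<longleftrightarrow> x \<in> UNIV"
      using ae by eventually_elim (fastforce simp: A_def)
  qed (simp_all add: sets_mu)
  also have "measure \<mu> UNIV = 1" using prob by (simp add: measure_def)
  finally have "eventually (\<lambda>N. 1 - e / b < measure \<mu> (A N)) sequentially"
    using e c by (intro order_tendstoD(1)) (auto simp: b_def)
  then obtain N where N: "1 - e / b < measure \<mu> (A N)" by (auto simp: eventually_sequentially)
  define w where "w x = u x + b * indicator (- A N) x" for x
  have w_meas[measurable]: "w \<in> borel_measurable borel" unfolding w_def by measurable
  have bpos: "0 < b" using c by (simp add: b_def)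
  have w0: "0 \<le> w x" and uw: "u x \<le> w x" for x using u01 bpos by (auto simp: w_def indicator_def)
  have wb: "\<bar>w x\<bar> \<le> 1 + b" for x using w0[of x] u01(2)[of x] bpos by (auto simp: w_def indicator_def)
  \<comment> \<open>Cut the orbit greedily into blocks of average at least \<open>c\<close>; at most
    \<open>N\<close> terms at the end may fail to form a block, which costs at most
    \<open>N * c\<close>.\<close>
  have block: "(real L - real N) * c \<le> (\<Sum>i<L. w ((T ^^ i) x))" for L x
  proof (induction L arbitrary: x rule: less_induct)
    case (less L)
    show ?case
    proof (cases "L \<le> N")
      case True
      then have "(real L - real N) * c \<le> 0" using c by (simp add: mult_nonpos_nonneg)
      also have "0 \<le> (\<Sum>i<L. w ((T ^^ i) x))" by (intro sum_nonneg w0)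
      finally show ?thesis .
    next
      case False
      have "\<exists>k. 1 \<le> k \<and> k \<le> L \<and> real k * c \<le> (\<Sum>i<k. w ((T ^^ i) x))"
      proof (cases "x \<in> A N")
        case True
        then obtain k where k: "1 \<le> k" "k \<le> N" "real k * c \<le> (\<Sum>i<k. u ((T ^^ i) x))"
          by (auto simp: A_def)
        note k(3)
        also have "(\<Sum>i<k. u ((T ^^ i) x)) \<le> (\<Sum>i<k. w ((T ^^ i) x))" by (intro sum_mono uw)
        finally show ?thesis using k False by (intro exI[of _ k]) auto
      next
        case out: False
        then have "c \<le> w x" using u01(1)[of x] by (simp add: w_def b_def)
        then show ?thesis using False by (intro exI[of _ 1]) auto
      qed
      then obtain k where k: "1 \<le> k" "k \<le> L" "real k * c \<le> (\<Sum>i<k. w ((T ^^ i) x))" by blast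
      have "(real (L - k) - real N) * c \<le> (\<Sum>i<L - k. w ((T ^^ i) ((T ^^ k) x)))"
        using k by (intro less) auto
      moreover have "(\<Sum>i<L. w ((T ^^ i) x)) = (\<Sum>i<k. w ((T ^^ i) x)) + (\<Sum>i<L - k. w ((T ^^ i) ((T ^^ k) x)))"
      proof -
        have "(\<Sum>i<L. w ((T ^^ i) x)) = (\<Sum>i<k. w ((T ^^ i) x)) + (\<Sum>i=k..<L. w ((T ^^ i) x))"
          using sum.atLeastLessThan_concat[of 0 k L "\<lambda>i. w ((T ^^ i) x)"] k by (simp add: atLeast0LessThan)
        also have "(\<Sum>i=k..<L. w ((T ^^ i) x)) = (\<Sum>i<L - k. w ((T ^^ (i + k)) x))"
          using sum.shift_bounds_nat_ivl[of "\<lambda>i. w ((T ^^ i) x)" 0 k "L - k"] k by (simp add: atLeast0LessThan)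
        finally show ?thesis by (simp add: funpow_add)
      qed
      ultimately show ?thesis using k by (simp add: of_nat_diff algebra_simps)
    qed
  qed
  have iw: "integrable \<mu> (\<lambda>x. w ((T ^^ i) x))" for i
    using wb by (intro integrable_bounded[where b="1 + b"]) auto
  have "(real L - real N) * c \<le> real L * (\<integral>x. w x \<partial>\<mu>)" for L
  proof -
    have "(real L - real N) * c = (\<integral>x. (real L - real N) * c \<partial>\<mu>)" using prob by (simp add: space_mu measure_def)
    also have "\<dots> \<le> (\<integral>x. (\<Sum>i<L. w ((T ^^ i) x)) \<partial>\<mu>)"
      using block iw by (intro integral_mono) auto
    also have "\<dots> = real L * (\<integral>x. w x \<partial>\<mu>)"
      using iw by (simp add: integral_T)
    finally show ?thesis .
  qed
  \<comment> \<open>The right side does not depend on \<open>L\<close>, so the factor of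
    \<open>L\<close> on the left cannot be positive.\<close>
  then have "real L * (c - (\<integral>x. w x \<partial>\<mu>)) \<le> real N * c" for L by (simp add: algebra_simps)
  then have cw: "c \<le> (\<integral>x. w x \<partial>\<mu>)"
    using ex_less_of_nat_mult[of "c - (\<integral>x. w x \<partial>\<mu>)" "real N * c"] by (meson not_le diff_gt_0_iff_gt)
  have iu: "integrable \<mu> u" using u01 by (intro integrable_bounded[where b=1]) auto
  have "(\<integral>x. w x \<partial>\<mu>) = (\<integral>x. u x \<partial>\<mu>) + b * measure \<mu> (- A N)"
  proof -
    have "integrable \<mu> (\<lambda>x. b * indicator (- A N) x)"
      by (intro integrable_mult_right integrable_real_indicator) (auto simp: sets_mu emeasure_eq_measure)
    then show ?thesis unfolding w_def using iu by (simp add: sets_mu space_mu)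
  qed
  also have "measure \<mu> (- A N) = 1 - measure \<mu> (A N)"
    using finite_measure_compl[of "A N"] prob by (simp add: sets_mu space_mu Compl_eq_Diff_UNIV measure_def)
  also have "b * (1 - measure \<mu> (A N)) \<le> e" using N bpos by (simp add: field_simps)
  finally show "c \<le> (\<integral>x. u x \<partial>\<mu>) + e" using cw by simp
qed

definition avg :: "('a \<Rightarrow> real) \<Rightarrow> nat \<Rightarrow> 'a \<Rightarrow> real" where
  "avg u n x = (\<Sum>i<n. u ((T ^^ i) x)) / real n"

lemma avg_meas [measurable]:
  assumes [measurable]: "u \<in> borel_measurable borel"
  shows "avg u n \<in> borel_measurable borel"
  unfolding avg_def[abs_def] by measurable

text \<open>This makes the superlevel sets of the limsup strictly invariant, as ergodicity speaks of
  sets equal to their own preimage.\<close>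

lemma limsup_avg_shift:
  assumes "\<And>x. 0 \<le> u x" "\<And>x. u x \<le> 1"
  shows "limsup (\<lambda>n. ereal (avg u n (T x))) = limsup (\<lambda>n. ereal (avg u n x))"
proof -
  define r where "r n = avg u n (T x) - avg u n x" for n
  have r: "r \<longlonglongrightarrow> 0"
    unfolding r_def avg_def by (rule average_shift_null[where b = 1]) (use assms in \<open>auto simp: abs_le_iff\<close>)
  have "avg u n (T x) = r n + avg u n x" for n by (simp add: r_def)
  then have "limsup (\<lambda>n. ereal (avg u n (T x))) = limsup (\<lambda>n. ereal (r n) + ereal (avg u n x))" by simp
  also have "\<dots> = ereal 0 + limsup (\<lambda>n. ereal (avg u n x))"
    using r by (intro ereal_limsup_lim_add) auto
  finally show ?thesis by simp
qed

text \<open>If the limsup exceeded some \<open>c\<close> above the integral on a set of positive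
  measure, ergodicity would give that set full measure, and the preceding estimate would make the
  integral at least \<open>c\<close>.\<close>

lemma limsup_avg_le:
  fixes u :: "'a \<Rightarrow> real"
  assumes erg: "\<And>A. A \<in> sets borel \<Longrightarrow> T -` A = A \<Longrightarrow> emeasure \<mu> A = 0 \<or> emeasure \<mu> A = 1"
    and u [measurable]: "u \<in> borel_measurable borel" and u01: "\<And>x. 0 \<le> u x" "\<And>x. u x \<le> 1"
  shows "AE x in \<mu>. limsup (\<lambda>n. ereal (avg u n x)) \<le> ereal (\<integral>x. u x \<partial>\<mu>)"
proof -
  let ?I = "\<integral>x. u x \<partial>\<mu>"
  have I0: "0 \<le> ?I" using u01 by simp
  have "AE x in \<mu>. limsup (\<lambda>n. ereal (avg u n x)) \<le> ereal (?I + inverse (real (Suc k)))" for k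
  proof -
    define c where "c = ?I + inverse (real (Suc k))"
    have cI: "?I < c" "0 \<le> c" using I0 by (auto simp: c_def)
    define A where "A = {x. ereal c < limsup (\<lambda>n. ereal (avg u n x))}"
    have [measurable]: "A \<in> sets borel" unfolding A_def by measurable
    have "T -` A = A" by (auto simp: A_def limsup_avg_shift[OF u01])
    moreover have "emeasure \<mu> A \<noteq> 1"
    proof
      assume "emeasure \<mu> A = 1"
      then have "AE x in \<mu>. x \<in> A" by (intro AE_full) auto
      then have "AE x in \<mu>. \<exists>n\<ge>1. real n * c \<le> (\<Sum>i<n. u ((T ^^ i) x))"
      proof eventually_elim
        fix x assume "x \<in> A"
        then have "ereal c < limsup (\<lambda>n. ereal (avg u n x))" by (simp add: A_def)
        also have "\<dots> \<le> (SUP n\<in>{1..}. ereal (avg u n x))" unfolding limsup_INF_SUP by (rule INF_lower) simp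
        finally obtain n where n: "n \<ge> 1" "c < avg u n x" by (auto simp: less_SUP_iff)
        then show "\<exists>n\<ge>1. real n * c \<le> (\<Sum>i<n. u ((T ^^ i) x))"
          by (intro exI[of _ n]) (auto simp: avg_def field_simps)
      qed
      then have "c \<le> ?I" by (intro integral_ge_of_averages u u01 cI(2))
      then show False using cI by simp
    qed
    ultimately have "emeasure \<mu> A = 0" using erg[of A] by simp
    then have "A \<in> null_sets \<mu>" by (auto simp: null_sets_def sets_mu)
    then show ?thesis unfolding c_def[symmetric] by (rule AE_I') (auto simp: A_def)
  qed
  then have "AE x in \<mu>. \<forall>k. limsup (\<lambda>n. ereal (avg u n x)) \<le> ereal (?I + inverse (real (Suc k)))"
    by (simp add: AE_all_countable)
  then show ?thesis
  proof eventually_elim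
    fix x assume le: "\<forall>k. limsup (\<lambda>n. ereal (avg u n x)) \<le> ereal (?I + inverse (real (Suc k)))"
    have "(\<lambda>k. ?I + inverse (real (Suc k))) \<longlonglongrightarrow> ?I + 0"
      by (intro tendsto_intros LIMSEQ_inverse_real_of_nat)
    then have "(\<lambda>k. ereal (?I + inverse (real (Suc k)))) \<longlonglongrightarrow> ereal ?I" by simp
    then show "limsup (\<lambda>n. ereal (avg u n x)) \<le> ereal ?I"
      by (rule LIMSEQ_le_const) (use le in auto)
  qed
qed

text \<open>The upper bound applied to \<open>1 - u\<close> is the lower bound for
  \<open>u\<close>.\<close>

theorem birkhoff_ergodic:
  fixes u :: "'a \<Rightarrow> real"
  assumes erg: "\<And>A. A \<in> sets borel \<Longrightarrow> T -` A = A \<Longrightarrow> emeasure \<mu> A = 0 \<or> emeasure \<mu> A = 1"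
    and u [measurable]: "u \<in> borel_measurable borel" and u01: "\<And>x. 0 \<le> u x" "\<And>x. u x \<le> 1"
  shows "AE x in \<mu>. (\<lambda>n. avg u n x) \<longlonglongrightarrow> (\<integral>x. u x \<partial>\<mu>)"
proof -
  let ?I = "\<integral>x. u x \<partial>\<mu>"
  have iu: "integrable \<mu> u" using u01 by (intro integrable_bounded[where b=1]) auto
  have I': "(\<integral>x. 1 - u x \<partial>\<mu>) = 1 - ?I" using iu prob by (simp add: space_mu measure_def)
  have "AE x in \<mu>. limsup (\<lambda>n. ereal (avg u n x)) \<le> ereal ?I" by (rule limsup_avg_le[OF erg u u01])
  moreover have "AE x in \<mu>. limsup (\<lambda>n. ereal (avg (\<lambda>x. 1 - u x) n x)) \<le> ereal (1 - ?I)"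
    unfolding I'[symmetric] by (rule limsup_avg_le[OF erg]) (use u01 in auto)
  ultimately show ?thesis
  proof eventually_elim
    fix x assume a: "limsup (\<lambda>n. ereal (avg u n x)) \<le> ereal ?I"
      and b: "limsup (\<lambda>n. ereal (avg (\<lambda>x. 1 - u x) n x)) \<le> ereal (1 - ?I)"
    have up: "\<forall>\<^sub>F n in sequentially. avg u n x < y" if "?I < y" for y
    proof -
      have "limsup (\<lambda>n. ereal (avg u n x)) < ereal y" using a that by (metis ereal_less_eq(3) le_less_trans less_ereal.simps(1))
      from Limsup_lessD[OF this] show ?thesis by simp
    qed
    have low: "\<forall>\<^sub>F n in sequentially. y < avg u n x" if "y < ?I" for y
    proof -
      have "limsup (\<lambda>n. ereal (avg (\<lambda>x. 1 - u x) n x)) < ereal (1 - y)"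
        using b that by (metis diff_strict_left_mono le_less_trans less_ereal.simps(1))
      then have "\<forall>\<^sub>F n in sequentially. avg (\<lambda>x. 1 - u x) n x < 1 - y" using Limsup_lessD by fastforce
      \<comment> \<open>At n = 0 both averages are 0, so complementing requires n > 0.\<close>
      then show ?thesis using eventually_gt_at_top[of 0]
      proof eventually_elim
        case (elim n)
        then have "avg (\<lambda>x. 1 - u x) n x = 1 - avg u n x"
          by (simp add: avg_def sum_subtractf diff_divide_distrib)
        then show ?case using elim by simp
      qed
    qed
    show "(\<lambda>n. avg u n x) \<longlonglongrightarrow> ?I" using up low by (intro order_tendstoI) auto
  qed
qed

end

section \<open>Simplicial systems\<close>

lemma bary_unique:
  assumes "finite s" "\<not> affine_dependent s" "sum b s = sum c s"
    and "(\<Sum>v\<in>s. b v *\<^sub>R v) = (\<Sum>v\<in>s. c v *\<^sub>R v)" "v \<in> s"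
  shows "b v = c v"
proof (rule ccontr)
  assume "b v \<noteq> c v"
  then have "affine_dependent s"
    unfolding affine_dependent_explicit_finite[OF assms(1)] using assms
    by (intro exI[of _ "\<lambda>v. b v - c v"]) (auto simp: sum_subtractf scaleR_diff_left)
  then show False using assms by simp
qed

text \<open>No sign condition is imposed: on the affine hull of a simplex, affine independence alone
  determines the values at the vertices. Values off \<open>s\<close> are arbitrary.\<close>

definition bary :: "'a::euclidean_space set \<Rightarrow> 'a \<Rightarrow> 'a \<Rightarrow> real" where
  "bary s x = (SOME b. sum b s = 1 \<and> (\<Sum>v\<in>s. b v *\<^sub>R v) = x)"

lemma baryI:
  assumes "nsimplex s n" "sum b s = 1" "(\<Sum>v\<in>s. b v *\<^sub>R v) = x" "v \<in> s"
  shows "bary s x v = b v"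
proof -
  have "sum (bary s x) s = 1 \<and> (\<Sum>v\<in>s. bary s x v *\<^sub>R v) = x"
    unfolding bary_def by (rule someI[of _ b]) (use assms in auto)
  then show ?thesis
    using bary_unique[of s "bary s x" b v] assms unfolding nsimplex_def by metis
qed

lemma bary_hull:
  assumes "nsimplex s n" "x \<in> convex hull s"
  shows "sum (bary s x) s = 1" "(\<Sum>v\<in>s. bary s x v *\<^sub>R v) = x" "v \<in> s \<Longrightarrow> 0 \<le> bary s x v"
proof -
  obtain b where b: "\<forall>v\<in>s. 0 \<le> b v" "sum b s = 1" "(\<Sum>v\<in>s. b v *\<^sub>R v) = x"
    using assms convex_hull_finite[of s] by (auto simp: nsimplex_def)
  have eq: "bary s x v = b v" if "v \<in> s" for v using baryI[OF assms(1) b(2,3) that] .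
  show "sum (bary s x) s = 1" "(\<Sum>v\<in>s. bary s x v *\<^sub>R v) = x" using b eq by auto
  show "v \<in> s \<Longrightarrow> 0 \<le> bary s x v" using b eq by auto
qed

text \<open>For points of the hull this is twice the total variation distance of two probability
  vectors, hence the bound 2.\<close>

definition bdist :: "'a::euclidean_space set \<Rightarrow> 'a \<Rightarrow> 'a \<Rightarrow> real" where
  "bdist s x y = (\<Sum>v\<in>s. \<bar>bary s x v - bary s y v\<bar>)"

lemma bdist_le_2:
  assumes "nsimplex s n" "x \<in> convex hull s" "y \<in> convex hull s"
  shows "bdist s x y \<le> 2"
proof -
  have "bdist s x y \<le> (\<Sum>v\<in>s. bary s x v + bary s y v)"
    unfolding bdist_def using bary_hull(3)[OF assms(1,2)] bary_hull(3)[OF assms(1,3)]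
    by (intro sum_mono) (fastforce simp: abs_le_iff)
  also have "\<dots> = 2"
    using bary_hull(1)[OF assms(1,2)] bary_hull(1)[OF assms(1,3)] by (simp add: sum.distrib)
  finally show ?thesis .
qed

lemma dist_le_bdist:
  assumes s: "nsimplex s n" and x: "x \<in> convex hull s" "y \<in> convex hull s"
  shows "dist x y \<le> (\<Sum>v\<in>s. norm v) * bdist s x y"
proof -
  have fin: "finite s" using s by (simp add: nsimplex_def)
  have "x - y = (\<Sum>v\<in>s. (bary s x v - bary s y v) *\<^sub>R v)"
    using bary_hull(2)[OF s x(1)] bary_hull(2)[OF s x(2)] by (simp add: scaleR_diff_left sum_subtractf)
  then have "dist x y \<le> (\<Sum>v\<in>s. \<bar>bary s x v - bary s y v\<bar> * norm v)"
    by (simp add: dist_norm sum_norm_le)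
  also have "\<dots> \<le> (\<Sum>v\<in>s. \<bar>bary s x v - bary s y v\<bar> * (\<Sum>v\<in>s. norm v))"
    using fin by (intro sum_mono mult_left_mono member_le_sum) auto
  finally show ?thesis by (simp add: bdist_def sum_distrib_right[symmetric] mult.commute[of "sum norm s"])
qed

text \<open>Dobrushin's argument: a vector of total mass zero is a combination of differences of unit vectors.\<close>
lemma dobrushin_contraction:
  fixes M :: "'w \<Rightarrow> 'v \<Rightarrow> real"
  assumes fin: "finite A" "finite V"
    and M0: "\<And>w v. w \<in> A \<Longrightarrow> v \<in> V \<Longrightarrow> 0 \<le> M w v" and M1: "\<And>w. w \<in> A \<Longrightarrow> sum (M w) V = 1"
    and ov: "\<And>w w'. w \<in> A \<Longrightarrow> w' \<in> A \<Longrightarrow> \<exists>v\<in>V. 0 < M w v \<and> 0 < M w' v"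
  obtains \<tau> where "0 \<le> \<tau>" "\<tau> < 1"
    "\<And>r. sum r A = 0 \<Longrightarrow> (\<Sum>v\<in>V. \<bar>\<Sum>w\<in>A. r w * M w v\<bar>) \<le> \<tau> * (\<Sum>w\<in>A. \<bar>r w\<bar>)"
proof -
  \<comment> \<open>Total variation distance of two rows. Overlapping rows have it below 1, and
    finiteness gives a uniform bound; inserting 0 into the maximum covers an empty
    \<open>A\<close>.\<close>
  define \<delta> where "\<delta> w w' = (\<Sum>v\<in>V. \<bar>M w v - M w' v\<bar>) / 2" for w w'
  define \<tau> where "\<tau> = Max (insert 0 (case_prod \<delta> ` (A \<times> A)))"
  have finT: "finite (insert 0 (case_prod \<delta> ` (A \<times> A)))" using fin by auto
  have \<delta>1: "\<delta> w w' < 1" if w: "w \<in> A" "w' \<in> A" for w w'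
  proof -
    have "(\<Sum>v\<in>V. \<bar>M w v - M w' v\<bar>) < (\<Sum>v\<in>V. M w v + M w' v)"
    proof (rule sum_strict_mono_ex1[OF fin(2)])
      show "\<forall>v\<in>V. \<bar>M w v - M w' v\<bar> \<le> M w v + M w' v" using M0 w by (fastforce simp: abs_le_iff)
      show "\<exists>v\<in>V. \<bar>M w v - M w' v\<bar> < M w v + M w' v" using ov[OF w] by (auto intro!: bexI)
    qed
    then show ?thesis unfolding \<delta>_def using M1 w by (simp add: sum.distrib)
  qed
  have \<tau>0: "0 \<le> \<tau>" unfolding \<tau>_def using finT by (intro Max_ge) auto
  have \<tau>1: "\<tau> < 1" unfolding \<tau>_def using finT \<delta>1 by (subst Max_less_iff) auto
  have \<delta>\<tau>: "\<delta> w w' \<le> \<tau>" if "w \<in> A" "w' \<in> A" for w w'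
    unfolding \<tau>_def using finT that by (intro Max_ge) auto
  have "(\<Sum>v\<in>V. \<bar>\<Sum>w\<in>A. r w * M w v\<bar>) \<le> \<tau> * (\<Sum>w\<in>A. \<bar>r w\<bar>)" if r: "sum r A = 0" for r
  proof -
    \<comment> \<open>The positive and negative parts have the same mass \<open>h\<close>. The
      product weights \<open>p w * q w'\<close> pair them off, each pair contributing a difference
      of two rows.\<close>
    define p where "p w = max (r w) 0" for w
    define q where "q w = max (- r w) 0" for w
    have r_eq: "r w = p w - q w" "\<bar>r w\<bar> = p w + q w" and pq: "0 \<le> p w" "0 \<le> q w" for w
      by (auto simp: p_def q_def)
    define h where "h = sum p A"
    have h0: "0 \<le> h" unfolding h_def by (intro sum_nonneg pq)
    have hq: "sum q A = h" using r by (simp add: r_eq(1) sum_subtractf h_def)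
    have abs_sum: "(\<Sum>w\<in>A. \<bar>r w\<bar>) = 2 * h" by (simp add: r_eq(2) sum.distrib hq h_def)
    show ?thesis
    proof (cases "h = 0")
      case True
      then have "\<forall>w\<in>A. r w = 0"
        using abs_sum fin by (simp add: sum_nonneg_eq_0_iff)
      then show ?thesis by simp
    next
      case False
      then have hpos: "0 < h" using h0 by simp
      have eq: "h * (\<Sum>w\<in>A. r w * M w v) = (\<Sum>w\<in>A. \<Sum>w'\<in>A. p w * q w' * (M w v - M w' v))" for v
      proof -
        have "(\<Sum>w\<in>A. \<Sum>w'\<in>A. p w * q w' * (M w v - M w' v))
          = (\<Sum>w\<in>A. \<Sum>w'\<in>A. p w * M w v * q w') - (\<Sum>w\<in>A. \<Sum>w'\<in>A. p w * (q w' * M w' v))"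
          by (simp add: sum_subtractf[symmetric] algebra_simps)
        also have "\<dots> = (\<Sum>w\<in>A. p w * M w v) * h - h * (\<Sum>w\<in>A. q w * M w v)"
          by (simp add: sum_distrib_left[symmetric] sum_distrib_right[symmetric] hq h_def)
        also have "\<dots> = h * (\<Sum>w\<in>A. r w * M w v)"
          by (simp add: r_eq(1) left_diff_distrib sum_subtractf algebra_simps)
        finally show ?thesis by simp
      qed
      have "h * (\<Sum>v\<in>V. \<bar>\<Sum>w\<in>A. r w * M w v\<bar>) = (\<Sum>v\<in>V. \<bar>h * (\<Sum>w\<in>A. r w * M w v)\<bar>)"
        using h0 by (simp add: sum_distrib_left[symmetric] abs_mult)
      also have "\<dots> \<le> (\<Sum>v\<in>V. \<Sum>w\<in>A. \<Sum>w'\<in>A. p w * q w' * \<bar>M w v - M w' v\<bar>)"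
        unfolding eq
      proof (rule sum_mono)
        fix v
        have "\<bar>\<Sum>w\<in>A. \<Sum>w'\<in>A. p w * q w' * (M w v - M w' v)\<bar>
            \<le> (\<Sum>w\<in>A. \<bar>\<Sum>w'\<in>A. p w * q w' * (M w v - M w' v)\<bar>)" by (rule sum_abs)
        also have "\<dots> \<le> (\<Sum>w\<in>A. \<Sum>w'\<in>A. \<bar>p w * q w' * (M w v - M w' v)\<bar>)"
          by (rule sum_mono, rule sum_abs)
        finally show "\<bar>\<Sum>w\<in>A. \<Sum>w'\<in>A. p w * q w' * (M w v - M w' v)\<bar>
            \<le> (\<Sum>w\<in>A. \<Sum>w'\<in>A. p w * q w' * \<bar>M w v - M w' v\<bar>)" by (simp add: abs_mult pq)
      qed
      also have "\<dots> = (\<Sum>w\<in>A. \<Sum>w'\<in>A. \<Sum>v\<in>V. p w * q w' * \<bar>M w v - M w' v\<bar>)"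
        by (subst sum.swap, rule sum.cong[OF refl], rule sum.swap)
      also have "\<dots> = (\<Sum>w\<in>A. \<Sum>w'\<in>A. p w * q w' * (2 * \<delta> w w'))"
        by (simp add: \<delta>_def sum_distrib_left[symmetric])
      also have "\<dots> \<le> (\<Sum>w\<in>A. \<Sum>w'\<in>A. p w * q w' * (2 * \<tau>))"
        by (intro sum_mono mult_left_mono) (auto simp: pq \<delta>\<tau>)
      also have "\<dots> = h * (\<tau> * (2 * h))"
        by (simp add: sum_distrib_left[symmetric] sum_distrib_right[symmetric] hq h_def)
      finally show ?thesis using hpos by (simp add: abs_sum)
    qed
  qed
  with \<tau>0 \<tau>1 that show thesis by blast
qed

section \<open>The \<open>d\<close>-simplices of a complex and of its subdivision\<close>

lemma complexD:
  assumes "complex K"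
  shows "finite K"
    "s \<in> K \<Longrightarrow> finite s" "s \<in> K \<Longrightarrow> \<not> affine_dependent s"
    "s \<in> K \<Longrightarrow> t \<subseteq> s \<Longrightarrow> t \<noteq> {} \<Longrightarrow> t \<in> K"
    "s \<in> K \<Longrightarrow> t \<in> K \<Longrightarrow> convex hull s \<inter> convex hull t = convex hull (s \<inter> t)"
  using assms unfolding complex_def simplex_set_def by blast+

lemma proper_subdivisionD:
  assumes "proper_subdivision Ks K"
  shows "complex Ks" "complex K" "polyhedron Ks = polyhedron K"
    "s \<in> Ks \<Longrightarrow> \<exists>t\<in>K. convex hull s \<subseteq> convex hull t"
    "t \<in> K \<Longrightarrow> \<exists>S\<subseteq>Ks. convex hull t = (\<Union>s\<in>S. convex hull s)"
  using assms unfolding proper_subdivision_def by blast+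

locale simplicial_system =
  fixes K Ks :: "'a::euclidean_space set set" and \<gamma> :: "'a \<Rightarrow> 'a" and d :: nat
  assumes sub: "proper_subdivision Ks K" and simp_map: "simplicial_map Ks K \<gamma>"
    and nondeg: "nondegenerate Ks \<gamma>" and dim: "everywhere_dim K d"
begin

abbreviation "D \<equiv> dsimp K d"
abbreviation "E \<equiv> dsimp Ks d"
abbreviation "J \<equiv> Jmap K d"
abbreviation "g \<equiv> plmap Ks \<gamma>"
abbreviation "X \<equiv> polyhedron K"
abbreviation "P s F \<equiv> measure (lam s) F"

lemma complexes: "complex K" "complex Ks"
  using proper_subdivisionD[OF sub] by blast+

lemma finite_D [simp]: "finite D" and finite_E [simp]: "finite E"
  using complexes[THEN complexD(1)] by (simp_all add: dsimp_def)

lemma D_K: "s \<in> D \<Longrightarrow> s \<in> K" and E_Ks: "a \<in> E \<Longrightarrow> a \<in> Ks"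
  by (auto simp: dsimp_def)

lemma nsimplex_D: "s \<in> D \<Longrightarrow> nsimplex s d" and nsimplex_E: "a \<in> E \<Longrightarrow> nsimplex a d"
  using complexD(2,3)[OF complexes(1)] complexD(2,3)[OF complexes(2)] by (auto simp: dsimp_def nsimplex_def)

lemma finite_vertices: "s \<in> D \<Longrightarrow> finite s" "a \<in> E \<Longrightarrow> finite a"
  using nsimplex_D nsimplex_E by (auto simp: nsimplex_def)

lemma extend_D: "t \<in> K \<Longrightarrow> \<exists>s\<in>D. t \<subseteq> s"
  using dim unfolding everywhere_dim_def dsimp_def by blast

lemma card_inter_le:
  assumes "nsimplex s d" "nsimplex t d" "s \<noteq> t" shows "card (s \<inter> t) \<le> d"
proof -
  have "s \<inter> t \<subset> s" using assms by (metis card_subset_eq inf.absorb_iff2 inf_le1 inf_le2 nsimplex_def psubsetI)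
  then show ?thesis using assms psubset_card_mono[of s "s \<inter> t"] by (simp add: nsimplex_def)
qed

lemma hull_borel [measurable, simp]: "s \<in> D \<Longrightarrow> convex hull s \<in> sets borel" "a \<in> E \<Longrightarrow> convex hull a \<in> sets borel"
  using finite_vertices by auto

lemma hull_compact [simp]: "s \<in> D \<Longrightarrow> compact (convex hull s)" "a \<in> E \<Longrightarrow> compact (convex hull a)"
  using finite_vertices by (auto intro: finite_imp_compact_convex_hull)

lemma P_mono: "A \<subseteq> B \<Longrightarrow> B \<in> sets borel \<Longrightarrow> P s A \<le> P s B"
  by (intro finite_measure.finite_measure_mono[OF finite_measure_lam]) auto

lemma P_UNIV: "s \<in> D \<Longrightarrow> P s UNIV = 1" and P_hull: "s \<in> D \<Longrightarrow> P s (convex hull s) = 1"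
  by (simp_all add: measure_lam_hull[OF nsimplex_D])

lemma P_inter_hull: "s \<in> D \<Longrightarrow> F \<in> sets borel \<Longrightarrow> P s (convex hull s \<inter> F) = P s F"
  using measure_lam_restrict(1)[OF nsimplex_D nsimplex_D, of s s F] by (simp add: P_hull)

lemma P_distinct:
  assumes "s \<in> D" "t \<in> D" "s \<noteq> t" shows "P s (convex hull t) = 0"
proof -
  have "P s (convex hull t) = P s (convex hull s \<inter> convex hull t)"
    using assms by (simp add: P_inter_hull)
  also have "convex hull s \<inter> convex hull t = convex hull (s \<inter> t)"
    using complexD(5)[OF complexes(1)] assms by (simp add: D_K)
  also have "P s \<dots> = 0"
    using assms card_inter_le[of s t] by (intro measure_lam_null) (simp_all add: nsimplex_D finite_vertices)
  finally show ?thesis .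
qed

lemma E_overlap_null:
  assumes "s \<in> D" "a \<in> E" "b \<in> E" "a \<noteq> b" shows "P s (convex hull a \<inter> convex hull b) = 0"
proof -
  have "convex hull a \<inter> convex hull b = convex hull (a \<inter> b)"
    using complexD(5)[OF complexes(2)] assms by (simp add: E_Ks)
  also have "P s \<dots> = 0"
    using assms card_inter_le[of a b] by (intro measure_lam_null) (simp_all add: nsimplex_D nsimplex_E finite_vertices)
  finally show ?thesis .
qed

text \<open>Two simplices of \<open>D\<close> overlap in a null set, which cannot carry the positive
  mass of \<open>a\<close>. This justifies the definite description in \<open>Jmap\<close>.\<close>

lemma J_unique:
  assumes a: "a \<in> E" and s: "s \<in> D" "convex hull a \<subseteq> convex hull s"
    and t: "t \<in> D" "convex hull a \<subseteq> convex hull t"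
  shows "s = t"
proof (rule ccontr)
  assume "s \<noteq> t"
  have "0 < P s (convex hull a)"
    by (rule measure_lam_restrict(2)[OF nsimplex_D nsimplex_E, of s a UNIV]) (use a s in auto)
  also have "\<dots> \<le> P s (convex hull t)" using t by (intro P_mono) auto
  also have "\<dots> = 0" using P_distinct s t \<open>s \<noteq> t\<close> by simp
  finally show False by simp
qed

lemma J_eqI: "a \<in> E \<Longrightarrow> s \<in> D \<Longrightarrow> convex hull a \<subseteq> convex hull s \<Longrightarrow> J a = s"
  unfolding Jmap_def using J_unique by (intro the_equality) metis+

lemma J_D: assumes "a \<in> E" shows "J a \<in> D" "convex hull a \<subseteq> convex hull (J a)"
proof -
  obtain t where t: "t \<in> K" "convex hull a \<subseteq> convex hull t"
    using proper_subdivisionD(4)[OF sub E_Ks[OF assms]] by blast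
  obtain s where s: "s \<in> D" "t \<subseteq> s" using extend_D[OF t(1)] by blast
  have "convex hull a \<subseteq> convex hull s" using t(2) hull_mono[OF s(2), of convex] by blast
  then show "J a \<in> D" "convex hull a \<subseteq> convex hull (J a)" using J_eqI[OF assms s(1)] s by auto
qed

lemma P_E:
  assumes "a \<in> E" "F \<in> sets borel"
  shows "P (J a) (convex hull a \<inter> F) = nu K d a * P a F" "0 < nu K d a"
  unfolding nu_def
  using measure_lam_restrict[OF nsimplex_D nsimplex_E, of "J a" a F] J_D assms by auto

text \<open>The edges of \<open>Grel\<close> leaving \<open>s\<close>, counted with multiplicity:
  several sons may have the same image.\<close>

definition sons :: "'a set \<Rightarrow> 'a set set" where
  "sons s = {a \<in> E. J a = s}"

lemma finite_sons [simp]: "finite (sons s)" by (simp add: sons_def)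

lemma sons_E: "a \<in> sons s \<Longrightarrow> a \<in> E" and sons_J: "a \<in> sons s \<Longrightarrow> J a = s"
  by (auto simp: sons_def)

text \<open>The simplices of lower dimension are null, so the others fill a dense closed subset.\<close>
lemma hull_sons:
  assumes s: "s \<in> D" shows "convex hull s = (\<Union>a\<in>sons s. convex hull a)"
proof
  let ?F = "\<Union>a\<in>sons s. convex hull a"
  show "?F \<subseteq> convex hull s" using J_D sons_E sons_J by blast
  show "convex hull s \<subseteq> ?F"
  proof (rule ccontr)
    assume "\<not> convex hull s \<subseteq> ?F"
    then obtain x where x: "x \<in> convex hull s" "x \<in> - ?F" by auto
    have cl: "closed ?F"
      by (intro closed_UN) (auto simp: sons_def compact_imp_closed)
    have pos: "0 < P s (- ?F)"
      by (rule measure_lam_open_pos[OF nsimplex_D[OF s] open_Compl[OF cl] x(2,1)])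
    have sK: "s \<in> K" by (rule D_K[OF s])
    obtain S where S: "S \<subseteq> Ks" "convex hull s = (\<Union>a\<in>S. convex hull a)"
      using proper_subdivisionD(5)[OF sub sK] by (elim exE conjE)
    define T where "T = {a \<in> S. card a \<le> d}"
    have finT: "finite T" "\<And>a. a \<in> T \<Longrightarrow> finite a"
    proof -
      have "T \<subseteq> Ks" using S(1) by (auto simp: T_def)
      then show "finite T" "\<And>a. a \<in> T \<Longrightarrow> finite a"
        using finite_subset complexD(1,2)[OF complexes(2)] by blast+
    qed
    have "convex hull s \<inter> - ?F \<subseteq> (\<Union>a\<in>T. convex hull a)"
    proof
      fix z assume z: "z \<in> convex hull s \<inter> - ?F"
      then obtain a where a: "a \<in> S" "z \<in> convex hull a" using S by auto
      have aK: "a \<in> Ks" and as: "convex hull a \<subseteq> convex hull s" using a S by auto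
      \<comment> \<open>The dimension of \<open>s\<close> bounds the number of vertices of a simplex
        inside its hull by \<open>Suc d\<close>.\<close>
      have "aff_dim (convex hull a) \<le> aff_dim (convex hull s)" by (rule aff_dim_subset[OF as])
      then have "card a \<le> Suc d"
        using nsimplex_D[OF s] complexD(2,3)[OF complexes(2) aK]
        using aff_dim_affine_independent[of a] aff_dim_affine_independent[of s]
        by (simp add: aff_dim_convex_hull nsimplex_def)
      moreover have "card a \<noteq> Suc d"
      proof
        assume "card a = Suc d"
        then have "a \<in> sons s" using aK J_eqI[of a s] s as by (auto simp: sons_def dsimp_def)
        then show False using z a by auto
      qed
      ultimately show "z \<in> (\<Union>a\<in>T. convex hull a)" using a by (auto simp: T_def)
    qed
    then have "P s (convex hull s \<inter> - ?F) \<le> P s (\<Union>a\<in>T. convex hull a)"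
      using finT by (intro P_mono) auto
    also have "\<dots> \<le> (\<Sum>a\<in>T. P s (convex hull a))"
      using finT by (intro measure_UNION_le) auto
    also have "\<dots> = 0"
    proof (intro sum.neutral ballI measure_lam_null[OF nsimplex_D[OF s]] finT(2))
      show "card a \<le> d" if "a \<in> T" for a using that unfolding T_def by blast
    qed
    finally have "P s (convex hull s \<inter> - ?F) \<le> 0" .
    then show False using pos P_inter_hull[OF s borel_open[OF open_Compl[OF cl]]] by simp
  qed
qed

section \<open>The polyhedron and its piecewise linear map\<close>

lemma X_D: "X = (\<Union>s\<in>D. convex hull s)"
proof
  show "X \<subseteq> (\<Union>s\<in>D. convex hull s)"
  proof
    fix x assume "x \<in> X"
    then obtain t where t: "t \<in> K" "x \<in> convex hull t" by (auto simp: polyhedron_def)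
    then obtain s where s: "s \<in> D" "t \<subseteq> s" using extend_D[OF t(1)] by blast
    show "x \<in> (\<Union>s\<in>D. convex hull s)" using t s hull_mono[OF s(2), of convex] by blast
  qed
qed (auto simp: polyhedron_def dest: D_K)

lemma X_E: "X = (\<Union>a\<in>E. convex hull a)"
  unfolding X_D using hull_sons J_D by (fastforce simp: sons_def)

lemma hull_sub_X: "s \<in> D \<Longrightarrow> convex hull s \<subseteq> X"
  by (auto simp: X_D)

lemma compact_X: "compact X"
  unfolding X_D by (intro compact_UN) auto

lemma X_borel [measurable]: "X \<in> sets borel"
  using compact_X by (rule borel_compact)

text \<open>\<open>plmap\<close> picks some representation of the point in some simplex. All of them
  give one value because the point lies in the hull of the common face \<open>s \<inter> a\<close>,
  whose weights, padded by zeros, are its coordinates in either simplex.\<close>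

lemma g_bary:
  assumes a: "a \<in> Ks" and b: "\<forall>v\<in>a. 0 \<le> b v" "sum b a = 1"
  shows "g (\<Sum>v\<in>a. b v *\<^sub>R v) = (\<Sum>v\<in>a. b v *\<^sub>R \<gamma> v)"
proof -
  let ?x = "\<Sum>v\<in>a. b v *\<^sub>R v"
  have fa: "finite c" "\<not> affine_dependent c" if "c \<in> Ks" for c
    using complexD(2,3)[OF complexes(2) that] by auto
  have xa: "?x \<in> convex hull a" using b fa[OF a] by (auto simp: convex_hull_finite)
  have xX: "?x \<in> polyhedron Ks" using xa a by (auto simp: polyhedron_def)
  have "g ?x = (SOME y. \<exists>s\<in>Ks. \<exists>c. (\<forall>v\<in>s. 0 \<le> c v) \<and> sum c s = 1 \<and> (\<Sum>v\<in>s. c v *\<^sub>R v) = ?x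
                      \<and> y = (\<Sum>v\<in>s. c v *\<^sub>R \<gamma> v))"
    using xX by (simp add: plmap_def)
  also have "\<dots> = (\<Sum>v\<in>a. b v *\<^sub>R \<gamma> v)"
  proof (rule some_equality)
    show "\<exists>s\<in>Ks. \<exists>c. (\<forall>v\<in>s. 0 \<le> c v) \<and> sum c s = 1 \<and> (\<Sum>v\<in>s. c v *\<^sub>R v) = ?x
                      \<and> (\<Sum>v\<in>a. b v *\<^sub>R \<gamma> v) = (\<Sum>v\<in>s. c v *\<^sub>R \<gamma> v)"
      using a b by blast
  next
    fix y assume "\<exists>s\<in>Ks. \<exists>c. (\<forall>v\<in>s. 0 \<le> c v) \<and> sum c s = 1 \<and> (\<Sum>v\<in>s. c v *\<^sub>R v) = ?x
                      \<and> y = (\<Sum>v\<in>s. c v *\<^sub>R \<gamma> v)"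
    then obtain s c where s: "s \<in> Ks" and c: "\<forall>v\<in>s. 0 \<le> c v" "sum c s = 1" "(\<Sum>v\<in>s. c v *\<^sub>R v) = ?x"
      and y: "y = (\<Sum>v\<in>s. c v *\<^sub>R \<gamma> v)" by blast
    have "?x \<in> convex hull s" using c fa[OF s] by (auto simp: convex_hull_finite)
    then have "?x \<in> convex hull (s \<inter> a)"
      using xa complexD(5)[OF complexes(2) s a] by blast
    then obtain u where u: "sum u (s \<inter> a) = 1" "(\<Sum>v\<in>s \<inter> a. u v *\<^sub>R v) = ?x"
      using fa[OF s] by (auto simp: convex_hull_finite)
    have key: "(\<Sum>v\<in>t. e v *\<^sub>R \<gamma> v) = (\<Sum>v\<in>s \<inter> a. u v *\<^sub>R \<gamma> v)"
      if t: "t \<in> Ks" "s \<inter> a \<subseteq> t" and e: "sum e t = 1" "(\<Sum>v\<in>t. e v *\<^sub>R v) = ?x" for t e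
    proof -
      let ?u = "\<lambda>v. if v \<in> s \<inter> a then u v else 0"
      have ext: "(\<Sum>v\<in>t. if v \<in> s \<inter> a then f v else 0) = sum f (s \<inter> a)" for f :: "'a \<Rightarrow> 'b::comm_monoid_add"
        using sum.inter_restrict[OF fa(1)[OF t(1)], of f "s \<inter> a"] t(2) by (simp add: inf.absorb2)
      have ext': "(\<Sum>v\<in>t. ?u v *\<^sub>R f v) = (\<Sum>v\<in>s \<inter> a. u v *\<^sub>R f v)" for f :: "'a \<Rightarrow> 'a"
        unfolding ext[symmetric] by (rule sum.cong) simp_all
      have "e v = ?u v" if "v \<in> t" for v
        by (rule bary_unique[OF fa[OF t(1)] _ _ that]) (simp_all only: e u ext ext')
      then have "(\<Sum>v\<in>t. e v *\<^sub>R \<gamma> v) = (\<Sum>v\<in>t. ?u v *\<^sub>R \<gamma> v)" by (intro sum.cong) auto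
      then show ?thesis unfolding ext' .
    qed
    show "y = (\<Sum>v\<in>a. b v *\<^sub>R \<gamma> v)"
      unfolding y using key[OF s _ c(2,3)] key[OF a _ b(2) refl] by simp
  qed
  finally show ?thesis .
qed

lemma image_D: "a \<in> E \<Longrightarrow> \<gamma> ` a \<in> D"
  using simp_map nondeg by (auto simp: simplicial_map_def nondegenerate_def dsimp_def)

lemma inj_E: "a \<in> E \<Longrightarrow> inj_on \<gamma> a"
  using nondeg E_Ks[of a] finite_vertices(2)[of a] unfolding nondegenerate_def by (intro eq_card_imp_inj_on) auto

lemma g_E:
  assumes "a \<in> E" "x \<in> convex hull a" shows "g x = (\<Sum>v\<in>a. bary a x v *\<^sub>R \<gamma> v)"
  using g_bary[of a "bary a x"] bary_hull[OF nsimplex_E[OF assms(1)] assms(2)] assms(1)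
  by (simp add: dsimp_def)

lemma g_image_E:
  assumes a: "a \<in> E" shows "g ` (convex hull a) = convex hull (\<gamma> ` a)"
proof (intro equalityI subsetI)
  note [simp] = finite_vertices(2)[OF a]
  fix z assume "z \<in> g ` (convex hull a)"
  then obtain x where x: "x \<in> convex hull a" "z = g x" by auto
  note b = bary_hull[OF nsimplex_E[OF a] x(1)]
  show "z \<in> convex hull (\<gamma> ` a)"
    unfolding x(2) g_E[OF a x(1)] using a b
    by (intro convex_sum) (auto simp: convex_convex_hull hull_inc)
next
  note [simp] = finite_vertices(2)[OF a]
  fix z assume "z \<in> convex hull (\<gamma> ` a)"
  then obtain u where u: "\<forall>v\<in>\<gamma> ` a. 0 \<le> u v" "sum u (\<gamma> ` a) = 1" "(\<Sum>v\<in>\<gamma> ` a. u v *\<^sub>R v) = z"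
    using a by (auto simp: convex_hull_finite)
  let ?x = "\<Sum>v\<in>a. u (\<gamma> v) *\<^sub>R v"
  have s: "sum (u \<circ> \<gamma>) a = 1" using u(2) by (simp add: sum.reindex[OF inj_E[OF a]])
  then have "g ?x = z"
    using g_bary[of a "u \<circ> \<gamma>"] a u by (simp add: dsimp_def sum.reindex[OF inj_E[OF a]])
  moreover have "?x \<in> convex hull a"
    using s u a by (auto simp: convex_hull_finite intro!: exI[of _ "u \<circ> \<gamma>"])
  ultimately show "z \<in> g ` (convex hull a)" by auto
qed

lemma continuous_on_g: "continuous_on X g"
  unfolding X_E
proof (rule continuous_on_closed_Union)
  fix a assume a: "a \<in> E"
  show "closed (convex hull a)" using a by (simp add: compact_imp_closed)
  obtain f where f: "bij_betw f {..d} a" using nsimplex_param[OF nsimplex_E[OF a]] .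
  obtain c where c: "\<And>i. i < d \<Longrightarrow> linear (c i)"
      "\<And>i j. i < d \<Longrightarrow> j < d \<Longrightarrow> c i (f j - f d) = (if i = j then 1 else 0::real)"
    using frame_simplex[OF nsimplex_E[OF a] f] unfolding frame_def by auto
  \<comment> \<open>The affine map prescribed by \<open>\<gamma>\<close> on the vertices, written on
    the whole space through the dual functionals of the edges so that its continuity is
    evident.\<close>
  let ?G = "\<lambda>x. \<gamma> (f d) + (\<Sum>i<d. c i (x - f d) *\<^sub>R (\<gamma> (f i) - \<gamma> (f d)))"
  have "g x = ?G x" if "x \<in> convex hull a" for x
  proof -
    have "x \<in> aff_param f d ` std_simplex d" using that unfolding convex_hull_param[OF f] .
    then obtain y where y: "y \<in> std_simplex d" "x = aff_param f d y" by auto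
    have cy: "c i (x - f d) = y i" if "i < d" for i
      using frame_coord[of i d c "\<lambda>i. f i - f d" y] c that by (simp add: y(2) aff_param_lincomb)
    obtain b where b: "\<And>v. v \<in> a \<Longrightarrow> 0 \<le> b v" "sum b a = 1"
      "\<And>h :: 'a \<Rightarrow> 'a. (\<Sum>v\<in>a. b v *\<^sub>R h v) = aff_param (h \<circ> f) d y"
      using std_simplex_weights[OF f y(1)] by metis
    have "g x = aff_param (\<gamma> \<circ> f) d y"
      using g_bary[OF E_Ks[OF a], of b] b(1,2) b(3)[of \<gamma>] b(3)[of "\<lambda>x. x"] y(2) by (simp add: comp_def)
    also have "\<dots> = ?G x" by (simp add: aff_param_def cy)
    finally show ?thesis .
  qed
  moreover have "continuous_on (convex hull a) ?G"
  proof (intro continuous_intros)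
    fix i assume "i \<in> {..<d}"
    then have "linear (c i)" using c by auto
    then have "continuous_on UNIV (c i)" by (rule linear_continuous_on[OF linear_conv_bounded_linear[THEN iffD1]])
    then show "continuous_on (convex hull a) (\<lambda>x. c i (x - f d))"
      by (rule continuous_on_compose2[of UNIV]) (auto intro: continuous_intros)
  qed
  ultimately show "continuous_on (convex hull a) g" by (simp cong: continuous_on_cong)
qed simp

lemma g_outside: "x \<notin> X \<Longrightarrow> g x = x"
  using proper_subdivisionD(3)[OF sub] by (simp add: plmap_def)

lemma g_borel [measurable]: "g \<in> borel_measurable borel"
proof -
  have "(\<lambda>x. if x \<in> X then g x else x) \<in> borel_measurable borel"
    by (intro borel_measurable_continuous_on_if X_borel continuous_on_g continuous_on_id)
  also have "(\<lambda>x. if x \<in> X then g x else x) = g" using g_outside by auto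
  finally show ?thesis .
qed

lemma g_vimage_borel [measurable]: "F \<in> sets borel \<Longrightarrow> g -` F \<in> sets borel"
  using measurable_sets_borel[OF g_borel] .

lemma g_X: "x \<in> X \<Longrightarrow> g x \<in> X"
  using g_image_E image_D hull_sub_X unfolding X_E by blast

section \<open>One-step transition law of the normalized measures\<close>

lemma P_push:
  assumes a: "a \<in> sons s" and F: "F \<in> sets borel"
  shows "P s (convex hull a \<inter> g -` F) = nu K d a * P (\<gamma> ` a) F"
proof -
  have aE: "a \<in> E" using a by (rule sons_E)
  \<comment> \<open>Given that a point lies in \<open>a\<close>, its image is distributed by the
    normalized measure of the image simplex; this is the Markov property.\<close>
  have "P a (g -` F) = P (\<gamma> ` a) F"
    using aE by (intro measure_lam_push[OF nsimplex_E nsimplex_D[OF image_D]] g_bary F)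
      (auto simp: E_Ks)
  then show ?thesis using P_E(1)[OF aE g_vimage_borel[OF F]] sons_J[OF a] by simp
qed

text \<open>Sons overlap in null faces, so almost everywhere disjointness has to stand in for
  disjointness.\<close>

lemma P_sum:
  assumes s: "s \<in> D" and F: "\<And>a. a \<in> sons s \<Longrightarrow> F a \<in> sets borel"
  shows "P s (\<Union>a\<in>sons s. convex hull a \<inter> F a) = (\<Sum>a\<in>sons s. P s (convex hull a \<inter> F a))"
proof (rule measure_UNION_AE)
  fix a assume a: "a \<in> sons s"
  have "convex hull a \<inter> F a \<in> sets borel" using sons_E[OF a] F[OF a] by auto
  then show "convex hull a \<inter> F a \<in> fmeasurable (lam s)"
    using finite_measure.emeasure_finite[OF finite_measure_lam] by (simp add: fmeasurable_def less_top)
next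
  show "pairwise (\<lambda>i j. AE x in lam s. x \<notin> convex hull i \<inter> F i \<or> x \<notin> convex hull j \<inter> F j) (sons s)"
  proof (rule pairwiseI)
    fix a b assume ab: "a \<in> sons s" "b \<in> sons s" "a \<noteq> b"
    have "convex hull a \<inter> convex hull b \<in> null_sets (lam s)"
      using E_overlap_null[OF s sons_E sons_E] ab sons_E[OF ab(1)] sons_E[OF ab(2)]
      by (intro null_setsI) (auto simp: finite_measure.emeasure_eq_measure[OF finite_measure_lam])
    then show "AE x in lam s. x \<notin> convex hull a \<inter> F a \<or> x \<notin> convex hull b \<inter> F b"
      by (rule AE_I'[of "convex hull a \<inter> convex hull b"]) auto
  qed
qed simp

text \<open>The target \<open>F a\<close> may vary with the branch; the covers of
  \<open>cylinder_cover\<close> are pulled back differently along each son.\<close>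

lemma P_step:
  assumes s: "s \<in> D" and F: "\<And>a. a \<in> sons s \<Longrightarrow> F a \<in> sets borel"
  shows "P s (\<Union>a\<in>sons s. convex hull a \<inter> g -` F a) = (\<Sum>a\<in>sons s. nu K d a * P (\<gamma> ` a) (F a))"
  using P_sum[OF s, of "\<lambda>a. g -` F a"] F by (simp add: P_push)

lemma P_vimage:
  assumes s: "s \<in> D" and F: "F \<in> sets borel"
  shows "P s (g -` F) = (\<Sum>a\<in>sons s. nu K d a * P (\<gamma> ` a) F)"
proof -
  have "P s (g -` F) = P s (convex hull s \<inter> g -` F)"
    using s F by (simp add: P_inter_hull)
  also have "convex hull s \<inter> g -` F = (\<Union>a\<in>sons s. convex hull a \<inter> g -` F)"
    using hull_sons[OF s] by auto
  finally show ?thesis using P_step[OF s, of "\<lambda>_. F"] F by simp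
qed

lemma nu_pos: "a \<in> E \<Longrightarrow> 0 < nu K d a"
  by (rule P_E(2)[of a UNIV]) auto

lemma nu_sum: "s \<in> D \<Longrightarrow> (\<Sum>a\<in>sons s. nu K d a) = 1"
  using P_vimage[of s UNIV] P_UNIV image_D sons_E by (simp cong: sum.cong)

lemma sons_nonempty: "s \<in> D \<Longrightarrow> sons s \<noteq> {}"
  using nu_sum[of s] by auto

text \<open>An average with positive weights reaches an upper bound of its terms only if every term
  does. This drives both the spreading of measure 1 in a terminal class and the maximum
  principle.\<close>

lemma nu_average_max:
  assumes s: "s \<in> D" and h: "\<And>t. t \<in> D \<Longrightarrow> h t \<le> m" and avg: "m \<le> (\<Sum>a\<in>sons s. nu K d a * h (\<gamma> ` a))"
    and a: "a \<in> sons s"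
  shows "h (\<gamma> ` a) = m"
proof (rule ccontr)
  assume "h (\<gamma> ` a) \<noteq> m"
  then have lt: "h (\<gamma> ` a) < m" using h[OF image_D[OF sons_E[OF a]]] by simp
  have "(\<Sum>b\<in>sons s. nu K d b * h (\<gamma> ` b)) < (\<Sum>b\<in>sons s. nu K d b * m)"
  proof (rule sum_strict_mono_ex1)
    show "\<forall>b\<in>sons s. nu K d b * h (\<gamma> ` b) \<le> nu K d b * m"
    proof (intro ballI mult_left_mono)
      fix b assume b: "b \<in> sons s"
      show "h (\<gamma> ` b) \<le> m" by (rule h[OF image_D[OF sons_E[OF b]]])
      show "0 \<le> nu K d b" using nu_pos[OF sons_E[OF b]] by simp
    qed
    show "\<exists>b\<in>sons s. nu K d b * h (\<gamma> ` b) < nu K d b * m"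
      using a lt nu_pos[OF sons_E[OF a]] by (intro bexI[of _ a] mult_strict_left_mono) auto
  qed simp
  then show False using avg nu_sum[OF s] by (simp add: sum_distrib_right[symmetric])
qed

text \<open>Since \<open>\<gamma>\<close> relabels vertices, the distance of the images is the l1
  distance of the coordinates in \<open>a\<close>. Passing from \<open>a\<close> to
  \<open>J a\<close> multiplies the difference of coordinates, which has total mass zero, by the
  stochastic matrix \<open>?M\<close> whose rows belong to the vertices of \<open>a\<close>.\<close>

lemma sons_contraction:
  assumes a: "a \<in> E"
  shows "\<exists>\<tau>\<ge>0. \<tau> < 1 \<and> (\<forall>x\<in>convex hull a. \<forall>y\<in>convex hull a. bdist (J a) x y \<le> \<tau> * bdist (\<gamma> ` a) (g x) (g y))"
proof -
  let ?s = "J a" and ?M = "\<lambda>w. bary (J a) w"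
  have s: "?s \<in> D" "convex hull a \<subseteq> convex hull ?s" using J_D[OF a] by auto
  note ns = nsimplex_D[OF s(1)]
  note [simp] = finite_vertices(2)[OF a] finite_vertices(1)[OF s(1)]
  have ws: "w \<in> convex hull ?s" if "w \<in> a" for w using that s(2) by (auto simp: hull_inc)
  have "\<exists>v\<in>?s. 0 < ?M w v \<and> 0 < ?M w' v" if w: "w \<in> a" "w' \<in> a" for w w'
  proof (rule ccontr)
    assume no: "\<not> (\<exists>v\<in>?s. 0 < ?M w v \<and> 0 < ?M w' v)"
    \<comment> \<open>The carrier of a vertex \<open>w\<close>: the face of \<open>J a\<close> on
      which its coordinates are positive. Disjoint carriers of two vertices would be disjoint
      simplices of \<open>K\<close> both met by \<open>a\<close>, against properness.\<close>
    have carr: "\<exists>t\<in>K. t = {v\<in>?s. 0 < ?M w v} \<and> w \<in> convex hull t" if w: "w \<in> a" for w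
    proof (intro bexI conjI)
      let ?t = "{v\<in>?s. 0 < ?M w v}"
      note b = bary_hull[OF ns ws[OF w]]
      have z: "?M w v = 0" if "v \<in> ?s - ?t" for v using b(3)[of v] that by force
      have "sum (?M w) ?t = sum (?M w) ?s" by (rule sum.mono_neutral_left) (use z in auto)
      then have 1: "sum (?M w) ?t = 1" using b(1) by simp
      have "(\<Sum>v\<in>?t. ?M w v *\<^sub>R v) = (\<Sum>v\<in>?s. ?M w v *\<^sub>R v)"
        by (rule sum.mono_neutral_left) (use z in auto)
      then have 2: "(\<Sum>v\<in>?t. ?M w v *\<^sub>R v) = w" using b(2) by simp
      show "w \<in> convex hull ?t"
        using s 1 2 by (subst convex_hull_finite) (auto intro!: exI[of _ "?M w"])
      have "?t \<noteq> {}" using 1 by (intro notI) simp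
      then show "?t \<in> K" by (intro complexD(4)[OF complexes(1) D_K[OF s(1)]]) auto
    qed auto
    obtain t where t: "t \<in> K" "t = {v\<in>?s. 0 < ?M w v}" "w \<in> convex hull t" using carr[OF w(1)] by blast
    obtain t' where t': "t' \<in> K" "t' = {v\<in>?s. 0 < ?M w' v}" "w' \<in> convex hull t'" using carr[OF w(2)] by blast
    have "t \<inter> t' = {}" using no t t' by auto
    then have "convex hull t \<inter> convex hull t' = {}"
      using complexD(5)[OF complexes(1) t(1) t'(1)] by simp
    moreover have "convex hull a \<inter> convex hull t \<noteq> {}" "convex hull a \<inter> convex hull t' \<noteq> {}"
      using t(3) t'(3) hull_inc[of w a convex] hull_inc[of w' a convex] w by blast+
    ultimately show False
      using sub E_Ks[OF a] t(1) t'(1) unfolding proper_subdivision_def by blast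
  qed
  then obtain \<tau> where \<tau>: "0 \<le> \<tau>" "\<tau> < 1"
    "\<And>r. sum r a = 0 \<Longrightarrow> (\<Sum>v\<in>?s. \<bar>\<Sum>w\<in>a. r w * ?M w v\<bar>) \<le> \<tau> * (\<Sum>w\<in>a. \<bar>r w\<bar>)"
    using dobrushin_contraction[of a ?s ?M] a s bary_hull[OF ns ws] by auto
  have "bdist ?s x y \<le> \<tau> * bdist (\<gamma> ` a) (g x) (g y)" if x: "x \<in> convex hull a" "y \<in> convex hull a" for x y
  proof -
    have ba: "bary ?s x v = (\<Sum>w\<in>a. bary a x w * ?M w v)" if x: "x \<in> convex hull a" and v: "v \<in> ?s" for x v
    proof (rule baryI[OF ns _ _ v])
      note b = bary_hull[OF nsimplex_E[OF a] x]
      have "(\<Sum>v\<in>?s. \<Sum>w\<in>a. bary a x w * ?M w v) = (\<Sum>w\<in>a. bary a x w * (\<Sum>v\<in>?s. ?M w v))"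
        by (subst sum.swap) (simp add: sum_distrib_left)
      also have "\<dots> = 1" using b(1) bary_hull(1)[OF ns ws] by simp
      finally show "(\<Sum>v\<in>?s. \<Sum>w\<in>a. bary a x w * ?M w v) = 1" .
      have "(\<Sum>v\<in>?s. (\<Sum>w\<in>a. bary a x w * ?M w v) *\<^sub>R v) = (\<Sum>w\<in>a. bary a x w *\<^sub>R (\<Sum>v\<in>?s. ?M w v *\<^sub>R v))"
        unfolding scaleR_sum_left scaleR_sum_right by (subst sum.swap) simp
      also have "\<dots> = x" using b(2) bary_hull(2)[OF ns ws] by simp
      finally show "(\<Sum>v\<in>?s. (\<Sum>w\<in>a. bary a x w * ?M w v) *\<^sub>R v) = x" .
    qed
    have bg: "bary (\<gamma> ` a) (g x) (\<gamma> w) = bary a x w" if x: "x \<in> convex hull a" and w: "w \<in> a" for x w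
    proof -
      note b = bary_hull[OF nsimplex_E[OF a] x]
      let ?b = "\<lambda>z. bary a x (the_inv_into a \<gamma> z)"
      have inv: "the_inv_into a \<gamma> (\<gamma> v) = v" if "v \<in> a" for v using inj_E[OF a] that by (rule the_inv_into_f_f)
      have "bary (\<gamma> ` a) (g x) (\<gamma> w) = ?b (\<gamma> w)"
        by (rule baryI[OF nsimplex_D[OF image_D[OF a]]])
          (use w b in \<open>auto simp: sum.reindex[OF inj_E[OF a]] inv g_E[OF a x]\<close>)
      then show ?thesis using inv w by simp
    qed
    have "bdist ?s x y = (\<Sum>v\<in>?s. \<bar>\<Sum>w\<in>a. (bary a x w - bary a y w) * ?M w v\<bar>)"
      unfolding bdist_def using x by (simp add: ba left_diff_distrib sum_subtractf)
    also have "\<dots> \<le> \<tau> * (\<Sum>w\<in>a. \<bar>bary a x w - bary a y w\<bar>)"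
      using bary_hull(1)[OF nsimplex_E[OF a]] x by (intro \<tau>(3)) (simp add: sum_subtractf)
    also have "(\<Sum>w\<in>a. \<bar>bary a x w - bary a y w\<bar>) = bdist (\<gamma> ` a) (g x) (g y)"
      unfolding bdist_def sum.reindex[OF inj_E[OF a]] using x by (simp add: bg)
    finally show ?thesis .
  qed
  then show ?thesis using \<tau> by blast
qed

definition contraction_rate :: "real \<Rightarrow> bool" where
  "contraction_rate \<tau> \<longleftrightarrow> 0 \<le> \<tau> \<and> \<tau> < 1 \<and>
    (\<forall>a\<in>E. \<forall>x\<in>convex hull a. \<forall>y\<in>convex hull a. bdist (J a) x y \<le> \<tau> * bdist (\<gamma> ` a) (g x) (g y))"

lemma contraction_rateD:
  assumes "contraction_rate \<tau>"
  shows "0 \<le> \<tau>" "\<tau> < 1"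
    "a \<in> E \<Longrightarrow> x \<in> convex hull a \<Longrightarrow> y \<in> convex hull a \<Longrightarrow> bdist (J a) x y \<le> \<tau> * bdist (\<gamma> ` a) (g x) (g y)"
  using assms unfolding contraction_rate_def by auto

lemma contraction: obtains \<tau> where "contraction_rate \<tau>"
proof -
  obtain \<tau> where \<tau>: "\<And>a. a \<in> E \<Longrightarrow> 0 \<le> \<tau> a \<and> \<tau> a < 1 \<and>
      (\<forall>x\<in>convex hull a. \<forall>y\<in>convex hull a. bdist (J a) x y \<le> \<tau> a * bdist (\<gamma> ` a) (g x) (g y))"
    using sons_contraction by metis
  define t where "t = Max (insert 0 (\<tau> ` E))"
  have le: "\<tau> a \<le> t" if "a \<in> E" for a unfolding t_def using that by (intro Max_ge) auto
  show thesis
  proof (rule that, unfold contraction_rate_def, intro conjI ballI)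
    show "0 \<le> t" unfolding t_def by (intro Max_ge) auto
    show "t < 1" unfolding t_def using \<tau> by (subst Max_less_iff) auto
    fix a x y assume a: "a \<in> E" "x \<in> convex hull a" "y \<in> convex hull a"
    have "bdist (J a) x y \<le> \<tau> a * bdist (\<gamma> ` a) (g x) (g y)" using \<tau> a by blast
    also have "\<dots> \<le> t * bdist (\<gamma> ` a) (g x) (g y)"
      using le a by (intro mult_right_mono) (auto simp: bdist_def sum_nonneg)
    finally show "bdist (J a) x y \<le> t * bdist (\<gamma> ` a) (g x) (g y)" .
  qed
qed

lemma dist_bound:
  obtains C where "0 < C" "\<And>s x y. s \<in> D \<Longrightarrow> x \<in> convex hull s \<Longrightarrow> y \<in> convex hull s \<Longrightarrow> dist x y \<le> C * bdist s x y"
proof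
  define C where "C = 1 + (\<Sum>s\<in>D. \<Sum>v\<in>s. norm v)"
  show "0 < C" unfolding C_def by (intro add_pos_nonneg sum_nonneg) auto
  fix s x y assume s: "s \<in> D" and x: "x \<in> convex hull s" "y \<in> convex hull s"
  have "(\<Sum>v\<in>s. norm v) \<le> C"
    unfolding C_def using member_le_sum[of s D "\<lambda>s. \<Sum>v\<in>s. norm v"] s by (simp add: sum_nonneg)
  then have "(\<Sum>v\<in>s. norm v) * bdist s x y \<le> C * bdist s x y"
    by (intro mult_right_mono) (auto simp: bdist_def sum_nonneg)
  then show "dist x y \<le> C * bdist s x y"
    using dist_le_bdist[OF nsimplex_D[OF s] x] by simp
qed

end

section \<open>Chains, terminal classes and the zero-one law\<close>

text \<open>The length is explicit so that chains can be concatenated and counted;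
  \<open>chain_rel_map\<close> must know that its chain has two steps.\<close>

definition chain_steps :: "('a::metric_space \<Rightarrow> 'a) \<Rightarrow> 'a set \<Rightarrow> real \<Rightarrow> nat \<Rightarrow> 'a \<Rightarrow> 'a \<Rightarrow> bool" where
  "chain_steps g X e n x y \<longleftrightarrow> (\<exists>xs::nat \<Rightarrow> 'a. xs 0 = x \<and> xs n = y \<and> (\<forall>i\<le>n. xs i \<in> X)
       \<and> (\<forall>i<n. dist (g (xs i)) (xs (Suc i)) < e))"

lemma eps_chain_steps: "eps_chain g X e x y \<longleftrightarrow> (\<exists>n\<ge>1. chain_steps g X e n x y)"
  unfolding eps_chain_def chain_steps_def by blast

lemma chain_steps_trans:
  assumes "chain_steps g X e n x y" "chain_steps g X e m y z"
  shows "chain_steps g X e (n + m) x z"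
proof -
  obtain xs where xs: "xs 0 = x" "xs n = y" "\<And>i. i \<le> n \<Longrightarrow> xs i \<in> X"
      "\<And>i. i < n \<Longrightarrow> dist (g (xs i)) (xs (Suc i)) < e"
    using assms(1) unfolding chain_steps_def by blast
  obtain ys where ys: "ys 0 = y" "ys m = z" "\<And>i. i \<le> m \<Longrightarrow> ys i \<in> X"
      "\<And>i. i < m \<Longrightarrow> dist (g (ys i)) (ys (Suc i)) < e"
    using assms(2) unfolding chain_steps_def by blast
  define zs where "zs i = (if i \<le> n then xs i else ys (i - n))" for i
  have "dist (g (zs i)) (zs (Suc i)) < e" if "i < n + m" for i
  proof -
    consider "i < n" | "i = n" | "i > n" by linarith
    then show ?thesis
    proof cases
      case 2
      then show ?thesis using that ys(4)[of 0] by (simp add: zs_def xs(2) ys(1))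
    next
      case 3
      then show ?thesis using that ys(4)[of "i - n"] by (simp add: zs_def Suc_diff_le)
    qed (simp add: zs_def xs(4))
  qed
  moreover have "zs 0 = x" "zs (n + m) = z" "\<forall>i\<le>n + m. zs i \<in> X"
    using xs ys by (auto simp: zs_def)
  ultimately show ?thesis unfolding chain_steps_def by blast
qed

lemma eps_chain_trans: "eps_chain g X e x y \<Longrightarrow> eps_chain g X e y z \<Longrightarrow> eps_chain g X e x z"
  unfolding eps_chain_steps using chain_steps_trans by (metis le_add1 order.trans)

lemma chain_rel_trans: "(x, y) \<in> chain_rel g X \<Longrightarrow> (y, z) \<in> chain_rel g X \<Longrightarrow> (x, z) \<in> chain_rel g X"
  unfolding chain_rel_def using eps_chain_trans by fastforce

text \<open>One jump from \<open>g x\<close> to \<open>p\<close>, followed by the true orbit of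
  \<open>p\<close>.\<close>

lemma eps_chain_orbit:
  assumes "x \<in> X" "p \<in> X" "dist (g x) p < e" "\<And>z. z \<in> X \<Longrightarrow> g z \<in> X"
  shows "eps_chain g X e x ((g ^^ k) p)"
proof -
  have e: "0 < e" using assms(3) by (rule le_less_trans[OF zero_le_dist])
  have X: "(g ^^ j) p \<in> X" for j by (induction j) (auto simp: assms)
  have "dist (g (case i of 0 \<Rightarrow> x | Suc j \<Rightarrow> (g ^^ j) p)) ((g ^^ i) p) < e" for i
    using assms(3) e by (cases i) auto
  then have "chain_steps g X e (Suc k) x ((g ^^ k) p)"
    unfolding chain_steps_def using assms(1) X
    by (intro exI[of _ "case_nat x (\<lambda>j. (g ^^ j) p)"]) (auto split: nat.split)
  then show ?thesis unfolding eps_chain_steps by (metis One_nat_def Suc_le_mono le0)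
qed

text \<open>Drop the first step of a chain from \<open>x\<close>: its second point is close to
  \<open>g x\<close>, so by continuity the third is close to the image of \<open>g x\<close>. This
  requires two steps, and appending the loop at \<open>y\<close> guarantees them.\<close>

lemma chain_rel_map:
  assumes cont: "continuous_on X g" and gX: "\<And>z. z \<in> X \<Longrightarrow> g z \<in> X"
    and xy: "(x, y) \<in> chain_rel g X" and yy: "(y, y) \<in> chain_rel g X"
  shows "(g x, y) \<in> chain_rel g X"
proof -
  have X: "x \<in> X" "y \<in> X" using xy by (auto simp: chain_rel_def)
  have "eps_chain g X e (g x) y" if e: "0 < e" for e
  proof -
    obtain \<delta> where \<delta>: "\<delta> > 0" "\<And>p. p \<in> X \<Longrightarrow> dist p (g x) < \<delta> \<Longrightarrow> dist (g p) (g (g x)) < e / 2"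
      using cont gX[OF X(1)] e unfolding continuous_on_iff by (meson half_gt_zero)
    define \<epsilon> where "\<epsilon> = min \<delta> (e / 2)"
    have \<epsilon>: "0 < \<epsilon>" "\<epsilon> \<le> \<delta>" "\<epsilon> \<le> e / 2" using \<delta>(1) e by (auto simp: \<epsilon>_def)
    obtain n m where nm: "1 \<le> n" "1 \<le> m" "chain_steps g X \<epsilon> n x y" "chain_steps g X \<epsilon> m y y"
      using xy yy \<epsilon>(1) unfolding chain_rel_def eps_chain_steps by blast
    have "chain_steps g X \<epsilon> (n + m) x y" by (rule chain_steps_trans[OF nm(3,4)])
    moreover obtain k where k: "n + m = Suc (Suc k)" using nm(1,2) by (metis One_nat_def Suc_le_D add_Suc_right add_Suc)
    ultimately obtain xs where xs: "xs 0 = x" "xs (Suc (Suc k)) = y" "\<And>i. i \<le> Suc (Suc k) \<Longrightarrow> xs i \<in> X"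
      "\<And>i. i < Suc (Suc k) \<Longrightarrow> dist (g (xs i)) (xs (Suc i)) < \<epsilon>"
      unfolding chain_steps_def by auto
    \<comment> \<open>The new chain starts at \<open>g x\<close> and skips
      \<open>xs 1\<close>.\<close>
    define ys where "ys = case_nat (g x) (\<lambda>j. xs (Suc (Suc j)))"
    have "dist (g (g x)) (xs 2) < e"
    proof -
      have "dist (xs 1) (g x) < \<delta>" using xs(4)[of 0] \<epsilon> by (simp add: xs(1) dist_commute)
      then have "dist (g (xs 1)) (g (g x)) < e / 2" using \<delta>(2) xs(3)[of 1] by simp
      moreover have "dist (g (xs 1)) (xs 2) < e / 2" using xs(4)[of 1] \<epsilon> by (simp add: numeral_2_eq_2)
      ultimately show ?thesis
        using dist_triangle3[of "g (g x)" "xs 2" "g (xs 1)"] by linarith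
    qed
    moreover have "dist (g (xs (Suc (Suc j)))) (xs (Suc (Suc (Suc j)))) < e" if "Suc j < Suc k" for j
      using xs(4)[of "Suc (Suc j)"] that \<epsilon> e by simp
    ultimately have "dist (g (ys i)) (ys (Suc i)) < e" if "i < Suc k" for i
      using that by (cases i) (auto simp: ys_def numeral_2_eq_2)
    moreover have "ys 0 = g x" "ys (Suc k) = y" "\<forall>i\<le>Suc k. ys i \<in> X"
      using xs gX[OF X(1)] by (auto simp: ys_def split: nat.split)
    ultimately show ?thesis unfolding eps_chain_def by (intro exI[of _ "Suc k"]) auto
  qed
  then show ?thesis using gX X unfolding chain_rel_def by auto
qed

lemma chain_rel_funpow:
  assumes "continuous_on X g" "\<And>z. z \<in> X \<Longrightarrow> g z \<in> X" "(y, y) \<in> chain_rel g X"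
  shows "((g ^^ m) y, y) \<in> chain_rel g X"
  by (induction m) (auto intro: assms chain_rel_map)

context simplicial_system
begin

lemma g_into: "a \<in> E \<Longrightarrow> x \<in> convex hull a \<Longrightarrow> g x \<in> convex hull (\<gamma> ` a)"
  unfolding g_image_E[symmetric] by (rule imageI)

lemma g_onto:
  assumes "a \<in> E" "y \<in> convex hull (\<gamma> ` a)" obtains w where "w \<in> convex hull a" "g w = y"
proof -
  have "y \<in> g ` (convex hull a)" using assms(2) unfolding g_image_E[OF assms(1)] .
  then show thesis by (auto intro: that)
qed

section \<open>Terminal classes of the transition graph\<close>

abbreviation "G \<equiv> Grel Ks K \<gamma> d"
abbreviation "TB \<equiv> terminal_basic_sets Ks K \<gamma> d"

lemma G_sons: "(s, t) \<in> G \<longleftrightarrow> (\<exists>a\<in>sons s. t = \<gamma> ` a)"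
  unfolding Grel_def sons_def by auto

lemma G_D: "(s, t) \<in> G \<Longrightarrow> s \<in> D \<and> t \<in> D"
  unfolding Grel_def using J_D(1) image_D by auto

lemma G_trancl_D: "(s, t) \<in> G\<^sup>+ \<Longrightarrow> s \<in> D \<and> t \<in> D"
  by (induction rule: trancl.induct) (auto dest: G_D)

lemma G_serial: "s \<in> D \<Longrightarrow> \<exists>t. (s, t) \<in> G"
  using sons_nonempty[of s] unfolding G_sons by auto

text \<open>Reduces membership in a terminal class to reachability from one base state.\<close>

lemma TB_iff: "B \<in> TB \<longleftrightarrow> (\<exists>s. (s, s) \<in> G\<^sup>+ \<and> B = G\<^sup>+ `` {s} \<and> (\<forall>t\<in>B. (t, s) \<in> G\<^sup>+))"
proof
  assume "B \<in> TB"
  then obtain s where s: "(s, s) \<in> G\<^sup>+" "B = {t. (t, t) \<in> G\<^sup>+ \<and> (s, t) \<in> G\<^sup>+ \<and> (t, s) \<in> G\<^sup>+}"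
    and cl: "G\<^sup>+ `` B \<subseteq> B"
    unfolding terminal_basic_sets_def G_basic_sets_def Let_def by auto
  have "s \<in> B" using s by simp
  then have "G\<^sup>+ `` {s} = B" using s(2) cl by blast
  then show "\<exists>s. (s, s) \<in> G\<^sup>+ \<and> B = G\<^sup>+ `` {s} \<and> (\<forall>t\<in>B. (t, s) \<in> G\<^sup>+)" using s by auto
next
  assume "\<exists>s. (s, s) \<in> G\<^sup>+ \<and> B = G\<^sup>+ `` {s} \<and> (\<forall>t\<in>B. (t, s) \<in> G\<^sup>+)"
  then obtain s where s: "(s, s) \<in> G\<^sup>+" "B = G\<^sup>+ `` {s}" "\<And>t. t \<in> B \<Longrightarrow> (t, s) \<in> G\<^sup>+" by auto
  have st: "t \<in> B \<longleftrightarrow> (s, t) \<in> G\<^sup>+" for t unfolding s(2) by simp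
  have "(t, t) \<in> G\<^sup>+" if "t \<in> B" for t
    by (rule trancl_trans[OF s(3)[OF that]]) (use st that in simp)
  then have "t \<in> B \<longleftrightarrow> (t, t) \<in> G\<^sup>+ \<and> (s, t) \<in> G\<^sup>+ \<and> (t, s) \<in> G\<^sup>+" for t
    using s(3) st by metis
  then have "B = {t. (t, t) \<in> G\<^sup>+ \<and> (s, t) \<in> G\<^sup>+ \<and> (t, s) \<in> G\<^sup>+}"
    by (intro set_eqI) (simp only: mem_Collect_eq)
  moreover have "G\<^sup>+ `` B \<subseteq> B"
  proof safe
    fix t u assume "t \<in> B" "(t, u) \<in> G\<^sup>+"
    then show "u \<in> B" unfolding st by (rule trancl_trans)
  qed
  ultimately show "B \<in> TB"
    unfolding terminal_basic_sets_def G_basic_sets_def Let_def using s(1) by blast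
qed

lemma TB_eq: "B \<in> TB \<Longrightarrow> s \<in> B \<Longrightarrow> B = G\<^sup>+ `` {s}"
  unfolding TB_iff by (elim exE conjE) (simp, blast intro: trancl_trans)

lemma TB_D: "B \<in> TB \<Longrightarrow> s \<in> B \<Longrightarrow> s \<in> D"
  using TB_eq[of B s] by (auto dest: G_trancl_D)

lemma TB_nonempty: "B \<in> TB \<Longrightarrow> B \<noteq> {}"
  unfolding TB_iff by auto

lemma TB_subset: "B \<in> TB \<Longrightarrow> B \<subseteq> D" using TB_D by blast

lemma finite_TB: "B \<in> TB \<Longrightarrow> finite B"
  by (rule finite_subset[OF TB_subset finite_D])

lemma finite_TBs: "finite TB"
  by (rule finite_subset[of _ "Pow D"]) (use TB_subset in auto)

lemma TB_sons: "B \<in> TB \<Longrightarrow> s \<in> B \<Longrightarrow> a \<in> sons s \<Longrightarrow> \<gamma> ` a \<in> B"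
  using TB_eq[of B s] G_sons[of s] by auto

lemma TB_trancl: "B \<in> TB \<Longrightarrow> s \<in> B \<Longrightarrow> t \<in> B \<Longrightarrow> (s, t) \<in> G\<^sup>+"
  using TB_eq[of B s] by auto

lemma TB_closed: "B \<in> TB \<Longrightarrow> s \<in> B \<Longrightarrow> (s, t) \<in> G\<^sup>* \<Longrightarrow> t \<in> B"
  using TB_eq[of B s] by (auto simp: rtrancl_eq_or_trancl)

lemma TB_disjoint: "B \<in> TB \<Longrightarrow> B' \<in> TB \<Longrightarrow> s \<in> B \<Longrightarrow> s \<in> B' \<Longrightarrow> B = B'"
  using TB_eq by blast

text \<open>A state reachable from \<open>s\<close> whose set of successors has minimal size is recurrent, up to one step.\<close>
lemma reaches_terminal:
  assumes s: "s \<in> D" obtains B t where "B \<in> TB" "t \<in> B" "(s, t) \<in> G\<^sup>*"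
proof -
  have fin: "finite (G\<^sup>+ `` {t})" for t
    by (rule finite_subset[of _ D]) (auto dest: G_trancl_D)
  obtain t where t: "(s, t) \<in> G\<^sup>*" "\<And>u. (s, u) \<in> G\<^sup>* \<Longrightarrow> card (G\<^sup>+ `` {t}) \<le> card (G\<^sup>+ `` {u})"
    using ex_has_least_nat[of "\<lambda>t. (s, t) \<in> G\<^sup>*" s "\<lambda>t. card (G\<^sup>+ `` {t})"] by auto
  have same: "G\<^sup>+ `` {u} = G\<^sup>+ `` {t}" if "(t, u) \<in> G\<^sup>+" for u
  proof (rule card_seteq[OF fin])
    show "G\<^sup>+ `` {u} \<subseteq> G\<^sup>+ `` {t}" using that by (auto intro: trancl_trans)
    show "card (G\<^sup>+ `` {t}) \<le> card (G\<^sup>+ `` {u})"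
      using t(1) that by (intro t(2)) (meson rtrancl_trans trancl_into_rtrancl)
  qed
  have "t \<in> D" using t(1) s by (auto simp: rtrancl_eq_or_trancl dest: G_trancl_D)
  \<comment> \<open>\<open>t\<close> itself may be transient, so its successor \<open>u\<close>
    serves as the base state of the class.\<close>
  then obtain u where u: "(t, u) \<in> G" using G_serial by blast
  have "G\<^sup>+ `` {t} \<in> TB"
    unfolding TB_iff using u same by (intro exI[of _ u]) (auto intro: r_into_trancl)
  then show thesis using that[of "G\<^sup>+ `` {t}" u] u t(1) by (auto intro: rtrancl_into_rtrancl)
qed

text \<open>An itinerary of \<open>n\<close> steps for \<open>x\<close>, from \<open>s\<close> to
  \<open>t\<close>. It is a relation, since a point on a common face may continue through several
  sons.\<close>

primrec route :: "nat \<Rightarrow> 'a set \<Rightarrow> 'a \<Rightarrow> 'a set \<Rightarrow> bool" where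
  "route 0 s x t \<longleftrightarrow> s = t \<and> s \<in> D \<and> x \<in> convex hull s"
| "route (Suc n) s x t \<longleftrightarrow> s \<in> D \<and> (\<exists>a\<in>sons s. x \<in> convex hull a \<and> route n (\<gamma> ` a) (g x) t)"

lemma route_start: "route n s x t \<Longrightarrow> s \<in> D \<and> x \<in> convex hull s"
  by (cases n) (auto simp: hull_sons)

lemma route_rtrancl: "route n s x t \<Longrightarrow> (s, t) \<in> G\<^sup>*"
proof (induction n arbitrary: s x)
  case (Suc n)
  then obtain a where a: "a \<in> sons s" "route n (\<gamma> ` a) (g x) t" by auto
  have "(s, \<gamma> ` a) \<in> G" using a(1) by (auto simp: G_sons)
  then show ?case using Suc.IH[OF a(2)] by (rule converse_rtrancl_into_rtrancl)
qed simp

lemma route_end: "route n s x t \<Longrightarrow> t \<in> D \<and> (g ^^ n) x \<in> convex hull t"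
  by (induction n arbitrary: s x) (auto simp: funpow_swap1)

lemma route_exists: "s \<in> D \<Longrightarrow> x \<in> convex hull s \<Longrightarrow> \<exists>t. route n s x t"
proof (induction n arbitrary: s x)
  case (Suc n)
  obtain a where a: "a \<in> sons s" "x \<in> convex hull a" using Suc.prems hull_sons by blast
  have "g x \<in> convex hull (\<gamma> ` a)" by (rule g_into[OF sons_E[OF a(1)] a(2)])
  then obtain t where "route n (\<gamma> ` a) (g x) t" using Suc.IH image_D sons_E a(1) by blast
  then show ?case using a Suc.prems by auto
qed auto

text \<open>Pull \<open>z\<close> back through the inverse branches along the route of
  \<open>x\<close>. In the final simplex the two points are within 2 in barycentric distance, and
  each step back multiplies this by the contraction rate, so one \<open>N\<close> works for all
  points and routes.\<close>

lemma shadow: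
  assumes e: "0 < e"
  obtains N where "\<And>n s x t z. N \<le> n \<Longrightarrow> route n s x t \<Longrightarrow> z \<in> convex hull t
    \<Longrightarrow> \<exists>y\<in>convex hull s. (g ^^ n) y = z \<and> dist x y < e"
proof -
  obtain \<tau> where rate: "contraction_rate \<tau>" using contraction .
  note \<tau> = contraction_rateD[OF rate]
  obtain C where C: "0 < C" "\<And>s x y. s \<in> D \<Longrightarrow> x \<in> convex hull s \<Longrightarrow> y \<in> convex hull s \<Longrightarrow> dist x y \<le> C * bdist s x y"
    using dist_bound by blast
  have pull: "\<exists>y\<in>convex hull s. (g ^^ n) y = z \<and> bdist s x y \<le> 2 * \<tau> ^ n"
    if "route n s x t" "z \<in> convex hull t" for n s x t z
    using that
  proof (induction n arbitrary: s x)
    case 0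
    then show ?case using bdist_le_2[OF nsimplex_D, of s x z] by auto
  next
    case (Suc n)
    then obtain a where a: "a \<in> sons s" "x \<in> convex hull a" "route n (\<gamma> ` a) (g x) t" by auto
    note aE = sons_E[OF a(1)]
    obtain y where y: "y \<in> convex hull (\<gamma> ` a)" "(g ^^ n) y = z" "bdist (\<gamma> ` a) (g x) y \<le> 2 * \<tau> ^ n"
      using Suc.IH[OF a(3) Suc.prems(2)] by blast
    obtain w where w: "w \<in> convex hull a" "g w = y" using g_onto[OF aE y(1)] .
    have "bdist s x w \<le> \<tau> * bdist (\<gamma> ` a) (g x) (g w)"
      using \<tau>(3)[OF aE a(2) w(1)] sons_J[OF a(1)] by simp
    also have "\<dots> \<le> \<tau> * (2 * \<tau> ^ n)" using y(3) w(2) \<tau>(1) by (intro mult_left_mono) auto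
    finally have "bdist s x w \<le> 2 * \<tau> ^ Suc n" by simp
    moreover have "w \<in> convex hull s" using w(1) J_D(2)[OF aE] sons_J[OF a(1)] by blast
    moreover have "(g ^^ Suc n) w = z" using y(2) w(2) by (simp add: funpow_swap1)
    ultimately show ?case by blast
  qed
  have "\<exists>N. \<forall>n s x t z. N \<le> n \<longrightarrow> route n s x t \<longrightarrow> z \<in> convex hull t
    \<longrightarrow> (\<exists>y\<in>convex hull s. (g ^^ n) y = z \<and> dist x y < e)"
  proof -
    have "(\<lambda>n. C * (2 * \<tau> ^ n)) \<longlonglongrightarrow> C * (2 * 0)"
      using \<tau> by (intro tendsto_intros LIMSEQ_power_zero) auto
    then have "eventually (\<lambda>n. C * (2 * \<tau> ^ n) < e) sequentially"
      using e by (intro order_tendstoD(2)) auto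
    then obtain N where N: "\<And>n. N \<le> n \<Longrightarrow> C * (2 * \<tau> ^ n) < e" by (auto simp: eventually_sequentially)
    have "\<exists>y\<in>convex hull s. (g ^^ n) y = z \<and> dist x y < e"
      if n: "N \<le> n" and r: "route n s x t" "z \<in> convex hull t" for n s x t z
    proof -
      obtain y where y: "y \<in> convex hull s" "(g ^^ n) y = z" "bdist s x y \<le> 2 * \<tau> ^ n"
        using pull[OF r] by blast
      have "dist x y \<le> C * bdist s x y" using C(2) route_start[OF r(1)] y(1) by blast
      also have "\<dots> \<le> C * (2 * \<tau> ^ n)" using y(3) C(1) by (intro mult_left_mono) auto
      also have "\<dots> < e" by (rule N[OF n])
      finally show ?thesis using y by blast
    qed
    then show ?thesis by blast
  qed
  then show thesis using that by metis
qed

text \<open>The tail of a long route, starting at \<open>g x\<close>, is shadowed by the orbit of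
  some \<open>p\<close> that arrives at \<open>z\<close>; a single jump from \<open>g x\<close> to
  \<open>p\<close>, then the orbit through \<open>z\<close> to \<open>y\<close>, is a chain.\<close>

lemma chain_of_routes:
  assumes x: "x \<in> X" and y: "y \<in> X"
    and r: "\<And>N. \<exists>n\<ge>N. \<exists>s t k z. route n s x t \<and> z \<in> convex hull t \<and> (g ^^ k) z = y"
  shows "(x, y) \<in> chain_rel g X"
proof -
  have "eps_chain g X e x y" if e: "0 < e" for e
  proof -
    obtain N where N: "\<And>n s x t z. N \<le> n \<Longrightarrow> route n s x t \<Longrightarrow> z \<in> convex hull t
      \<Longrightarrow> \<exists>y\<in>convex hull s. (g ^^ n) y = z \<and> dist x y < e" using shadow[OF e] by blast
    \<comment> \<open>The first step of the route is spent on the jump, hence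
      \<open>Suc N\<close>.\<close>
    obtain n s t k z where n: "Suc N \<le> n" "route n s x t" "z \<in> convex hull t" "(g ^^ k) z = y"
      using r[of "Suc N"] by blast
    then obtain m where m: "n = Suc m" "N \<le> m" by (metis Suc_le_D Suc_le_mono)
    then obtain a where a: "a \<in> sons s" "route m (\<gamma> ` a) (g x) t" using n(2) by auto
    obtain p where p: "p \<in> convex hull (\<gamma> ` a)" "(g ^^ m) p = z" "dist (g x) p < e"
      using N[OF m(2) a(2) n(3)] by blast
    have "p \<in> X" using p(1) hull_sub_X[OF image_D[OF sons_E[OF a(1)]]] by blast
    then have "eps_chain g X e x ((g ^^ (k + m)) p)" by (intro eps_chain_orbit x p(3) g_X)
    then show ?thesis using p(2) n(4) by (simp add: funpow_add)
  qed
  then show ?thesis using x y unfolding chain_rel_def by simp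
qed

text \<open>Each son maps onto its image simplex, so points can be lifted backwards along a
  path.\<close>

lemma G_onto: "(s, t) \<in> G\<^sup>+ \<Longrightarrow> y \<in> convex hull t \<Longrightarrow> \<exists>k. \<exists>z\<in>convex hull s. (g ^^ k) z = y"
proof (induction arbitrary: rule: converse_trancl_induct)
  case (base s)
  then obtain a where a: "a \<in> sons s" "t = \<gamma> ` a" by (auto simp: G_sons)
  obtain z where "z \<in> convex hull a" "g z = y" using g_onto[OF sons_E[OF a(1)]] base(2) a(2) by metis
  then show ?case using a(1) J_D(2)[OF sons_E[OF a(1)]] sons_J[OF a(1)] by (intro exI[of _ 1]) auto
next
  case (step s u)
  then obtain a where a: "a \<in> sons s" "u = \<gamma> ` a" by (auto simp: G_sons)
  obtain k z where z: "z \<in> convex hull u" "(g ^^ k) z = y" using step by blast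
  obtain w where "w \<in> convex hull a" "g w = z" using g_onto[OF sons_E[OF a(1)]] z(1) a(2) by metis
  then show ?case using z(2) a(1) J_D(2)[OF sons_E[OF a(1)]] sons_J[OF a(1)]
    by (intro exI[of _ "Suc k"]) (auto simp: funpow_swap1)
qed

text \<open>A route that starts in \<open>B\<close> ends in \<open>B\<close>, and from there the
  orbits reach every point of every simplex of \<open>B\<close>.\<close>

lemma terminal_chain:
  assumes B: "B \<in> TB" and x: "x \<in> (\<Union>s\<in>B. convex hull s)" and y: "y \<in> (\<Union>s\<in>B. convex hull s)"
  shows "(x, y) \<in> chain_rel g X"
proof (rule chain_of_routes)
  show "x \<in> X" "y \<in> X" using x y TB_D[OF B] by (auto simp: X_D)
  fix N
  obtain s where s: "s \<in> B" "x \<in> convex hull s" using x by auto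
  obtain s' where s': "s' \<in> B" "y \<in> convex hull s'" using y by auto
  obtain t where t: "route N s x t" using route_exists[OF TB_D[OF B s(1)] s(2)] by blast
  have "t \<in> B" using TB_closed[OF B s(1) route_rtrancl[OF t]] .
  then obtain k z where "z \<in> convex hull t" "(g ^^ k) z = y"
    using G_onto[OF TB_trancl[OF B _ s'(1)] s'(2)] by blast
  then show "\<exists>n\<ge>N. \<exists>s t k z. route n s x t \<and> z \<in> convex hull t \<and> (g ^^ k) z = y" using t by blast
qed

lemma finite_basic_sets: "finite (basic_sets g X)"
proof -
  let ?C = "chain_rel g X"
  \<comment> \<open>\<open>t\<close> is hit by routes of \<open>x\<close> of unbounded length. Every
    point has such a \<open>t\<close> by the pigeonhole principle, and one of them will label the
    chain class.\<close>
  define rec where "rec x t \<longleftrightarrow> (\<forall>N. \<exists>n\<ge>N. \<exists>s. route n s x t)" for x t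
  have rec_ex: "\<exists>t\<in>D. rec x t" if x: "x \<in> X" for x
  proof -
    obtain s where s: "s \<in> D" "x \<in> convex hull s" using x by (auto simp: X_D)
    obtain t where t: "\<And>n. route n s x (t n)" using route_exists[OF s] by metis
    have "range t \<subseteq> D" using route_end[OF t] by auto
    then have "finite (range t)" by (rule finite_subset) simp
    then obtain n0 where "infinite {n. t n = t n0}" using pigeonhole_infinite[of UNIV t] by auto
    then have "rec x (t n0)"
      unfolding rec_def infinite_nat_iff_unbounded_le using t by (metis mem_Collect_eq)
    then show ?thesis using route_end[OF t] by blast
  qed
  \<comment> \<open>With a shared label \<open>t\<close>, some point of the orbit of
    \<open>y\<close> lies in the hull of \<open>t\<close> and is chained to from \<open>x\<close>;
    chain recurrence of \<open>y\<close> leads from that point back to \<open>y\<close>. Applied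
    both ways, this makes the labelling injective.\<close>
  have link: "(x, y) \<in> ?C" if x: "x \<in> X" "rec x t" and y: "(y, y) \<in> ?C" "rec y t" for x y t
  proof -
    obtain m s where "route m s y t" using y(2) unfolding rec_def by blast
    then have m: "(g ^^ m) y \<in> convex hull t" "t \<in> D" using route_end by auto
    have "(x, (g ^^ m) y) \<in> ?C"
    proof (rule chain_of_routes[OF x(1)])
      show "(g ^^ m) y \<in> X" using m hull_sub_X by blast
      show "\<exists>n\<ge>N. \<exists>s t k z. route n s x t \<and> z \<in> convex hull t \<and> (g ^^ k) z = (g ^^ m) y" for N
        using x(2) m(1) unfolding rec_def by (metis funpow_0)
    qed
    then show ?thesis
      using chain_rel_trans chain_rel_funpow[OF continuous_on_g g_X y(1)] by blast
  qed
  define cls where "cls x = {y. (y, y) \<in> ?C \<and> (x, y) \<in> ?C \<and> (y, x) \<in> ?C}" for x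
  define Q where "Q B p \<longleftrightarrow> fst p \<in> D \<and> rec (snd p) (fst p) \<and> (snd p, snd p) \<in> ?C \<and> B = cls (snd p)" for B p
  have "\<forall>B\<in>basic_sets g X. \<exists>p. Q B p"
  proof
    fix B assume "B \<in> basic_sets g X"
    then obtain x where x: "(x, x) \<in> ?C" "B = cls x"
      unfolding basic_sets_def Let_def cls_def by blast
    then have "x \<in> X" by (auto simp: chain_rel_def)
    then obtain t where "t \<in> D" "rec x t" using rec_ex by blast
    then have "Q B (t, x)" using x by (simp add: Q_def)
    then show "\<exists>p. Q B p" ..
  qed
  then obtain p where p: "\<forall>B\<in>basic_sets g X. Q B (p B)" by (rule bchoice[THEN exE])
  define f where "f = fst \<circ> p"
  have f: "f B \<in> D" "rec (snd (p B)) (f B)" "(snd (p B), snd (p B)) \<in> ?C" "B = cls (snd (p B))"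
    if "B \<in> basic_sets g X" for B using p that by (auto simp: Q_def f_def)
  have "inj_on f (basic_sets g X)"
  proof (rule inj_onI)
    fix A B assume AB: "A \<in> basic_sets g X" "B \<in> basic_sets g X" "f A = f B"
    let ?a = "snd (p A)" and ?b = "snd (p B)"
    have X: "?a \<in> X" "?b \<in> X" using f(3)[OF AB(1)] f(3)[OF AB(2)] by (auto simp: chain_rel_def)
    have ab: "(?a, ?b) \<in> ?C" "(?b, ?a) \<in> ?C"
      using link[OF X(1) f(2)[OF AB(1)] f(3)[OF AB(2)]] link[OF X(2) f(2)[OF AB(2)] f(3)[OF AB(1)]]
        f(2)[OF AB(1)] f(2)[OF AB(2)] AB(3) by simp_all
    have "y \<in> cls ?a \<longleftrightarrow> y \<in> cls ?b" for y
      unfolding cls_def mem_Collect_eq using ab chain_rel_trans by metis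
    then have "cls ?a = cls ?b" by blast
    then show "A = B" using f(4)[OF AB(1)] f(4)[OF AB(2)] by simp
  qed
  moreover have "f ` basic_sets g X \<subseteq> D" using f(1) by blast
  ultimately show ?thesis by (metis finite_D finite_imageD finite_subset)
qed

section \<open>Densities of invariant sets on a terminal class\<close>

lemma P_le_1: "s \<in> D \<Longrightarrow> P s A \<le> 1"
  using P_mono[of A UNIV s] P_UNIV[of s] by simp

text \<open>At each scale, cylinders meeting \<open>C\<close> cover it; on every cylinder the invariant set has the density
  it has on some simplex of \<open>B\<close>.\<close>
lemma cylinder_cover:
  assumes B: "\<And>s a. s \<in> B \<Longrightarrow> a \<in> sons s \<Longrightarrow> \<gamma> ` a \<in> B" "B \<subseteq> D"
    and \<tau>: "contraction_rate \<tau>"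
    and A: "A \<in> sets borel" "g -` A = A" and m: "\<And>s. s \<in> B \<Longrightarrow> P s A \<le> m"
    and s: "s \<in> B"
  shows "\<exists>F\<in>sets borel. C \<inter> convex hull s \<subseteq> F \<and>
    F \<subseteq> {y \<in> convex hull s. \<exists>c\<in>C \<inter> convex hull s. bdist s y c \<le> 2 * \<tau> ^ n} \<and> P s (F \<inter> A) \<le> m * P s F"
  using s
proof (induction n arbitrary: s C)
  case 0
  then have sD: "s \<in> D" using B(2) by blast
  show ?case
  proof (cases "C \<inter> convex hull s = {}")
    case True
    then show ?thesis by (intro bexI[of _ "{}"]) auto
  next
    case False
    have "P s (convex hull s \<inter> A) \<le> m * P s (convex hull s)"
      using m[OF 0] A by (simp add: P_inter_hull[OF sD] P_hull[OF sD])
    then show ?thesis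
      using False bdist_le_2[OF nsimplex_D[OF sD]] sD by (intro bexI[of _ "convex hull s"]) auto
  qed
next
  case (Suc n)
  then have sD: "s \<in> D" using B(2) by blast
  \<comment> \<open>The induction hypothesis for the image of \<open>C\<close> under each branch,
    packaged so that one cover per son can be chosen.\<close>
  define R where "R a F \<longleftrightarrow> F \<in> sets borel \<and> g ` (C \<inter> convex hull a) \<inter> convex hull (\<gamma> ` a) \<subseteq> F \<and>
    F \<subseteq> {y \<in> convex hull (\<gamma> ` a). \<exists>c\<in>g ` (C \<inter> convex hull a) \<inter> convex hull (\<gamma> ` a). bdist (\<gamma> ` a) y c \<le> 2 * \<tau> ^ n}
      \<and> P (\<gamma> ` a) (F \<inter> A) \<le> m * P (\<gamma> ` a) F" for a F
  have "\<forall>a\<in>sons s. \<exists>F. R a F"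
  proof
    fix a assume a: "a \<in> sons s"
    show "\<exists>F. R a F"
      unfolding R_def using Suc.IH[OF B(1)[OF Suc.prems a], of "g ` (C \<inter> convex hull a)"]
      by (simp only: Bex_def)
  qed
  then obtain F where "\<forall>a\<in>sons s. R a (F a)" by (rule bchoice[THEN exE])
  then have F: "F a \<in> sets borel" "g ` (C \<inter> convex hull a) \<inter> convex hull (\<gamma> ` a) \<subseteq> F a"
    "F a \<subseteq> {y \<in> convex hull (\<gamma> ` a).
        \<exists>c\<in>g ` (C \<inter> convex hull a) \<inter> convex hull (\<gamma> ` a). bdist (\<gamma> ` a) y c \<le> 2 * \<tau> ^ n}"
    "P (\<gamma> ` a) (F a \<inter> A) \<le> m * P (\<gamma> ` a) (F a)" if "a \<in> sons s" for a
    using that unfolding R_def by simp_all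
  let ?F = "\<Union>a\<in>sons s. convex hull a \<inter> g -` F a"
  have "?F \<in> sets borel"
    using F(1) sons_E by (intro sets.finite_UN) auto
  moreover have "C \<inter> convex hull s \<subseteq> ?F"
  proof
    fix x assume x: "x \<in> C \<inter> convex hull s"
    then obtain a where a: "a \<in> sons s" "x \<in> convex hull a" using hull_sons[OF sD] by auto
    have "g x \<in> g ` (C \<inter> convex hull a) \<inter> convex hull (\<gamma> ` a)"
      using x a g_into[OF sons_E[OF a(1)] a(2)] by blast
    then show "x \<in> ?F" using F(2)[OF a(1)] a by blast
  qed
  moreover have "?F \<subseteq> {y \<in> convex hull s. \<exists>c\<in>C \<inter> convex hull s. bdist s y c \<le> 2 * \<tau> ^ Suc n}"
  proof
    fix y assume "y \<in> ?F"
    then obtain a where a: "a \<in> sons s" "y \<in> convex hull a" "g y \<in> F a" by auto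
    then obtain c where c: "c \<in> C \<inter> convex hull a" "bdist (\<gamma> ` a) (g y) (g c) \<le> 2 * \<tau> ^ n"
      using F(3)[OF a(1)] by auto
    have "bdist s y c \<le> \<tau> * bdist (\<gamma> ` a) (g y) (g c)"
      using contraction_rateD(3)[OF \<tau> sons_E[OF a(1)] a(2), of c] c sons_J[OF a(1)] by auto
    also have "\<dots> \<le> \<tau> * (2 * \<tau> ^ n)" using c(2) contraction_rateD(1)[OF \<tau>] by (rule mult_left_mono)
    finally have "bdist s y c \<le> 2 * \<tau> ^ Suc n" by simp
    moreover have "convex hull a \<subseteq> convex hull s" using hull_sons[OF sD] a(1) by blast
    ultimately show "y \<in> {y \<in> convex hull s. \<exists>c\<in>C \<inter> convex hull s. bdist s y c \<le> 2 * \<tau> ^ Suc n}"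
      using a c by blast
  qed
  moreover have "P s (?F \<inter> A) \<le> m * P s ?F"
  proof -
    \<comment> \<open>Invariance moves \<open>A\<close> under the preimage, so the density bound of
      each cover survives the pull-back and is then averaged over the sons.\<close>
    have "?F \<inter> A = (\<Union>a\<in>sons s. convex hull a \<inter> g -` (F a \<inter> A))"
      using A(2) by auto
    then have "P s (?F \<inter> A) = (\<Sum>a\<in>sons s. nu K d a * P (\<gamma> ` a) (F a \<inter> A))"
      using P_step[OF sD, of "\<lambda>a. F a \<inter> A"] F(1) A(1) by simp
    also have "\<dots> \<le> (\<Sum>a\<in>sons s. nu K d a * (m * P (\<gamma> ` a) (F a)))"
      using nu_pos sons_E F(4) by (intro sum_mono mult_left_mono) (auto intro: less_imp_le)
    also have "\<dots> = m * P s ?F"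
      using P_step[OF sD, of F] F(1) by (simp add: sum_distrib_left mult.left_commute)
    finally show ?thesis .
  qed
  ultimately show ?case by blast
qed

text \<open>Let \<open>m\<close> be the largest density of \<open>A\<close> on a simplex of
  \<open>B\<close>, attained at \<open>s\<close>. The cylinder covers of a compact \<open>C\<close>
  inside \<open>A\<close> shrink to \<open>C\<close>, giving \<open>P s C \<le> m * P s C\<close>;
  exhausting \<open>A\<close> by compact sets yields \<open>m \<le> m * m\<close>, so
  \<open>m\<close> is 0 or 1. The value 1 then spreads to all of \<open>B\<close>. No Lebesgue
  density theorem enters.\<close>

lemma zero_one:
  assumes B: "B \<in> TB" and A: "A \<in> sets borel" "g -` A = A"
  shows "(\<forall>s\<in>B. P s A = 0) \<or> (\<forall>s\<in>B. P s A = 1)"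
proof -
  obtain \<tau> where rate: "contraction_rate \<tau>" using contraction .
  note \<tau> = contraction_rateD[OF rate]
  obtain L where L: "0 < L" "\<And>s x y. s \<in> D \<Longrightarrow> x \<in> convex hull s \<Longrightarrow> y \<in> convex hull s \<Longrightarrow> dist x y \<le> L * bdist s x y"
    using dist_bound by blast
  define m where "m = Max ((\<lambda>s. P s A) ` B)"
  have m: "P s A \<le> m" if "s \<in> B" for s
    unfolding m_def using that finite_TB[OF B] by (intro Max_ge) auto
  have "m \<in> (\<lambda>s. P s A) ` B"
    unfolding m_def using finite_TB[OF B] TB_nonempty[OF B] by (intro Max_in) auto
  then obtain s where s: "s \<in> B" "P s A = m" by auto
  note sD = TB_D[OF B s(1)]
  interpret finite_measure "lam s" by (rule finite_measure_lam)
  have m0: "0 \<le> m" using s(2) by auto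
  have compact_le: "P s C \<le> m * P s C" if C: "compact C" "C \<subseteq> A" for C
  proof (cases "C = {}")
    case False
    \<comment> \<open>Closed neighbourhoods decreasing to \<open>C\<close>: the covers themselves
      need not be nested, but one of sufficient depth lies in a given \<open>U k\<close>.\<close>
    define U where "U k = {x. infdist x C \<le> inverse (real (Suc k))}" for k
    have Ucl: "closed (U k)" for k
      unfolding U_def by (intro closed_Collect_le continuous_intros continuous_on_infdist)
    have Uk: "P s C \<le> m * P s (U k)" for k
    proof -
      have "(\<lambda>n. L * (2 * \<tau> ^ n)) \<longlonglongrightarrow> L * (2 * 0)"
        using \<tau> by (intro tendsto_intros LIMSEQ_power_zero) auto
      then have "eventually (\<lambda>n. L * (2 * \<tau> ^ n) < inverse (real (Suc k))) sequentially"
        by (intro order_tendstoD(2)) auto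
      then obtain n where n: "L * (2 * \<tau> ^ n) < inverse (real (Suc k))"
        by (auto simp: eventually_sequentially)
      have "\<exists>F\<in>sets borel. C \<inter> convex hull s \<subseteq> F \<and>
          F \<subseteq> {y \<in> convex hull s. \<exists>c\<in>C \<inter> convex hull s. bdist s y c \<le> 2 * \<tau> ^ n} \<and> P s (F \<inter> A) \<le> m * P s F"
        by (rule cylinder_cover[OF TB_sons[OF B] TB_subset[OF B] rate A m s(1)])
      then obtain F where F1: "F \<in> sets borel" and F2: "C \<inter> convex hull s \<subseteq> F \<and>
          F \<subseteq> {y \<in> convex hull s. \<exists>c\<in>C \<inter> convex hull s. bdist s y c \<le> 2 * \<tau> ^ n} \<and> P s (F \<inter> A) \<le> m * P s F"
        by (rule bexE)
      note F = F1 F2[THEN conjunct1] F2[THEN conjunct2, THEN conjunct1] F2[THEN conjunct2, THEN conjunct2]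
      have "F \<subseteq> U k"
      proof
        fix y assume "y \<in> F"
        then obtain c where c: "y \<in> convex hull s" "c \<in> C" "c \<in> convex hull s" "bdist s y c \<le> 2 * \<tau> ^ n"
          using F(3) by blast
        have "infdist y C \<le> dist y c" by (rule infdist_le[OF c(2)])
        also have "\<dots> \<le> L * bdist s y c" by (rule L(2)[OF sD c(1,3)])
        also have "\<dots> \<le> L * (2 * \<tau> ^ n)" using c(4) L(1) by (intro mult_left_mono) auto
        finally show "y \<in> U k" using n by (simp add: U_def)
      qed
      have "P s C = P s (convex hull s \<inter> C)"
        using C by (intro P_inter_hull[OF sD, symmetric]) (simp add: borel_compact)
      also have "\<dots> \<le> P s (F \<inter> A)" using F C A(1) by (intro P_mono) auto
      also have "\<dots> \<le> m * P s F" by (rule F(4))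
      also have "\<dots> \<le> m * P s (U k)"
        using \<open>F \<subseteq> U k\<close> Ucl m0 by (intro mult_left_mono P_mono) auto
      finally show ?thesis .
    qed
    have "(\<lambda>k. P s (U k)) \<longlonglongrightarrow> P s (\<Inter>k. U k)"
    proof (rule finite_Lim_measure_decseq)
      show "range U \<subseteq> sets (lam s)" using Ucl by auto
      show "decseq U" unfolding decseq_def U_def
      proof (intro allI impI subsetI CollectI)
        fix i j :: nat and x assume ij: "i \<le> j" "x \<in> {x. infdist x C \<le> inverse (real (Suc j))}"
        have "infdist x C \<le> inverse (real (Suc j))" using ij(2) by simp
        also have "\<dots> \<le> inverse (real (Suc i))" using ij(1) by (intro le_imp_inverse_le) auto
        finally show "infdist x C \<le> inverse (real (Suc i))" .
      qed
    qed
    moreover have "(\<Inter>k. U k) = C"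
    proof
      show "C \<subseteq> (\<Inter>k. U k)" by (auto simp: U_def)
      show "(\<Inter>k. U k) \<subseteq> C"
      proof
        fix x assume "x \<in> (\<Inter>k. U k)"
        then have "infdist x C \<le> inverse (real (Suc k))" for k by (simp add: U_def)
        then have "infdist x C \<le> 0" using reals_Archimedean[of "infdist x C"] by (meson not_le)
        then show "x \<in> C"
          using in_closed_iff_infdist_zero[OF compact_imp_closed[OF C(1)] False, of x] infdist_nonneg[of x C] by simp
      qed
    qed
    ultimately have "(\<lambda>k. m * P s (U k)) \<longlonglongrightarrow> m * P s C" by (intro tendsto_mult_left) simp
    then show ?thesis using Uk by (intro LIMSEQ_le_const) auto
  qed simp
  have "emeasure (lam s) A = (SUP C\<in>{C. C \<subseteq> A \<and> compact C}. emeasure (lam s) C)"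
    by (rule inner_regular) (use A in \<open>auto simp: emeasure_eq_measure\<close>)
  also have "\<dots> \<le> ennreal (m * P s A)"
  proof (rule SUP_least)
    fix C assume "C \<in> {C. C \<subseteq> A \<and> compact C}"
    then have "P s C \<le> m * P s A"
      using compact_le[of C] mult_left_mono[OF P_mono[of C A s] m0] A(1) by auto
    then show "emeasure (lam s) C \<le> ennreal (m * P s A)" by (simp add: emeasure_eq_measure ennreal_leI)
  qed
  finally have mm: "m \<le> m * m" using m0 by (simp add: emeasure_eq_measure s(2))
  show ?thesis
  proof (cases "m = 0")
    case True
    then show ?thesis using m by (auto intro!: antisym)
  next
    case False
    then have "1 \<le> m" using mm m0 by simp
    then have s1: "P s A = 1" using s(2) P_le_1[OF sD, of A] by simp
    have step: "P (\<gamma> ` a) A = 1" if u: "u \<in> B" "P u A = 1" and a: "a \<in> sons u" for u a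
    proof (rule nu_average_max[OF TB_D[OF B u(1)] _ _ a])
      show "1 \<le> (\<Sum>a\<in>sons u. nu K d a * P (\<gamma> ` a) A)"
        using P_vimage[OF TB_D[OF B u(1)] A(1)] u(2) A(2) by simp
    qed (rule P_le_1)
    have "P t A = 1" if "(s, t) \<in> G\<^sup>+" for t
      using that
    proof (induction rule: trancl_induct)
      case (base t)
      then show ?case using step[OF s(1) s1] by (auto simp: G_sons)
    next
      case (step t u)
      then show ?case using \<open>\<And>u a. u \<in> B \<Longrightarrow> P u A = 1 \<Longrightarrow> a \<in> sons u \<Longrightarrow> P (\<gamma> ` a) A = 1\<close>
          TB_closed[OF B s(1) trancl_into_rtrancl] by (metis G_sons)
    qed
    then show ?thesis using TB_trancl[OF B s(1)] by blast
  qed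
qed

end

section \<open>Generic points and tractability\<close>

lemma sets_mixture [simp, measurable_cong]: "sets (mixture w S) = sets borel"
  and space_mixture [simp]: "space (mixture w S) = UNIV"
  using sets.sigma_sets_eq[of borel] by (auto simp: mixture_def)

lemma emeasure_mixture:
  fixes A :: "'a::euclidean_space set"
  assumes A: "A \<in> sets borel"
  shows "emeasure (mixture w S) A = (\<Sum>s\<in>S. ennreal (w s) * emeasure (lam s) A)"
  unfolding mixture_def
proof (rule emeasure_measure_of_sigma)
  show "sigma_algebra UNIV (sets borel :: 'a set set)"
    using sets.sigma_algebra_axioms[of "borel :: 'a measure"] by simp
  show "positive (sets borel) (\<lambda>A. \<Sum>s\<in>S. ennreal (w s) * emeasure (lam s) A)"
    by (simp add: positive_def)
  show "countably_additive (sets borel) (\<lambda>A. \<Sum>s\<in>S. ennreal (w s) * emeasure (lam s) A)"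
    unfolding countably_additive_def
  proof (intro allI impI)
    fix F :: "nat \<Rightarrow> 'a set" assume F: "range F \<subseteq> sets borel" "disjoint_family F"
    have "(\<Sum>i. \<Sum>s\<in>S. ennreal (w s) * emeasure (lam s) (F i)) = (\<Sum>s\<in>S. \<Sum>i. ennreal (w s) * emeasure (lam s) (F i))"
      by (rule suminf_sum) auto
    also have "\<dots> = (\<Sum>s\<in>S. ennreal (w s) * emeasure (lam s) (\<Union>i. F i))"
      using F by (simp add: ennreal_suminf_cmult suminf_emeasure)
    finally show "(\<Sum>i. \<Sum>s\<in>S. ennreal (w s) * emeasure (lam s) (F i)) = (\<Sum>s\<in>S. ennreal (w s) * emeasure (lam s) (\<Union>i. F i))" .
  qed
qed (rule A)

lemma emeasure_mixture_real:
  assumes "A \<in> sets borel" "\<And>s. s \<in> S \<Longrightarrow> 0 \<le> w s"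
  shows "emeasure (mixture w S) A = ennreal (\<Sum>s\<in>S. w s * measure (lam s) A)"
  unfolding emeasure_mixture[OF assms(1)] using assms(2)
  by (simp add: finite_measure.emeasure_eq_measure[OF finite_measure_lam] ennreal_mult[symmetric] sum_ennreal)

section \<open>Genericity of almost every point\<close>

definition small_partition :: "'a::metric_space set \<Rightarrow> real \<Rightarrow> nat \<Rightarrow> (nat \<Rightarrow> 'a set) \<Rightarrow> bool" where
  "small_partition X r m Q \<longleftrightarrow> (\<forall>i. Q i \<in> sets borel \<and> Q i \<subseteq> X) \<and> (\<forall>x\<in>X. \<exists>!i. i < m \<and> x \<in> Q i)
    \<and> (\<forall>i. \<forall>x\<in>Q i. \<forall>y\<in>Q i. dist x y < r)"

text \<open>Balls of radius r/2 from total boundedness, made disjoint by removing the earlier ones.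
  Past \<open>length ps\<close> the centre \<open>ps ! i\<close> is arbitrary, yet each such set is
  still Borel and small.\<close>

lemma small_partition_exists:
  fixes X :: "'a::metric_space set"
  assumes X: "compact X" and r: "0 < r" and bX: "X \<in> sets borel"
  obtains m Q where "small_partition X r m Q"
proof -
  obtain F where F: "finite F" "X \<subseteq> (\<Union>p\<in>F. ball p (r / 2))"
    using X r unfolding compact_eq_totally_bounded by (meson half_gt_zero)
  obtain ps where ps: "set ps = F" using finite_list[OF F(1)] by blast
  define Q where "Q i = (X \<inter> ball (ps ! i) (r / 2)) - (\<Union>j<i. ball (ps ! j) (r / 2))" for i
  have a1: "Q i \<in> sets borel" "Q i \<subseteq> X" for i using bX by (auto simp: Q_def)
  have a2: "\<exists>!i. i < length ps \<and> x \<in> Q i" if x: "x \<in> X" for x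
  proof -
    define k where "k = (LEAST j. x \<in> ball (ps ! j) (r / 2))"
    obtain p where "p \<in> set ps" "x \<in> ball p (r / 2)" using F(2) x ps by auto
    then obtain j where j: "j < length ps" "x \<in> ball (ps ! j) (r / 2)" by (metis in_set_conv_nth)
    have k1: "x \<in> ball (ps ! k) (r / 2)" unfolding k_def using j(2) by (rule LeastI)
    have k2: "k \<le> i" if "x \<in> ball (ps ! i) (r / 2)" for i unfolding k_def using that by (rule Least_le)
    have kj: "k < length ps" using k2[OF j(2)] j(1) by simp
    have "x \<notin> ball (ps ! j) (r / 2)" if "j < k" for j using k2[of j] that by auto
    then have "x \<in> Q k" using x k1 unfolding Q_def by blast
    moreover have "i = k" if "x \<in> Q i" for i
    proof (rule antisym)
      show "k \<le> i" using that k2[of i] by (simp add: Q_def)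
      show "i \<le> k"
      proof (rule ccontr)
        assume "\<not> i \<le> k"
        then show False using that k1 by (auto simp: Q_def)
      qed
    qed
    ultimately show ?thesis using kj by blast
  qed
  have a3: "dist x y < r" if "x \<in> Q i" "y \<in> Q i" for x y i
  proof -
    have "dist (ps ! i) x < r / 2" "dist (ps ! i) y < r / 2" using that by (auto simp: Q_def)
    then show ?thesis using dist_triangle3[of x y "ps ! i"] by linarith
  qed
  show thesis
    by (rule that[of "length ps" Q], unfold small_partition_def) (intro conjI allI ballI a1 a2 a3)
qed

lemma (in mpt) avg_sum: "avg (\<lambda>y. \<Sum>i\<in>I. c i * f i y) n x = (\<Sum>i\<in>I. c i * avg (f i) n x)"
  unfolding avg_def by (subst sum.swap) (simp add: sum_divide_distrib sum_distrib_left)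

text \<open>Genericity asks for one null set valid for all continuous \<open>u\<close>, while the
  ergodic theorem gives one per function. The indicators of partitions of mesh 1/(k + 1) form a
  countable family, and step functions built on them approximate every \<open>u\<close>
  uniformly.\<close>

lemma AE_generic:
  fixes \<mu> :: "'a::euclidean_space measure"
  assumes mpt: "mpt \<mu> T" and X: "compact X" "\<And>x. x \<in> X \<Longrightarrow> T x \<in> X" and mX: "emeasure \<mu> X = 1"
    and erg: "\<And>A. A \<in> sets borel \<Longrightarrow> T -` A = A \<Longrightarrow> emeasure \<mu> A = 0 \<or> emeasure \<mu> A = 1"
  shows "AE x in \<mu>. generic T X \<mu> x"
proof -
  interpret mpt \<mu> T by (rule mpt)
  have bX[measurable]: "X \<in> sets borel" using X(1) by (rule borel_compact)
  have "\<forall>k. \<exists>p. small_partition X (inverse (real (Suc k))) (fst p) (snd p)"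
  proof
    fix k
    obtain m Q where "small_partition X (inverse (real (Suc k))) m Q"
      using small_partition_exists[OF X(1) _ bX, of "inverse (real (Suc k))"] by auto
    then show "\<exists>p. small_partition X (inverse (real (Suc k))) (fst p) (snd p)"
      by (intro exI[of _ "(m, Q)"]) simp
  qed
  from choice[OF this] obtain p where p: "\<forall>k. small_partition X (inverse (real (Suc k))) (fst (p k)) (snd (p k))"
    by (rule exE)
  define m where "m k = fst (p k)" for k
  define Q where "Q k i = snd (p k) i" for k i
  have pQ: "small_partition X (inverse (real (Suc k))) (m k) (Q k)" for k
    using p by (simp add: m_def Q_def[abs_def])
  have Qb[measurable]: "Q k i \<in> sets borel" and QX: "Q k i \<subseteq> X"
    and Qun: "x \<in> X \<Longrightarrow> \<exists>!i. i < m k \<and> x \<in> Q k i"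
    and Qd: "x \<in> Q k i \<Longrightarrow> y \<in> Q k i \<Longrightarrow> dist x y < inverse (real (Suc k))" for x y k i
    using pQ[of k] unfolding small_partition_def by blast+
  have "AE x in \<mu>. (\<lambda>n. avg (indicator (Q k i)) n x) \<longlonglongrightarrow> (\<integral>y. indicator (Q k i) y \<partial>\<mu>)" for k i
    by (rule birkhoff_ergodic[OF erg]) (auto simp: indicator_def)
  then have all: "AE x in \<mu>. \<forall>k i. (\<lambda>n. avg (indicator (Q k i)) n x) \<longlonglongrightarrow> (\<integral>y. indicator (Q k i) y \<partial>\<mu>)"
    by (simp add: AE_all_countable)
  have "AE x in \<mu>. x \<in> X" by (rule AE_full[OF bX mX])
  with all show ?thesis
  proof eventually_elim
    fix x assume conv: "\<forall>k i. (\<lambda>n. avg (indicator (Q k i)) n x) \<longlonglongrightarrow> (\<integral>y. indicator (Q k i) y \<partial>\<mu>)" and x: "x \<in> X"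
    have orb: "(T ^^ i) x \<in> X" for i by (induction i) (auto simp: x X)
    show "generic T X \<mu> x"
      unfolding generic_def
    proof (intro allI impI)
      fix u :: "'a \<Rightarrow> real" assume u: "continuous_on X u"
      \<comment> \<open>\<open>u\<close> is constrained only on \<open>X\<close>; extending it by 0
        makes it Borel and matches the set integral in \<open>generic\<close>.\<close>
      define f where "f y = indicator X y *\<^sub>R u y" for y
      have f_meas: "f \<in> borel_measurable borel"
        unfolding f_def[abs_def] using bX u by (rule borel_measurable_continuous_on_indicator)
      obtain b where b: "\<And>y. y \<in> X \<Longrightarrow> \<bar>u y\<bar> \<le> b"
        using compact_imp_bounded[OF compact_continuous_image[OF u X(1)]] unfolding bounded_iff by auto
      have "0 \<le> b" using b[OF x] by simp
      then have fb: "\<bar>f y\<bar> \<le> b" for y using b by (auto simp: f_def indicator_def)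
      have fi: "integrable \<mu> f" by (rule integrable_bounded[OF f_meas fb])
      have "(\<lambda>n. (\<Sum>i<n. u ((T ^^ i) x)) / real n) \<longlonglongrightarrow> (\<integral>y. f y \<partial>\<mu>)"
      proof (rule LIMSEQ_I)
        fix e :: real assume e: "0 < e"
        \<comment> \<open>Three errors: \<open>u\<close> against \<open>v\<close> along the orbit,
          the convergence of the averages of \<open>v\<close>, and \<open>u\<close> against
          \<open>v\<close> in the integral.\<close>
        define \<epsilon> where "\<epsilon> = e / 3"
        have \<epsilon>: "0 < \<epsilon>" using e by (simp add: \<epsilon>_def)
        obtain \<delta> where \<delta>: "0 < \<delta>" "\<And>y z. y \<in> X \<Longrightarrow> z \<in> X \<Longrightarrow> dist z y < \<delta> \<Longrightarrow> dist (u z) (u y) < \<epsilon>"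
          using compact_uniformly_continuous[OF u X(1)] \<epsilon> unfolding uniformly_continuous_on_def by metis
        obtain k where k: "inverse (real (Suc k)) < \<delta>" using reals_Archimedean[OF \<delta>(1)] by blast
        \<comment> \<open>A sample point of each piece; for an empty piece it is arbitrary and its
          value is multiplied by a zero indicator.\<close>
        define q where "q i = (SOME z. z \<in> Q k i)" for i
        define v where "v y = (\<Sum>i<m k. u (q i) * indicator (Q k i) y)" for y
        have uv: "\<bar>f y - v y\<bar> \<le> \<epsilon>" for y
        proof (cases "y \<in> X")
          case True
          obtain i where i: "i < m k" "y \<in> Q k i" "\<And>j. j < m k \<Longrightarrow> y \<in> Q k j \<Longrightarrow> j = i"
            using Qun[OF True, of k] by blast
          have "v y = (\<Sum>j<m k. if j = i then u (q i) else 0)"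
            unfolding v_def
          proof (rule sum.cong[OF refl])
            fix j assume j: "j \<in> {..<m k}"
            show "u (q j) * indicator (Q k j) y = (if j = i then u (q i) else 0)"
            proof (cases "j = i")
              case True
              then show ?thesis using i(2) by simp
            next
              case False
              then have "y \<notin> Q k j" using i(3)[of j] j by blast
              then show ?thesis using False by simp
            qed
          qed
          then have vy: "v y = u (q i)" using i(1) by simp
          have qi: "q i \<in> Q k i" unfolding q_def using i(2) by (rule someI)
          have "dist (u y) (u (q i)) < \<epsilon>"
            using \<delta>(2)[of "q i" y] Qd[OF i(2) qi] k QX qi True by (meson less_trans subsetD)
          then show ?thesis using True vy by (simp add: f_def dist_real_def)
        next
          case False
          then have "y \<notin> Q k i" for i using QX by blast
          then show ?thesis using False \<epsilon> by (simp add: f_def v_def)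
        qed
        have v_meas: "v \<in> borel_measurable borel" unfolding v_def[abs_def] by measurable
        have ii: "integrable \<mu> (indicator (Q k i) :: 'a \<Rightarrow> real)" for i
          by (intro integrable_bounded[where b=1]) (auto simp: indicator_def)
        have vi: "integrable \<mu> v" unfolding v_def[abs_def]
          by (intro Bochner_Integration.integrable_sum integrable_mult_right ii)
        have "\<bar>(\<integral>y. f y \<partial>\<mu>) - (\<integral>y. v y \<partial>\<mu>)\<bar> = \<bar>\<integral>y. f y - v y \<partial>\<mu>\<bar>" using fi vi by simp
        also have "\<dots> \<le> (\<integral>y. \<bar>f y - v y\<bar> \<partial>\<mu>)" by (rule integral_abs_bound)
        also have "\<dots> \<le> (\<integral>y. \<epsilon> \<partial>\<mu>)" using fi vi uv by (intro integral_mono) auto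
        also have "\<dots> = \<epsilon>" using prob by (simp add: space_mu measure_def)
        finally have int: "\<bar>(\<integral>y. f y \<partial>\<mu>) - (\<integral>y. v y \<partial>\<mu>)\<bar> \<le> \<epsilon>" .
        have "avg v n x = (\<Sum>i<m k. u (q i) * avg (indicator (Q k i)) n x)" for n
          unfolding v_def[abs_def] by (rule avg_sum)
        moreover have "(\<lambda>n. \<Sum>i<m k. u (q i) * avg (indicator (Q k i)) n x) \<longlonglongrightarrow>
            (\<Sum>i<m k. u (q i) * (\<integral>y. indicator (Q k i) y \<partial>\<mu>))"
          using conv by (intro tendsto_intros) auto
        moreover have "(\<integral>y. v y \<partial>\<mu>) = (\<Sum>i<m k. u (q i) * (\<integral>y. indicator (Q k i) y \<partial>\<mu>))"
          unfolding v_def using ii by (subst Bochner_Integration.integral_sum) (auto intro: integrable_mult_right simp del: integral_indicator)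
        ultimately have "(\<lambda>n. avg v n x) \<longlonglongrightarrow> (\<integral>y. v y \<partial>\<mu>)" by simp
        from LIMSEQ_D[OF this \<epsilon>] obtain n0 where n0: "\<And>n. n0 \<le> n \<Longrightarrow> norm (avg v n x - (\<integral>y. v y \<partial>\<mu>)) < \<epsilon>" by blast
        have "norm ((\<Sum>i<n. u ((T ^^ i) x)) / real n - (\<integral>y. f y \<partial>\<mu>)) < e" if n: "max 1 n0 \<le> n" for n
        proof -
          have "(\<Sum>i<n. u ((T ^^ i) x)) / real n - avg v n x = (\<Sum>i<n. f ((T ^^ i) x) - v ((T ^^ i) x)) / real n"
            using orb by (simp add: avg_def f_def sum_subtractf diff_divide_distrib)
          moreover have "\<bar>\<Sum>i<n. f ((T ^^ i) x) - v ((T ^^ i) x)\<bar> \<le> (\<Sum>i<n. \<epsilon>)"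
            by (rule order.trans[OF sum_abs]) (intro sum_mono uv)
          ultimately have "\<bar>(\<Sum>i<n. u ((T ^^ i) x)) / real n - avg v n x\<bar> \<le> \<epsilon>"
            using n by (simp add: abs_divide divide_le_eq mult.commute)
          then show ?thesis using n0[of n] n int by (simp add: \<epsilon>_def abs_le_iff abs_less_iff) argo
        qed
        then show "\<exists>no. \<forall>n\<ge>no. norm ((\<Sum>i<n. u ((T ^^ i) x)) / real n - (\<integral>y. f y \<partial>\<mu>)) < e" by blast
      qed
      then show "(\<lambda>n. (\<Sum>i<n. u ((T ^^ i) x)) / real n) \<longlonglongrightarrow> (LINT y:X|\<mu>. u y)"
        by (simp add: set_lebesgue_integral_def f_def[abs_def])
    qed
  qed
qed

lemma generic_shift:
  assumes X: "compact X" "x \<in> X" "\<And>y. y \<in> X \<Longrightarrow> T y \<in> X" and gen: "generic T X \<mu> (T x)"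
  shows "generic T X \<mu> x"
  unfolding generic_def
proof (intro allI impI)
  fix u :: "'a \<Rightarrow> real" assume u: "continuous_on X u"
  have orb: "(T ^^ i) x \<in> X" for i by (induction i) (auto simp: X)
  obtain b where b: "\<And>y. y \<in> X \<Longrightarrow> \<bar>u y\<bar> \<le> b"
    using compact_imp_bounded[OF compact_continuous_image[OF u X(1)]] unfolding bounded_iff by auto
  have "(\<lambda>n. (\<Sum>i<n. u ((T ^^ i) (T x))) / real n) \<longlonglongrightarrow> (LINT y:X|\<mu>. u y)"
    using gen u unfolding generic_def by blast
  from tendsto_diff[OF this average_shift_null[of u T x b]] b orb
  show "(\<lambda>n. (\<Sum>i<n. u ((T ^^ i) x)) / real n) \<longlonglongrightarrow> (LINT y:X|\<mu>. u y)" by simp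
qed

lemma generic_funpow:
  assumes "compact X" "x \<in> X" "\<And>y. y \<in> X \<Longrightarrow> T y \<in> X" "generic T X \<mu> ((T ^^ n) x)"
  shows "generic T X \<mu> x"
  using assms(2,4)
proof (induction n arbitrary: x)
  case (Suc n)
  have "(T ^^ Suc n) x = (T ^^ n) (T x)" by (simp add: funpow_swap1)
  then have "generic T X \<mu> ((T ^^ n) (T x))" using Suc.prems(2) by metis
  then have gen: "generic T X \<mu> (T x)" by (rule Suc.IH[OF assms(3)[OF Suc.prems(1)]])
  show ?case by (rule generic_shift[OF assms(1) Suc.prems(1) _ gen]) (rule assms(3))
qed simp

context simplicial_system
begin

section \<open>Stationary vectors and invariant measures of terminal classes\<close>

abbreviation "\<Gamma> \<equiv> Gamma Ks K \<gamma> d"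
abbreviation "v B \<equiv> vB Ks K \<gamma> d B"
abbreviation "\<mu> B \<equiv> lamB Ks K \<gamma> d B"

lemma Gamma_sons: "\<Gamma> t s = (\<Sum>a\<in>{a \<in> sons s. \<gamma> ` a = t}. nu K d a)"
  unfolding Gamma_def sons_def by (rule sum.cong) auto

lemma Gamma_nonneg: "0 \<le> \<Gamma> t s"
  unfolding Gamma_sons using nu_pos sons_E by (intro sum_nonneg) (auto intro: less_imp_le)

lemma Gamma_pos: assumes "(s, t) \<in> G" shows "0 < \<Gamma> t s"
proof -
  obtain a where a: "a \<in> sons s" "\<gamma> ` a = t" using assms by (auto simp: G_sons)
  show ?thesis unfolding Gamma_sons
    using a nu_pos sons_E by (intro sum_pos) auto
qed

lemma Gamma_zero: "(s, t) \<notin> G \<Longrightarrow> \<Gamma> t s = 0"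
  unfolding Gamma_sons G_sons by (intro sum.neutral) auto

text \<open>Turns sums over states into sums over sons, so that the branch formula of
  \<open>P_vimage\<close> becomes the action of the matrix.\<close>

lemma Gamma_group:
  assumes "finite T" "\<And>a. a \<in> sons s \<Longrightarrow> \<gamma> ` a \<in> T"
  shows "(\<Sum>t\<in>T. \<Gamma> t s * h t) = (\<Sum>a\<in>sons s. nu K d a * h (\<gamma> ` a))"
proof -
  have "(\<Sum>t\<in>T. \<Gamma> t s * h t) = (\<Sum>t\<in>T. \<Sum>a\<in>{a \<in> sons s. \<gamma> ` a = t}. nu K d a * h (\<gamma> ` a))"
    unfolding Gamma_sons sum_distrib_right by (intro sum.cong) auto
  also have "\<dots> = (\<Sum>a\<in>sons s. nu K d a * h (\<gamma> ` a))"
    by (rule sum.group) (use assms in auto)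
  finally show ?thesis .
qed

lemma Gamma_irreducible:
  assumes B: "B \<in> TB" and st: "s \<in> B" "t \<in> B"
  shows "(s, t) \<in> {(s, t). s \<in> B \<and> t \<in> B \<and> 0 < \<Gamma> t s}\<^sup>+"
  using TB_trancl[OF B st]
proof (induction rule: trancl_induct)
  case (base t)
  then show ?case using TB_closed[OF B st(1) r_into_rtrancl] Gamma_pos st(1) by (intro r_into_trancl) auto
next
  case (step t u)
  have "t \<in> B" using TB_closed[OF B st(1) trancl_into_rtrancl[OF step(1)]] .
  then have "(t, u) \<in> {(s, t). s \<in> B \<and> t \<in> B \<and> 0 < \<Gamma> t s}"
    using TB_closed[OF B _ r_into_rtrancl[OF step(2)]] Gamma_pos[OF step(2)] by simp
  then show ?case by (rule trancl_into_trancl[OF step(3)])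
qed

lemma Gamma_stochastic: "B \<in> TB \<Longrightarrow> s \<in> B \<Longrightarrow> (\<Sum>t\<in>B. \<Gamma> t s) = 1"
  using Gamma_group[of B s "\<lambda>_. 1"] finite_TB TB_sons nu_sum[OF TB_D] by simp

text \<open>The definite description concerns vectors on all of \<open>D\<close>, whereas
  irreducibility holds on \<open>B\<close>. Solutions restrict to \<open>B\<close> and extend from
  it by zero, so existence and uniqueness carry over and the description denotes.\<close>

lemma vB_props:
  assumes B: "B \<in> TB"
  shows "s \<in> B \<Longrightarrow> 0 < v B s" "sum (v B) B = 1" "t \<in> B \<Longrightarrow> (\<Sum>s\<in>B. \<Gamma> t s * v B s) = v B t"
proof -
  note finB = finite_TB[OF B] and BD = TB_subset[OF B]
  define St where "St w \<longleftrightarrow> (\<forall>s. s \<notin> D \<longrightarrow> w s = 0) \<and> (\<forall>s\<in>D. 0 \<le> w s) \<and> sum w D = 1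
      \<and> {s \<in> D. w s \<noteq> 0} = B \<and> (\<forall>s2\<in>D. (\<Sum>s1\<in>D. \<Gamma> s2 s1 * w s1) = w s2)" for w
  have restr: "sum w D = sum w B" "(\<Sum>s\<in>D. \<Gamma> t s * w s) = (\<Sum>s\<in>B. \<Gamma> t s * w s)"
    if "\<And>s. s \<notin> B \<Longrightarrow> w s = 0" for w :: "'a set \<Rightarrow> real" and t
    using BD that by (auto intro!: sum.mono_neutral_right)
  have StB: "(\<forall>s. s \<notin> B \<longrightarrow> w s = 0) \<and> (\<forall>s\<in>B. 0 < w s) \<and> sum w B = 1 \<and> (\<forall>t\<in>B. (\<Sum>s\<in>B. \<Gamma> t s * w s) = w t)"
    if w: "St w" for w
  proof -
    have z: "w s = 0" if "s \<notin> B" for s using w that unfolding St_def by blast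
    have "0 < w s" if "s \<in> B" for s
    proof -
      have "w s \<noteq> 0" using w that unfolding St_def by blast
      moreover have "0 \<le> w s" using w that BD unfolding St_def by blast
      ultimately show ?thesis by simp
    qed
    moreover have "sum w B = 1" using w restr(1)[OF z] unfolding St_def by simp
    moreover have "(\<Sum>s\<in>B. \<Gamma> t s * w s) = w t" if "t \<in> B" for t
    proof -
      have "\<forall>s2\<in>D. (\<Sum>s1\<in>D. \<Gamma> s2 s1 * w s1) = w s2" using w unfolding St_def by simp
      then have "(\<Sum>s\<in>D. \<Gamma> t s * w s) = w t" using that BD by (simp add: subset_iff)
      then show ?thesis using restr(2)[OF z] by simp
    qed
    ultimately show ?thesis using z by blast
  qed
  obtain w where w: "\<And>s. s \<in> B \<Longrightarrow> 0 \<le> w s" "sum w B = 1" "\<And>t. t \<in> B \<Longrightarrow> (\<Sum>s\<in>B. \<Gamma> t s * w s) = w t"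
    using stationary_exists[of B \<Gamma>] finB TB_nonempty[OF B] Gamma_nonneg Gamma_stochastic[OF B] by blast
  have "\<exists>s\<in>B. 0 < w s"
  proof (rule ccontr)
    assume "\<not> (\<exists>s\<in>B. 0 < w s)"
    then have "w s = 0" if "s \<in> B" for s using w(1)[OF that] that by force
    then show False using w(2) by simp
  qed
  then obtain b where b: "b \<in> B" "0 < w b" by blast
  have wpos: "0 < w t" if "t \<in> B" for t
    by (rule stationary_pos[OF finB Gamma_nonneg w(1,3) b(2) Gamma_irreducible[OF B b(1) that]])
  define w' where "w' s = (if s \<in> B then w s else 0)" for s
  have w'B: "w' s = w s" if "s \<in> B" for s using that by (simp add: w'_def)
  have w'z: "w' s = 0" if "s \<notin> B" for s using that by (simp add: w'_def)
  have "St w'"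
    unfolding St_def
  proof (intro conjI allI ballI impI)
    show "w' s = 0" if "s \<notin> D" for s using that BD by (intro w'z) blast
    show "0 \<le> w' s" for s using w(1) by (simp add: w'_def)
    show "sum w' D = 1" using w(2) restr(1)[OF w'z] w'B by simp
    have "w' s \<noteq> 0 \<longleftrightarrow> s \<in> B" for s using wpos[of s] by (auto simp: w'_def)
    then show "{s \<in> D. w' s \<noteq> 0} = B" using BD by blast
    fix t assume t: "t \<in> D"
    have "(\<Sum>s\<in>D. \<Gamma> t s * w' s) = (\<Sum>s\<in>B. \<Gamma> t s * w s)" using restr(2)[OF w'z] w'B by simp
    also have "\<dots> = w' t"
    proof (cases "t \<in> B")
      case True
      then show ?thesis using w(3) w'B by simp
    next
      case False
      \<comment> \<open>No edge leaves a terminal class, so extension by zero is stationary off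
        \<open>B\<close> as well.\<close>
      then have "\<Gamma> t s = 0" if "s \<in> B" for s
        using TB_closed[OF B that r_into_rtrancl] by (intro Gamma_zero) blast
      then show ?thesis using w'z[OF False] by simp
    qed
    finally show "(\<Sum>s\<in>D. \<Gamma> t s * w' s) = w' t" .
  qed
  moreover have "u = w'" if u: "St u" for u
  proof
    fix s
    show "u s = w' s"
    proof (cases "s \<in> B")
      case True
      show ?thesis
        by (rule stationary_unique[OF finB TB_nonempty[OF B] Gamma_nonneg Gamma_irreducible[OF B] _ _ _ _ _ _ True])
          (use StB[OF u] StB[OF \<open>St w'\<close>] in auto)
    next
      case False
      then show ?thesis using StB[OF u] w'z by simp
    qed
  qed
  moreover have "v B = (THE w. St w)" unfolding vB_def St_def ..
  ultimately have "St (v B)" by (metis the_equality)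
  then show "s \<in> B \<Longrightarrow> 0 < v B s" "sum (v B) B = 1" "t \<in> B \<Longrightarrow> (\<Sum>s\<in>B. \<Gamma> t s * v B s) = v B t"
    using StB by blast+
qed

lemma sets_lamB [simp, measurable_cong]: "sets (\<mu> B) = sets borel" and space_lamB [simp]: "space (\<mu> B) = UNIV"
  by (simp_all add: lamB_def)

lemma emeasure_lamB:
  assumes "B \<in> TB" "A \<in> sets borel"
  shows "emeasure (\<mu> B) A = ennreal (\<Sum>s\<in>B. v B s * P s A)"
  unfolding lamB_def using vB_props(1)[OF assms(1)]
  by (intro emeasure_mixture_real assms(2)) (auto intro: less_imp_le)

text \<open>\<open>P_vimage\<close> turns the preimage into an application of
  \<open>\<Gamma>\<close>, and \<open>v B\<close> is fixed by it.\<close>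

lemma lamB_invariant:
  assumes B: "B \<in> TB" and A: "A \<in> sets borel"
  shows "emeasure (\<mu> B) (g -` A) = emeasure (\<mu> B) A"
proof -
  have "(\<Sum>s\<in>B. v B s * P s (g -` A)) = (\<Sum>s\<in>B. v B s * (\<Sum>t\<in>B. \<Gamma> t s * P t A))"
    using P_vimage[OF TB_D[OF B] A] Gamma_group[OF finite_TB[OF B] TB_sons[OF B], where h = "\<lambda>t. P t A"] by simp
  also have "\<dots> = (\<Sum>t\<in>B. (\<Sum>s\<in>B. \<Gamma> t s * v B s) * P t A)"
    unfolding sum_distrib_left sum_distrib_right by (subst sum.swap) (simp add: mult_ac)
  also have "\<dots> = (\<Sum>t\<in>B. v B t * P t A)" using vB_props(3)[OF B] by simp
  finally show ?thesis using A by (simp add: emeasure_lamB[OF B])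
qed

lemma lamB_one:
  assumes B: "B \<in> TB" and A: "A \<in> sets borel" "\<And>s. s \<in> B \<Longrightarrow> P s A = 1"
  shows "emeasure (\<mu> B) A = 1"
  using emeasure_lamB[OF B A(1)] A(2) vB_props(2)[OF B] by simp

text \<open>Each weight \<open>v B s\<close> is positive, so no simplex of \<open>B\<close> can hide
  mass.\<close>

lemma lamB_zero:
  assumes B: "B \<in> TB" and A: "A \<in> sets borel"
  shows "emeasure (\<mu> B) A = 0 \<longleftrightarrow> (\<forall>s\<in>B. P s A = 0)"
proof -
  have nn: "0 \<le> v B s * P s A" if "s \<in> B" for s using vB_props(1)[OF B that] by simp
  have "emeasure (\<mu> B) A = 0 \<longleftrightarrow> (\<Sum>s\<in>B. v B s * P s A) = 0"
    using sum_nonneg[of B "\<lambda>s. v B s * P s A"] nn by (simp add: emeasure_lamB[OF B A] ennreal_eq_0_iff antisym_conv)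
  also have "\<dots> \<longleftrightarrow> (\<forall>s\<in>B. v B s * P s A = 0)"
    using finite_TB[OF B] nn by (simp add: sum_nonneg_eq_0_iff)
  also have "\<dots> \<longleftrightarrow> (\<forall>s\<in>B. P s A = 0)" using vB_props(1)[OF B] by fastforce
  finally show ?thesis .
qed

lemma P_X: "s \<in> D \<Longrightarrow> P s X = 1"
  using P_mono[OF hull_sub_X X_borel, of s s] P_hull[of s] P_le_1[of s X] by simp

lemma lamB_zero_one:
  assumes B: "B \<in> TB" and A: "A \<in> sets borel" "g -` A = A"
  shows "emeasure (\<mu> B) A = 0 \<or> emeasure (\<mu> B) A = 1"
  using zero_one[OF B A] lamB_zero[OF B A(1)] lamB_one[OF B A(1)] by blast

lemma lamB_ergodic: assumes B: "B \<in> TB" shows "ergodic g X (\<mu> B)"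
  unfolding ergodic_def invariant_prob_def
  using lamB_one[OF B, of UNIV] lamB_one[OF B, of X] P_UNIV P_X TB_D[OF B] lamB_invariant[OF B]
    lamB_zero_one[OF B] by (simp add: g_borel)

lemma lamB_mpt: "B \<in> TB \<Longrightarrow> mpt (\<mu> B) g"
  using lamB_ergodic[of B] unfolding ergodic_def invariant_prob_def mpt_def by simp

lemma lamB_generic: "B \<in> TB \<Longrightarrow> AE x in \<mu> B. generic g X (\<mu> B) x"
  using lamB_ergodic[of B] unfolding ergodic_def invariant_prob_def
  by (intro AE_generic lamB_mpt compact_X g_X) blast+

lemma closed_UN_hull: "B \<in> TB \<Longrightarrow> closed (\<Union>s\<in>B. convex hull s)"
  using TB_D by (intro closed_UN finite_TB) (auto intro: compact_imp_closed)

lemma lamB_support: assumes B: "B \<in> TB" shows "support (\<mu> B) = (\<Union>s\<in>B. convex hull s)"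
proof (intro equalityI subsetI)
  let ?W = "\<Union>s\<in>B. convex hull s"
  fix x assume x: "x \<in> support (\<mu> B)"
  show "x \<in> ?W"
  proof (rule ccontr)
    assume "x \<notin> ?W"
    then have "0 < emeasure (\<mu> B) (- ?W)"
      using x open_Compl[OF closed_UN_hull[OF B]] unfolding support_def by blast
    moreover have "P s (- ?W) = 0" if s: "s \<in> B" for s
    proof -
      note sD = TB_D[OF B s]
      have "P s (- ?W) = P s (convex hull s \<inter> - ?W)"
        by (rule P_inter_hull[OF sD borel_open[OF open_Compl[OF closed_UN_hull[OF B]]], symmetric])
      also have "convex hull s \<inter> - ?W = {}" using s by auto
      finally show ?thesis by simp
    qed
    ultimately show False using lamB_zero[OF B borel_open[OF open_Compl[OF closed_UN_hull[OF B]]]] by simp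
  qed
next
  fix x assume "x \<in> (\<Union>s\<in>B. convex hull s)"
  then obtain s where s: "s \<in> B" "x \<in> convex hull s" by auto
  have "0 < emeasure (\<mu> B) U" if U: "open U" "x \<in> U" for U
  proof -
    have "P s U \<noteq> 0" using measure_lam_open_pos[OF nsimplex_D[OF TB_D[OF B s(1)]] U s(2)] by simp
    then have "emeasure (\<mu> B) U \<noteq> 0" using lamB_zero[OF B, of U] U(1) s(1) by auto
    then show ?thesis by (simp add: zero_less_iff_neq_zero)
  qed
  then show "x \<in> support (\<mu> B)" unfolding support_def by blast
qed

text \<open>Terminality puts all sons of a simplex of \<open>B\<close> into \<open>Bstar\<close>,
  and the sons cover it.\<close>

lemma UN_Bstar:
  assumes B: "B \<in> TB" shows "(\<Union>s\<in>B. convex hull s) = (\<Union>ss\<in>Bstar Ks K \<gamma> d B. convex hull ss)"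
proof (intro equalityI subsetI)
  fix x assume "x \<in> (\<Union>s\<in>B. convex hull s)"
  then obtain s where s: "s \<in> B" "x \<in> convex hull s" by auto
  then obtain a where a: "a \<in> sons s" "x \<in> convex hull a" using hull_sons[OF TB_D[OF B s(1)]] by auto
  have "a \<in> Bstar Ks K \<gamma> d B"
    unfolding Bstar_def using TB_sons[OF B s(1) a(1)] sons_E[OF a(1)] sons_J[OF a(1)] s(1) by simp
  then show "x \<in> (\<Union>ss\<in>Bstar Ks K \<gamma> d B. convex hull ss)" using a(2) by blast
next
  fix x assume "x \<in> (\<Union>ss\<in>Bstar Ks K \<gamma> d B. convex hull ss)"
  then obtain a where a: "a \<in> E" "J a \<in> B" "x \<in> convex hull a" by (auto simp: Bstar_def)
  then show "x \<in> (\<Union>s\<in>B. convex hull s)" using J_D(2)[OF a(1)] by blast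
qed

text \<open>The measure of \<open>N\<close> is a subharmonic function on the states, and its maximum propagates to a terminal class.\<close>
lemma P_max_principle:
  assumes N: "N \<in> sets borel" "N \<subseteq> g -` N" and z: "\<And>B s. B \<in> TB \<Longrightarrow> s \<in> B \<Longrightarrow> P s N = 0"
    and s: "s \<in> D"
  shows "P s N = 0"
proof -
  define m where "m = Max ((\<lambda>s. P s N) ` D)"
  have m: "P t N \<le> m" if "t \<in> D" for t
    unfolding m_def using that by (intro Max_ge) auto
  have "m \<in> (\<lambda>s. P s N) ` D" unfolding m_def using s by (intro Max_in) auto
  then obtain u where u: "u \<in> D" "P u N = m" by auto
  obtain B t where t: "B \<in> TB" "t \<in> B" "(u, t) \<in> G\<^sup>*" using reaches_terminal[OF u(1)] .
  have "t \<in> D \<and> P t N = m"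
    using t(3)
  proof (induction rule: rtrancl_induct)
    case (step y w)
    then have y: "y \<in> D" "P y N = m" by auto
    obtain a where a: "a \<in> sons y" "w = \<gamma> ` a" using step(2) by (auto simp: G_sons)
    have w: "w \<in> D" using a image_D[OF sons_E] by simp
    have "P y N \<le> P y (g -` N)" using N by (intro P_mono) auto
    then have "m \<le> (\<Sum>a\<in>sons y. nu K d a * P (\<gamma> ` a) N)"
      using P_vimage[OF y(1) N(1)] y(2) by simp
    from nu_average_max[OF y(1) m this a(1)] have "P w N = m" using a(2) by simp
    then show ?case using w by blast
  qed (use u in simp)
  then have "m = 0" using z[OF t(1,2)] by simp
  then show ?thesis using m[OF s] measure_nonneg[of "lam s" N] by simp
qed

text \<open>A point whose orbit ever leaves the exceptional set of some terminal class is generic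
  for the measure of that class. The remaining set \<open>N\<close> is mapped into itself and is
  null on every terminal simplex; the maximum principle makes it null on all simplices.\<close>

lemma AE_generic_D:
  assumes w: "\<And>s. s \<in> D \<Longrightarrow> 0 \<le> w s"
  shows "AE x in mixture w D. \<exists>B\<in>TB. generic g X (\<mu> B) x"
proof -
  have "\<forall>B\<in>TB. \<exists>N. N \<in> sets borel \<and> emeasure (\<mu> B) N = 0 \<and> (\<forall>x. x \<notin> N \<longrightarrow> generic g X (\<mu> B) x)"
  proof
    fix B assume B: "B \<in> TB"
    obtain N where "{x \<in> space (\<mu> B). \<not> generic g X (\<mu> B) x} \<subseteq> N" "emeasure (\<mu> B) N = 0" "N \<in> sets (\<mu> B)"
      using lamB_generic[OF B] by (rule AE_E)
    then show "\<exists>N. N \<in> sets borel \<and> emeasure (\<mu> B) N = 0 \<and> (\<forall>x. x \<notin> N \<longrightarrow> generic g X (\<mu> B) x)"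
      by (intro exI[of _ N]) auto
  qed
  from bchoice[OF this] obtain N0 where N0: "\<forall>B\<in>TB. N0 B \<in> sets borel \<and> emeasure (\<mu> B) (N0 B) = 0
    \<and> (\<forall>x. x \<notin> N0 B \<longrightarrow> generic g X (\<mu> B) x)" by (rule exE)
  have gm: "(g ^^ n) -` A \<in> sets borel" if "A \<in> sets borel" for n A
    using that by (induction n arbitrary: A) (auto simp: vimage_comp[symmetric])
  define N where "N = (\<Inter>n. \<Inter>B\<in>TB. (g ^^ n) -` N0 B) \<inter> X"
  have "- (\<Inter>n. \<Inter>B\<in>TB. (g ^^ n) -` N0 B) = (\<Union>n. \<Union>B\<in>TB. (g ^^ n) -` (- N0 B))" by auto
  also have "\<dots> \<in> sets borel"
  proof -
    have "(\<Union>B\<in>TB. (g ^^ n) -` (- N0 B)) \<in> sets borel" for n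
      using N0 by (intro sets.finite_UN finite_TBs gm) auto
    then show ?thesis by (intro sets.countable_UN) auto
  qed
  finally have "(\<Inter>n. \<Inter>B\<in>TB. (g ^^ n) -` N0 B) \<in> sets borel"
    using borel_comp by fastforce
  then have Nb: "N \<in> sets borel" unfolding N_def by (rule sets.Int) (rule X_borel)
  have "P s N = 0" if s: "s \<in> D" for s
  proof (rule P_max_principle[OF Nb _ _ s])
    show "N \<subseteq> g -` N"
    proof
      fix x assume x: "x \<in> N"
      have "(g ^^ n) (g x) \<in> N0 B" if "B \<in> TB" for n B
        using x that unfolding N_def by (auto simp: funpow_swap1 dest!: spec[of _ "Suc n"])
      then show "x \<in> g -` N" using x g_X unfolding N_def by auto
    qed
    fix B t assume Bt: "B \<in> TB" "t \<in> B"
    have b: "N0 B \<in> sets borel" "emeasure (\<mu> B) (N0 B) = 0" using N0 Bt(1) by auto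
    have "N \<subseteq> N0 B" unfolding N_def using Bt(1) by (auto dest!: spec[of _ 0])
    then have "P t N \<le> P t (N0 B)" using b(1) by (rule P_mono)
    also have "P t (N0 B) = 0" using lamB_zero[OF Bt(1) b(1)] b(2) Bt(2) by simp
    finally show "P t N = 0" by (simp add: measure_le_0_iff)
  qed
  \<comment> \<open>\<open>generic_funpow\<close> applies inside \<open>X\<close> only, so the
    complement is discarded separately.\<close>
  moreover have "P s (- X) = 0" if s: "s \<in> D" for s
  proof -
    have "P s (- X) = P s (convex hull s \<inter> - X)"
      using X_borel by (intro P_inter_hull[OF s, symmetric]) auto
    also have "convex hull s \<inter> - X = {}" using hull_sub_X[OF s] by auto
    finally show ?thesis by simp
  qed
  ultimately have P0: "P s (N \<union> - X) = 0" if "s \<in> D" for s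
    using measure_Un_le[of N "lam s" "- X"] Nb that
    by (simp add: measure_le_0_iff)
  have Nb: "N \<union> - X \<in> sets borel" using Nb by auto
  have "emeasure (mixture w D) (N \<union> - X) = 0"
    using emeasure_mixture_real[OF Nb w] P0 by simp
  then have "N \<union> - X \<in> null_sets (mixture w D)" using Nb by (simp add: null_sets_def)
  then show ?thesis
  proof (rule AE_I', intro subsetI)
    fix x assume x: "x \<in> {x \<in> space (mixture w D). \<not> (\<exists>B\<in>TB. generic g X (\<mu> B) x)}"
    show "x \<in> N \<union> - X"
    proof (cases "x \<in> X")
      case True
      have "(g ^^ n) x \<in> N0 B" if B: "B \<in> TB" for n B
      proof (rule ccontr)
        assume "(g ^^ n) x \<notin> N0 B"
        then have "generic g X (\<mu> B) ((g ^^ n) x)" using N0 B by blast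
        then have "generic g X (\<mu> B) x" by (rule generic_funpow[OF compact_X True g_X, rotated])
        then show False using x B by blast
      qed
      then show ?thesis using True unfolding N_def by blast
    qed simp
  qed
qed

text \<open>The union of the hulls of \<open>B\<close> is closed and mapped into itself, so orbits
  starting there have their limits there, inside one chain class. The basin has interior because the
  part of \<open>s\<close> not covered by other \<open>d\<close>-simplices is relatively
  open.\<close>

lemma terminal_visible:
  assumes B: "B \<in> TB" shows "\<exists>W. visible g X W \<and> support (\<mu> B) \<subseteq> W"
proof -
  let ?C = "chain_rel g X" and ?U = "\<Union>s\<in>B. convex hull s"
  obtain s where s: "s \<in> B" using TB_nonempty[OF B] by auto
  note sD = TB_D[OF B s]
  define V where "V = X \<inter> - (\<Union>t\<in>D - {s}. convex hull t)"
  have cl: "closed (\<Union>t\<in>D - {s}. convex hull t)"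
    by (intro closed_UN) (auto intro: compact_imp_closed)
  have Vs: "V \<subseteq> convex hull s" unfolding V_def X_D by blast
  \<comment> \<open>The other simplices cover only a null part of \<open>s\<close>.\<close>
  have "V \<noteq> {}"
  proof
    assume "V = {}"
    then have "convex hull s \<subseteq> (\<Union>t\<in>D - {s}. convex hull t)" using hull_sub_X[OF sD] unfolding V_def by blast
    then have "P s (convex hull s) \<le> P s (\<Union>t\<in>D - {s}. convex hull t)"
      using cl by (intro P_mono) auto
    also have "\<dots> \<le> (\<Sum>t\<in>D - {s}. P s (convex hull t))" by (intro measure_UNION_le) auto
    also have "\<dots> = 0" using P_distinct[OF sD] by (intro sum.neutral) auto
    finally show False using P_hull[OF sD] by simp
  qed
  then obtain x where x: "x \<in> V" by auto
  then have xU: "x \<in> ?U" using Vs s by blast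
  define W where "W = {y. (y, y) \<in> ?C \<and> (x, y) \<in> ?C \<and> (y, x) \<in> ?C}"
  have UW: "?U \<subseteq> W"
  proof
    fix y assume y: "y \<in> ?U"
    show "y \<in> W" unfolding W_def using terminal_chain[OF B y y] terminal_chain[OF B xU y] terminal_chain[OF B y xU] by simp
  qed
  have "W \<in> basic_sets g X"
    unfolding basic_sets_def Let_def W_def using terminal_chain[OF B xU xU] by blast
  moreover have "x \<in> basin g X W"
  proof -
    have gU: "g y \<in> ?U" if y: "y \<in> ?U" for y
    proof -
      obtain t where t: "t \<in> B" "y \<in> convex hull t" using y by auto
      then obtain a where a: "a \<in> sons t" "y \<in> convex hull a" using hull_sons[OF TB_D[OF B t(1)]] by auto
      show ?thesis using g_into[OF sons_E[OF a(1)] a(2)] TB_sons[OF B t(1) a(1)] by blast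
    qed
    have omega: "omega_limit g y \<subseteq> W" if y: "y \<in> ?U" for y
    proof
      fix z assume z: "z \<in> omega_limit g y"
      have orb: "(g ^^ n) y \<in> ?U" for n by (induction n) (use y gU in auto)
      have "z \<in> closure ?U"
        unfolding closure_approachable
      proof (intro allI impI)
        fix e :: real assume "0 < e"
        then obtain n where "dist ((g ^^ n) y) z < e" using z unfolding omega_limit_def by blast
        then show "\<exists>y\<in>?U. dist y z < e" using orb by blast
      qed
      then show "z \<in> W" using closure_closed[OF closed_UN_hull[OF B]] UW by blast
    qed
    have "V \<subseteq> {x \<in> X. omega_limit g x \<subseteq> W}"
    proof
      fix y assume y: "y \<in> V"
      then have "y \<in> ?U" using Vs s by blast
      then show "y \<in> {x \<in> X. omega_limit g x \<subseteq> W}" using omega y unfolding V_def by blast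
    qed
    moreover have "openin (top_of_set X) V"
      unfolding V_def by (intro openin_open_Int open_Compl cl)
    ultimately have "V \<subseteq> basin g X W" unfolding basin_def by (rule interior_of_maximal)
    then show ?thesis using x by blast
  qed
  ultimately have "visible g X W" unfolding visible_def by blast
  then show ?thesis using UW lamB_support[OF B] by blast
qed

text \<open>Every simplex \<open>u\<close> misses one of the two classes, and the hulls of that
  class meet \<open>u\<close> in null faces only.\<close>

lemma support_overlap_null:
  assumes B: "B \<in> TB" "B' \<in> TB" "B \<noteq> B'" and w: "\<And>s. s \<in> D \<Longrightarrow> 0 \<le> w s"
  shows "emeasure (mixture w D) (support (\<mu> B) \<inter> support (\<mu> B')) = 0"
proof -
  let ?I = "(\<Union>s\<in>B. convex hull s) \<inter> (\<Union>s\<in>B'. convex hull s)"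
  have Ib: "?I \<in> sets borel" using closed_UN_hull[OF B(1)] closed_UN_hull[OF B(2)] by (intro sets.Int) auto
  have "P u ?I = 0" if u: "u \<in> D" for u
  proof -
    obtain B0 where B0: "B0 \<in> TB" "u \<notin> B0" "?I \<subseteq> (\<Union>s\<in>B0. convex hull s)"
      using TB_disjoint[OF B(1,2), of u] B by blast
    have "P u ?I \<le> P u (\<Union>s\<in>B0. convex hull s)"
      using B0(3) closed_UN_hull[OF B0(1)] by (intro P_mono) auto
    also have "\<dots> \<le> (\<Sum>s\<in>B0. P u (convex hull s))"
      using finite_TB[OF B0(1)] TB_D[OF B0(1)] by (intro measure_UNION_le) auto
    also have "\<dots> = 0"
    proof (intro sum.neutral ballI P_distinct[OF u])
      fix s assume "s \<in> B0"
      then show "s \<in> D" "u \<noteq> s" using TB_D[OF B0(1)] B0(2) by auto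
    qed
    finally show ?thesis by (simp add: measure_le_0_iff)
  qed
  then show ?thesis
    using emeasure_mixture_real[OF Ib w] lamB_support[OF B(1)] lamB_support[OF B(2)] by simp
qed

theorem system_tractable:
  assumes w: "\<And>s. s \<in> D \<Longrightarrow> 0 \<le> w s"
  shows "tractable g X (mixture w D) TB (lamB Ks K \<gamma> d)"
  unfolding tractable_def
  using finite_basic_sets finite_TBs lamB_ergodic AE_generic_D[of w] terminal_visible support_overlap_null[of _ _ w] w
  by blast

end

theorem theorem4p12:
  fixes K Ks :: "'a::euclidean_space set set" and \<gamma> :: "'a \<Rightarrow> 'a" and d :: nat
    and v0 :: "'a set \<Rightarrow> real"
  assumes "complex K" and "complex Ks" and "proper_subdivision Ks K"
    and "simplicial_map Ks K \<gamma>" and "nondegenerate Ks \<gamma>"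
    and "d \<ge> 1" and "everywhere_dim K d"
    and "\<forall>s\<in>dsimp K d. 0 < v0 s" and "sum v0 (dsimp K d) = 1"
  shows "(\<forall>B\<in>terminal_basic_sets Ks K \<gamma> d.
            ergodic (plmap Ks \<gamma>) (polyhedron K) (lamB Ks K \<gamma> d B)
          \<and> support (lamB Ks K \<gamma> d B) = (\<Union>s\<in>B. convex hull s)
          \<and> (\<Union>s\<in>B. convex hull s) = (\<Union>ss\<in>Bstar Ks K \<gamma> d B. convex hull ss))
       \<and> tractable (plmap Ks \<gamma>) (polyhedron K) (mixture v0 (dsimp K d))
           (terminal_basic_sets Ks K \<gamma> d) (lamB Ks K \<gamma> d)"
proof -
  interpret simplicial_system K Ks \<gamma> d
    using assms by unfold_locales
  have v0: "0 \<le> v0 s" if "s \<in> dsimp K d" for s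
    using assms(8) that by (auto intro: less_imp_le)
  show ?thesis
  proof (intro conjI ballI)
    fix B assume B: "B \<in> terminal_basic_sets Ks K \<gamma> d"
    show "ergodic g X (lamB Ks K \<gamma> d B)" by (rule lamB_ergodic[OF B])
    show "support (lamB Ks K \<gamma> d B) = (\<Union>s\<in>B. convex hull s)" by (rule lamB_support[OF B])
    show "(\<Union>s\<in>B. convex hull s) = (\<Union>ss\<in>Bstar Ks K \<gamma> d B. convex hull ss)" by (rule UN_Bstar[OF B])
  qed (rule system_tractable, rule v0)
qed

end
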